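(* Let $R$ be a principal ideal domain and let $T^*$ be a complete $L_R$-theory extending the theory $T_R$ of $R$-modules. Let $\{M_i:i\in I\}$ be torsion $R$-modules that are models of $T^*$ and $U$ an ultrafilter on $I$. Then $\prod^{tor}M_i/U$ is a substructure of $\prod_{i\in I}M_i/U$ (indeed a torsion module), and for every $L_R$-formula $\phi(x_0,\dots,x_{n-1})$ and all $[f_0]_U,\dots,[f_{n-1}]_U\in\prod^{tor}M_i/U$, $$\{i\in I: M_i\models\phi(f_0(i),\dots,f_{n-1}(i))\}\in U\iff \prod^{tor}M_i/U\models\phi([f_0]_U,\dots,[f_{n-1}]_U).$$
   Context: $L_R=\langle +,-,0,(r\cdot)_{r\in R}\rangle$ is the language of $R$-modules. For a module $M$ and $m\in M$, $\mathcal{O}^M(m)=\{r\in R: r\cdot m=0 \text{ and } r \text{ is regular (not a zero divisor)}\}$; $M$ is a torsion module if $\mathcal{O}^M(m)\neq\emptyset$ for every $m\in M$. The torsion ultraproduct $\prod^{tor}M_i/U$ is the subset of the ordinary ultraproduct $\prod M_i/U$ consisting of the classes $[f]_U$ of those $f\in\prod_{i\in I}M_i$ for which there exist $X_f\in U$ and $r_f\in R$ with $r_f\in\mathcal{O}^{M_i}(f(i))$ for all $i\in X_f$, with operations inherited from $\prod M_i/U$. *)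

theory Defs
  imports "HOL-Algebra.Module" "HOL-Algebra.Ring_Divisibility"
begin

section \<open>Structures for the language of modules\<close>

text \<open>
  An \<open>L\<^sub>R\<close>-structure interprets \<open>+\<close>, unary \<open>-\<close>, \<open>0\<close> and the scalars \<open>r\<cdot>\<close>.  It reuses
  the record \<open>module\<close> of HOL-Algebra, so that the locale \<open>module\<close> applies to it directly; only
  the interpretation of \<open>-\<close> has to be added.  The fields \<open>mult\<close> and \<open>one\<close>, which
  that record inherits from rings, play no role for modules and are never referred to.
\<close>

record ('r, 'a) LR_struct = "('r, 'a) module" +
  uneg :: "'a \<Rightarrow> 'a"

definition LR_structure :: "('r, 'x) ring_scheme \<Rightarrow> ('r, 'a) LR_struct \<Rightarrow> bool" where
  "LR_structure R M \<longleftrightarrow>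
     \<zero>\<^bsub>M\<^esub> \<in> carrier M \<and>
     (\<forall>a\<in>carrier M. \<forall>b\<in>carrier M. a \<oplus>\<^bsub>M\<^esub> b \<in> carrier M) \<and>
     (\<forall>a\<in>carrier M. uneg M a \<in> carrier M) \<and>
     (\<forall>r\<in>carrier R. \<forall>a\<in>carrier M. r \<odot>\<^bsub>M\<^esub> a \<in> carrier M)"

definition substructure ::
    "('r, 'x) ring_scheme \<Rightarrow> ('r, 'a) LR_struct \<Rightarrow> ('r, 'a) LR_struct \<Rightarrow> bool" where
  "substructure R N M \<longleftrightarrow>
     LR_structure R N \<and> LR_structure R M \<and> carrier N \<subseteq> carrier M \<and>
     \<zero>\<^bsub>N\<^esub> = \<zero>\<^bsub>M\<^esub> \<and>
     (\<forall>a\<in>carrier N. \<forall>b\<in>carrier N. a \<oplus>\<^bsub>N\<^esub> b = a \<oplus>\<^bsub>M\<^esub> b) \<and>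
     (\<forall>a\<in>carrier N. uneg N a = uneg M a) \<and>
     (\<forall>r\<in>carrier R. \<forall>a\<in>carrier N. r \<odot>\<^bsub>N\<^esub> a = r \<odot>\<^bsub>M\<^esub> a)"

definition R_module :: "('r, 'x) ring_scheme \<Rightarrow> ('r, 'a) LR_struct \<Rightarrow> bool" where
  "R_module R M \<longleftrightarrow> module R M \<and> (\<forall>a\<in>carrier M. uneg M a = \<ominus>\<^bsub>M\<^esub> a)"


section \<open>Terms, formulas, satisfaction\<close>

datatype 'r LR_term =
    Var nat
  | Zero
  | Plus "'r LR_term" "'r LR_term"
  | Uminus "'r LR_term"
  | Scal 'r "'r LR_term"

datatype 'r LR_form =
    Eq "'r LR_term" "'r LR_term"
  | Neg "'r LR_form"
  | Conj "'r LR_form" "'r LR_form"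
  | Exi nat "'r LR_form"

abbreviation Univ :: "nat \<Rightarrow> 'r LR_form \<Rightarrow> 'r LR_form" where
  "Univ k \<phi> \<equiv> Neg (Exi k (Neg \<phi>))"

fun term_vars :: "'r LR_term \<Rightarrow> nat set" where
  "term_vars (Var k) = {k}"
| "term_vars Zero = {}"
| "term_vars (Plus s t) = term_vars s \<union> term_vars t"
| "term_vars (Uminus t) = term_vars t"
| "term_vars (Scal r t) = term_vars t"

fun free_vars :: "'r LR_form \<Rightarrow> nat set" where
  "free_vars (Eq s t) = term_vars s \<union> term_vars t"
| "free_vars (Neg \<phi>) = free_vars \<phi>"
| "free_vars (Conj \<phi> \<psi>) = free_vars \<phi> \<union> free_vars \<psi>"
| "free_vars (Exi k \<phi>) = free_vars \<phi> - {k}"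

text \<open>
  \<open>set_LR_form \<phi>\<close> is the set of the scalars that occur in \<open>\<phi>\<close>.  As \<open>R\<close> is a ring on a
  carrier set, the formulas of \<open>L\<^sub>R\<close> are those whose scalars belong to that set.
\<close>

definition LR_formula :: "('r, 'x) ring_scheme \<Rightarrow> 'r LR_form \<Rightarrow> bool" where
  "LR_formula R \<phi> \<longleftrightarrow> set_LR_form \<phi> \<subseteq> carrier R"

definition LR_sentence :: "('r, 'x) ring_scheme \<Rightarrow> 'r LR_form \<Rightarrow> bool" where
  "LR_sentence R \<phi> \<longleftrightarrow> LR_formula R \<phi> \<and> free_vars \<phi> = {}"

fun term_val :: "('r, 'a) LR_struct \<Rightarrow> (nat \<Rightarrow> 'a) \<Rightarrow> 'r LR_term \<Rightarrow> 'a" where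
  "term_val M v (Var k) = v k"
| "term_val M v Zero = \<zero>\<^bsub>M\<^esub>"
| "term_val M v (Plus s t) = term_val M v s \<oplus>\<^bsub>M\<^esub> term_val M v t"
| "term_val M v (Uminus t) = uneg M (term_val M v t)"
| "term_val M v (Scal r t) = r \<odot>\<^bsub>M\<^esub> term_val M v t"

fun sat :: "('r, 'a) LR_struct \<Rightarrow> (nat \<Rightarrow> 'a) \<Rightarrow> 'r LR_form \<Rightarrow> bool" where
  "sat M v (Eq s t) \<longleftrightarrow> term_val M v s = term_val M v t"
| "sat M v (Neg \<phi>) \<longleftrightarrow> \<not> sat M v \<phi>"
| "sat M v (Conj \<phi> \<psi>) \<longleftrightarrow> sat M v \<phi> \<and> sat M v \<psi>"
| "sat M v (Exi k \<phi>) \<longleftrightarrow> (\<exists>a\<in>carrier M. sat M (v(k := a)) \<phi>)"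


section \<open>Theories\<close>

definition LR_theory :: "('r, 'x) ring_scheme \<Rightarrow> 'r LR_form set \<Rightarrow> bool" where
  "LR_theory R T \<longleftrightarrow> (\<forall>\<sigma>\<in>T. LR_sentence R \<sigma>)"

text \<open>Used for sentences only, whose truth value does not depend on the assignment.\<close>

definition true_in :: "('r, 'a) LR_struct \<Rightarrow> 'r LR_form \<Rightarrow> bool" where
  "true_in M \<sigma> \<longleftrightarrow> (\<forall>v. (\<forall>k. v k \<in> carrier M) \<longrightarrow> sat M v \<sigma>)"

definition is_model ::
    "('r, 'x) ring_scheme \<Rightarrow> ('r, 'a) LR_struct \<Rightarrow> 'r LR_form set \<Rightarrow> bool" where
  "is_model R M T \<longleftrightarrow> LR_structure R M \<and> (\<forall>\<sigma>\<in>T. true_in M \<sigma>)"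

text \<open>
  A definition cannot quantify over all types, so the structures in the next two
  definitions have as universe an arbitrary (nonempty) subset of the type \<open>'r + nat\<close>.  This
  type has cardinality \<open>max |'r| \<aleph>\<^sub>0\<close>, hence by the downward Loewenheim-Skolem theorem every
  \<open>L\<^sub>R\<close>-structure on any type whatsoever is elementarily equivalent to one of these, and
  the definitions agree with satisfiability and consequence over all structures.
\<close>

definition satisfiable :: "('r, 'x) ring_scheme \<Rightarrow> 'r LR_form set \<Rightarrow> bool" where
  "satisfiable R T \<longleftrightarrow> (\<exists>N :: ('r, 'r + nat) LR_struct. is_model R N T)"

definition entails :: "('r, 'x) ring_scheme \<Rightarrow> 'r LR_form set \<Rightarrow> 'r LR_form \<Rightarrow> bool" where
  "entails R T \<sigma> \<longleftrightarrow>
     (\<forall>N :: ('r, 'r + nat) LR_struct. is_model R N T \<longrightarrow> true_in N \<sigma>)"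

definition complete_theory :: "('r, 'x) ring_scheme \<Rightarrow> 'r LR_form set \<Rightarrow> bool" where
  "complete_theory R T \<longleftrightarrow>
     LR_theory R T \<and> satisfiable R T \<and>
     (\<forall>\<sigma>. LR_sentence R \<sigma> \<longrightarrow> entails R T \<sigma> \<or> entails R T (Neg \<sigma>))"

definition extends_theory ::
    "('r, 'x) ring_scheme \<Rightarrow> 'r LR_form set \<Rightarrow> 'r LR_form set \<Rightarrow> bool" where
  "extends_theory R T T' \<longleftrightarrow> (\<forall>\<sigma>\<in>T'. entails R T \<sigma>)"

definition module_theory :: "('r, 'x) ring_scheme \<Rightarrow> 'r LR_form set" where
  "module_theory R =
     {Univ 0 (Univ 1 (Univ 2 (Eq (Plus (Plus (Var 0) (Var 1)) (Var 2))
                              (Plus (Var 0) (Plus (Var 1) (Var 2)))))),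
      Univ 0 (Univ 1 (Eq (Plus (Var 0) (Var 1)) (Plus (Var 1) (Var 0)))),
      Univ 0 (Eq (Plus (Var 0) Zero) (Var 0)),
      Univ 0 (Eq (Plus (Var 0) (Uminus (Var 0))) Zero),
      Univ 0 (Eq (Scal \<one>\<^bsub>R\<^esub> (Var 0)) (Var 0))}
   \<union> {Univ 0 (Univ 1 (Eq (Scal r (Plus (Var 0) (Var 1)))
                        (Plus (Scal r (Var 0)) (Scal r (Var 1))))) | r. r \<in> carrier R}
   \<union> {Univ 0 (Eq (Scal (r \<oplus>\<^bsub>R\<^esub> s) (Var 0)) (Plus (Scal r (Var 0)) (Scal s (Var 0))))
        | r s. r \<in> carrier R \<and> s \<in> carrier R}
   \<union> {Univ 0 (Eq (Scal (r \<otimes>\<^bsub>R\<^esub> s) (Var 0)) (Scal r (Scal s (Var 0))))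
        | r s. r \<in> carrier R \<and> s \<in> carrier R}"


section \<open>Torsion modules\<close>

definition regular :: "('r, 'x) ring_scheme \<Rightarrow> 'r \<Rightarrow> bool" where
  "regular R r \<longleftrightarrow>
     r \<in> carrier R \<and>
     (\<forall>s\<in>carrier R. r \<otimes>\<^bsub>R\<^esub> s = \<zero>\<^bsub>R\<^esub> \<or> s \<otimes>\<^bsub>R\<^esub> r = \<zero>\<^bsub>R\<^esub> \<longrightarrow> s = \<zero>\<^bsub>R\<^esub>)"

definition tor_ann :: "('r, 'x) ring_scheme \<Rightarrow> ('r, 'a) LR_struct \<Rightarrow> 'a \<Rightarrow> 'r set" where
  "tor_ann R M m = {r \<in> carrier R. r \<odot>\<^bsub>M\<^esub> m = \<zero>\<^bsub>M\<^esub> \<and> regular R r}"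

definition torsion_module :: "('r, 'x) ring_scheme \<Rightarrow> ('r, 'a) LR_struct \<Rightarrow> bool" where
  "torsion_module R M \<longleftrightarrow> R_module R M \<and> (\<forall>m\<in>carrier M. tor_ann R M m \<noteq> {})"


section \<open>Ultraproducts\<close>

definition ultrafilter_on :: "'i set \<Rightarrow> 'i set set \<Rightarrow> bool" where
  "ultrafilter_on I U \<longleftrightarrow>
     U \<subseteq> Pow I \<and> I \<in> U \<and> {} \<notin> U \<and>
     (\<forall>X\<in>U. \<forall>Y\<in>U. X \<inter> Y \<in> U) \<and>
     (\<forall>X\<in>U. \<forall>Y. X \<subseteq> Y \<and> Y \<subseteq> I \<longrightarrow> Y \<in> U) \<and>
     (\<forall>X. X \<subseteq> I \<longrightarrow> X \<in> U \<or> I - X \<in> U)"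

definition prod_carrier :: "'i set \<Rightarrow> ('i \<Rightarrow> ('r, 'a) LR_struct) \<Rightarrow> ('i \<Rightarrow> 'a) set" where
  "prod_carrier I M = (\<Pi>\<^sub>E i\<in>I. carrier (M i))"

definition ultra_rel ::
    "'i set \<Rightarrow> 'i set set \<Rightarrow> ('i \<Rightarrow> ('r, 'a) LR_struct) \<Rightarrow> (('i \<Rightarrow> 'a) \<times> ('i \<Rightarrow> 'a)) set" where
  "ultra_rel I U M =
     {(f, g). f \<in> prod_carrier I M \<and> g \<in> prod_carrier I M \<and> {i\<in>I. f i = g i} \<in> U}"

definition ultra_class ::
    "'i set \<Rightarrow> 'i set set \<Rightarrow> ('i \<Rightarrow> ('r, 'a) LR_struct) \<Rightarrow> ('i \<Rightarrow> 'a) \<Rightarrow> ('i \<Rightarrow> 'a) set" where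
  "ultra_class I U M f = ultra_rel I U M `` {f}"

text \<open>
  The operations on classes are given in the style of \<^theory>\<open>HOL.Equiv_Relations\<close>: all
  representatives yield the same class, and the union is that class.
\<close>

definition ultraproduct ::
    "'i set \<Rightarrow> 'i set set \<Rightarrow> ('i \<Rightarrow> ('r, 'a) LR_struct) \<Rightarrow> ('r, ('i \<Rightarrow> 'a) set) LR_struct" where
  "ultraproduct I U M =
     \<lparr>carrier = prod_carrier I M // ultra_rel I U M,
      mult = undefined,
      one = undefined,
      zero = ultra_class I U M (\<lambda>i\<in>I. \<zero>\<^bsub>M i\<^esub>),
      add = (\<lambda>A B. \<Union>f\<in>A. \<Union>g\<in>B. ultra_class I U M (\<lambda>i\<in>I. f i \<oplus>\<^bsub>M i\<^esub> g i)),
      smult = (\<lambda>r A. \<Union>f\<in>A. ultra_class I U M (\<lambda>i\<in>I. r \<odot>\<^bsub>M i\<^esub> f i)),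
      uneg = (\<lambda>A. \<Union>f\<in>A. ultra_class I U M (\<lambda>i\<in>I. uneg (M i) (f i)))\<rparr>"

definition torsion_ultraproduct ::
    "('r, 'x) ring_scheme \<Rightarrow> 'i set \<Rightarrow> 'i set set \<Rightarrow> ('i \<Rightarrow> ('r, 'a) LR_struct) \<Rightarrow>
     ('r, ('i \<Rightarrow> 'a) set) LR_struct" where
  "torsion_ultraproduct R I U M =
     (ultraproduct I U M)
       \<lparr>carrier := {ultra_class I U M f | f. f \<in> prod_carrier I M \<and>
          (\<exists>X\<in>U. \<exists>r\<in>carrier R. \<forall>i\<in>X. r \<in> tor_ann R (M i) (f i))}\<rparr>"

end

theory Submission
  imports Defs
begin

text \<open>
  Everything reduces to a uniform bound in a single torsion module: for a formula \<open>\<phi>\<close> and \<open>s \<noteq> 0\<close>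
  there is \<open>r \<noteq> 0\<close> such that \<open>\<exists>x. \<phi>(x, y)\<close>, for parameters \<open>y\<close> annihilated by \<open>s\<close>, always has
  a witness annihilated by \<open>r\<close>.  For given \<open>s\<close> and \<open>r\<close> this is a first-order sentence, so
  one \<open>r\<close> serves all \<open>M\<^sub>i\<close> at once, and the existential step in the usual induction for the
  theorem of Los can choose its witnesses with a common annihilator.

  The bound comes from a semantic form of the Baur-Monk elimination of quantifiers. For a
  positive primitive condition it follows from linear algebra over the principal ideal domain.
  The solutions \<open>x\<close> of such conditions form cosets; Neumann's lemma shows that those of infinite
  index can be avoided inside a finite set, and those of finite index are controlled by finitely
  many positive primitive conditions whose parameters are coset representatives. Both finite sets
  lie in a torsion module and so have a common annihilator.
\<close>

section \<open>Linear forms\<close>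

text \<open>The obstacle is that witnesses chosen in the separate factors are torsion, but their
  annihilators may vary with the index so that no single scalar serves on a set of \<open>U\<close>.
  Hence the search for a bound expressible in the language. It mentions scalars only, so the
  analysis behind it may use whatever one factor offers: coset representatives, parameters and
  annihilators that depend on that module. Completeness of the theory carries the resulting
  sentence, not the construction, to the other factors.

  That analysis rests on two uses of one lemma. \<open>back_and_forth\<close> compares two
  assignments \<open>v\<close> and \<open>v'\<close>. For different ones it shows that finitely many
  positive primitive sets decide a formula; for \<open>v' = v\<close> it replaces an arbitrary
  witness by an annihilated one.

  Completeness is defined through structures on the type \<open>'r + nat\<close>, whereas the
  factors live on an arbitrary type. The downward Loewenheim-Skolem theorem bridges the two.\<close>

context abelian_group
begin

lemma diff_eq_zero_iff:
  assumes "x \<in> carrier G" "y \<in> carrier G"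
  shows "x \<ominus> y = \<zero> \<longleftrightarrow> x = y"
  using add.inv_solve_right[of "\<zero>" x y] assms by (auto simp: minus_eq)

lemma additive_subgroup_iff:
  "additive_subgroup H G \<longleftrightarrow>
     H \<subseteq> carrier G \<and> \<zero> \<in> H \<and> (\<forall>x\<in>H. \<forall>y\<in>H. x \<ominus> y \<in> H)"
proof
  assume "additive_subgroup H G"
  then show "H \<subseteq> carrier G \<and> \<zero> \<in> H \<and> (\<forall>x\<in>H. \<forall>y\<in>H. x \<ominus> y \<in> H)"
    by (auto simp: minus_eq additive_subgroup.a_subset additive_subgroup.zero_closed
        additive_subgroup.a_closed additive_subgroup.a_inv_closed
        dest: additive_subgroup.a_Hcarr)
next
  assume *: "H \<subseteq> carrier G \<and> \<zero> \<in> H \<and> (\<forall>x\<in>H. \<forall>y\<in>H. x \<ominus> y \<in> H)"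
  have inv: "\<ominus> x \<in> H" if "x \<in> H" for x
  proof -
    have "\<zero> \<ominus> x \<in> H" "x \<in> carrier G"
      using * that by blast+
    then show ?thesis
      by (simp add: minus_eq)
  qed
  have "x \<oplus> y \<in> H" if "x \<in> H" "y \<in> H" for x y
  proof -
    have "x \<ominus> (\<ominus> y) \<in> H" "y \<in> carrier G"
      using * inv that by blast+
    then show ?thesis
      by (simp add: minus_eq)
  qed
  then show "additive_subgroup H G"
    using * inv by (intro additive_subgroup.intro add.subgroupI) (auto simp flip: a_inv_def)
qed

end

context module
begin

lemma minus_one_smult: "x \<in> carrier M \<Longrightarrow> \<ominus>\<^bsub>M\<^esub> x = (\<ominus> \<one>) \<odot>\<^bsub>M\<^esub> x"
  by (simp add: smult_l_minus)

lemma smult_smult_comm: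
  assumes "a \<in> carrier R" "b \<in> carrier R" "x \<in> carrier M"
  shows "a \<odot>\<^bsub>M\<^esub> (b \<odot>\<^bsub>M\<^esub> x) = b \<odot>\<^bsub>M\<^esub> (a \<odot>\<^bsub>M\<^esub> x)"
  using assms by (simp flip: smult_assoc1 add: R.m_comm)

end

text \<open>The product of the individual scalars serves all members: the condition survives
  multiplication, and without zero divisors the product stays nonzero. It unifies annihilators of
  elements, witness bounds for conditions, and annihilators of functions in the theorem of
  Los.\<close>

lemma (in "domain") uniform_scalar:
  assumes "finite \<Omega>" "\<And>\<omega>. \<omega> \<in> \<Omega> \<Longrightarrow> \<exists>r\<in>carrier R - {\<zero>}. P \<omega> r"
    and "\<And>\<omega> q r. P \<omega> r \<Longrightarrow> q \<in> carrier R \<Longrightarrow> r \<in> carrier R \<Longrightarrow> P \<omega> (q \<otimes> r)"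
  shows "\<exists>r\<in>carrier R - {\<zero>}. \<forall>\<omega>\<in>\<Omega>. P \<omega> r"
  using assms(1,2)
proof induction
  case empty
  show ?case by (intro bexI[of _ \<one>]) auto
next
  case (insert \<omega> \<Omega>)
  have "\<exists>r\<in>carrier R - {\<zero>}. \<forall>\<omega>\<in>\<Omega>. P \<omega> r"
    by (rule insert.IH) (use insert.prems in auto)
  then obtain r where r: "r \<in> carrier R" "r \<noteq> \<zero>" "\<forall>\<omega>\<in>\<Omega>. P \<omega> r"
    by blast
  obtain q where q: "q \<in> carrier R" "q \<noteq> \<zero>" "P \<omega> q"
    using insert.prems[of \<omega>] by blast
  have "P \<omega> (q \<otimes> r)"
    using assms(3)[OF q(3) r(1) q(1)] q r by (simp add: m_comm)
  then show ?case
    using r q assms(3) by (intro bexI[of _ "q \<otimes> r"]) (auto simp: integral_iff)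
qed

section \<open>Linear forms as functions, and the coefficients behind them\<close>

abbreviation assignments :: "('a, 'b) partial_object_scheme \<Rightarrow> ('v \<Rightarrow> 'a) set" where
  "assignments M \<equiv> {v. \<forall>j. v j \<in> carrier M}"

text \<open>Forms are functions of an assignment rather than coefficient vectors: the index type is
  arbitrary, so one notion serves \<open>'v + nat\<close> (free and quantified variables) as well as
  \<open>nat\<close> (unknowns of a system), and substitution is composition. Subtraction is
  expressed by the scalar \<open>\<ominus> \<one>\<close>.\<close>

inductive_set linear_forms ::
    "('r, 'x) ring_scheme \<Rightarrow> ('r, 'a) LR_struct \<Rightarrow> (('v \<Rightarrow> 'a) \<Rightarrow> 'a) set"
  for R M where
  Zero: "(\<lambda>v. \<zero>\<^bsub>M\<^esub>) \<in> linear_forms R M"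
| Proj: "(\<lambda>v. v j) \<in> linear_forms R M"
| Plus: "f \<in> linear_forms R M \<Longrightarrow> g \<in> linear_forms R M \<Longrightarrow>
    (\<lambda>v. f v \<oplus>\<^bsub>M\<^esub> g v) \<in> linear_forms R M"
| Scal: "r \<in> carrier R \<Longrightarrow> f \<in> linear_forms R M \<Longrightarrow>
    (\<lambda>v. r \<odot>\<^bsub>M\<^esub> f v) \<in> linear_forms R M"

lemma linear_form_subst:
  assumes "f \<in> linear_forms R M" and "\<And>j. D j \<in> linear_forms R M"
  shows "(\<lambda>v. f (\<lambda>j. D j v)) \<in> linear_forms R M"
  using assms(1)
proof induction
  case Zero
  show ?case by (rule linear_forms.Zero)
next
  case (Proj j)
  show ?case by (simp add: assms(2))
qed (auto intro: linear_forms.intros)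

primrec linear_sum :: "('r, 'a) LR_struct \<Rightarrow> nat \<Rightarrow> (nat \<Rightarrow> 'r) \<Rightarrow> (nat \<Rightarrow> 'a) \<Rightarrow> 'a" where
  "linear_sum M 0 c v = \<zero>\<^bsub>M\<^esub>"
| "linear_sum M (Suc n) c v = linear_sum M n c v \<oplus>\<^bsub>M\<^esub> c n \<odot>\<^bsub>M\<^esub> v n"

lemma linear_sum_in_linear_forms:
  assumes "\<And>j. c j \<in> carrier R"
  shows "(\<lambda>v. linear_sum M n c v) \<in> linear_forms R M"
  by (induction n) (auto intro!: linear_forms.intros assms)

locale pid_module = module R M + principal_domain R
  for R :: "('r, 'x) ring_scheme" (structure) and M :: "('r, 'a) LR_struct" (structure)
begin

lemma linear_form_closed [simp]:
  assumes "f \<in> linear_forms R M" "\<And>j. v j \<in> carrier M"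
  shows "f v \<in> carrier M"
  using assms by induction auto

lemma linear_form_add:
  assumes "f \<in> linear_forms R M" "\<And>j. v j \<in> carrier M" "\<And>j. w j \<in> carrier M"
  shows "f (\<lambda>j. v j \<oplus>\<^bsub>M\<^esub> w j) = f v \<oplus>\<^bsub>M\<^esub> f w"
  using assms by induction (auto simp: M.a_ac smult_r_distr)

lemma linear_form_smult:
  assumes "f \<in> linear_forms R M" "\<And>j. v j \<in> carrier M" "r \<in> carrier R"
  shows "f (\<lambda>j. r \<odot>\<^bsub>M\<^esub> v j) = r \<odot>\<^bsub>M\<^esub> f v"
  using assms(1)
proof induction
  case (Scal q f)
  then show ?case
    using assms by (simp flip: smult_assoc1 add: R.m_comm)
qed (use assms in \<open>auto simp: smult_r_distr\<close>)

lemma linear_form_zero: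
  assumes "f \<in> linear_forms R M"
  shows "f (\<lambda>j. \<zero>\<^bsub>M\<^esub>) = \<zero>\<^bsub>M\<^esub>"
  using linear_form_smult[OF assms, of "\<lambda>_. \<zero>\<^bsub>M\<^esub>" \<zero>] assms by simp

lemma linear_form_diff:
  assumes "f \<in> linear_forms R M" "\<And>j. v j \<in> carrier M" "\<And>j. w j \<in> carrier M"
  shows "f (\<lambda>j. v j \<ominus>\<^bsub>M\<^esub> w j) = f v \<ominus>\<^bsub>M\<^esub> f w"
  using linear_form_add[OF assms(1), of v "\<lambda>j. (\<ominus> \<one>) \<odot>\<^bsub>M\<^esub> w j"]
    linear_form_smult[OF assms(1), of w "\<ominus> \<one>"] assms
  by (simp add: M.minus_eq minus_one_smult)

lemma linear_forms_minus:
  assumes "f \<in> linear_forms R M"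
  shows "(\<lambda>v. (\<ominus> \<one>) \<odot>\<^bsub>M\<^esub> f v) \<in> linear_forms R M"
  using assms by (intro linear_forms.intros) auto

lemma linear_sum_closed [simp]:
  assumes "\<And>j. c j \<in> carrier R" "\<And>j. v j \<in> carrier M"
  shows "linear_sum M n c v \<in> carrier M"
  using linear_sum_in_linear_forms[of c R M n] assms by simp

lemma linear_sum_stable:
  assumes "\<And>j. c j \<in> carrier R" "\<And>j. v j \<in> carrier M" "\<And>j. n \<le> j \<Longrightarrow> c j = \<zero>" "n \<le> m"
  shows "linear_sum M m c v = linear_sum M n c v"
  using assms(4) by (induction m rule: dec_induct) (use assms in auto)

text \<open>Common divisors need coefficients, which a function does not display. Equality is
  asserted on assignments into \<open>carrier M\<close>, where the module laws hold; the vanishing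
  tail lets sums of different lengths be brought to the larger one before they are added.\<close>

lemma linear_form_coefficients:
  assumes "(f :: (nat \<Rightarrow> 'a) \<Rightarrow> 'a) \<in> linear_forms R M"
  shows "\<exists>c n. (\<forall>j. c j \<in> carrier R) \<and> (\<forall>j\<ge>n. c j = \<zero>) \<and>
    (\<forall>v\<in>assignments M. f v = linear_sum M n c v)"
  using assms
proof induction
  case Zero
  show ?case by (intro exI[of _ "\<lambda>_. \<zero>"] exI[of _ 0]) auto
next
  case (Proj j)
  let ?c = "\<lambda>i. if i = j then \<one> else \<zero>"
  have "linear_sum M n ?c v = (if j < n then v j else \<zero>\<^bsub>M\<^esub>)" if "v \<in> assignments M" for v n
    using that by (induction n) (auto simp: less_Suc_eq)
  then show ?case
    by (intro exI[of _ ?c] exI[of _ "Suc j"]) auto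
next
  case (Plus f g)
  obtain c n where
    c: "\<And>j. c j \<in> carrier R" "\<And>j. n \<le> j \<Longrightarrow> c j = \<zero>"
      "\<And>v. v \<in> assignments M \<Longrightarrow> f v = linear_sum M n c v"
    using Plus.IH(1) by blast
  obtain d m where
    d: "\<And>j. d j \<in> carrier R" "\<And>j. m \<le> j \<Longrightarrow> d j = \<zero>"
      "\<And>v. v \<in> assignments M \<Longrightarrow> g v = linear_sum M m d v"
    using Plus.IH(2) by blast
  have add: "linear_sum M k (\<lambda>j. c j \<oplus> d j) v = linear_sum M k c v \<oplus>\<^bsub>M\<^esub> linear_sum M k d v"
    if "v \<in> assignments M" for v k
    using that c d by (induction k) (auto simp: smult_l_distr M.a_ac)
  have "f v \<oplus>\<^bsub>M\<^esub> g v = linear_sum M (max n m) (\<lambda>j. c j \<oplus> d j) v" if "v \<in> assignments M" for v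
    using that add[of v] c d linear_sum_stable[of c v n "max n m"] linear_sum_stable[of d v m "max n m"]
    by simp
  then show ?case
    using c d by (intro exI[of _ "\<lambda>j. c j \<oplus> d j"] exI[of _ "max n m"]) auto
next
  case (Scal r f)
  then obtain c n where
    c: "\<And>j. c j \<in> carrier R" "\<And>j. n \<le> j \<Longrightarrow> c j = \<zero>"
      "\<And>v. v \<in> assignments M \<Longrightarrow> f v = linear_sum M n c v"
    by blast
  have "linear_sum M k (\<lambda>j. r \<otimes> c j) v = r \<odot>\<^bsub>M\<^esub> linear_sum M k c v"
    if "v \<in> assignments M" for v k
    using that c Scal by (induction k) (auto simp: smult_assoc1 smult_r_distr)
  then show ?case
    using c Scal by (intro exI[of _ "\<lambda>j. r \<otimes> c j"] exI[of _ n]) auto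
qed

section \<open>Greatest common divisors and the image of a linear form\<close>

lemma gcd_two:
  assumes "a \<in> carrier R" "b \<in> carrier R"
  obtains g x y p q where "g \<in> carrier R" "x \<in> carrier R" "y \<in> carrier R"
    "p \<in> carrier R" "q \<in> carrier R" "a = g \<otimes> x" "b = g \<otimes> y" "g = a \<otimes> p \<oplus> b \<otimes> q"
proof -
  have *: "ideal (PIdl a) R" "ideal (PIdl b) R"
    using assms by (auto intro: cgenideal_ideal)
  \<comment> \<open>The generator of the sum of the two ideals divides both elements and, lying in
    the sum, is a combination of them. This uses that every ideal is principal.\<close>
  obtain g where g: "g \<in> carrier R" "PIdl a <+>\<^bsub>R\<^esub> PIdl b = PIdl g"
    using exists_gen[OF add_ideals[OF *]] by blast
  have "\<zero> \<in> PIdl a" "\<zero> \<in> PIdl b"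
    using *[THEN ideal.axioms(1)] by (auto dest: additive_subgroup.zero_closed)
  then have "a \<oplus> \<zero> \<in> PIdl a <+>\<^bsub>R\<^esub> PIdl b" "\<zero> \<oplus> b \<in> PIdl a <+>\<^bsub>R\<^esub> PIdl b"
    using assms[THEN cgenideal_self] unfolding set_add_def' by blast+
  then have "a \<in> PIdl g" "b \<in> PIdl g"
    using assms by (simp_all add: g(2))
  then obtain x y where xy: "x \<in> carrier R" "y \<in> carrier R" "a = x \<otimes> g" "b = y \<otimes> g"
    unfolding cgenideal_def by blast
  have "g \<in> PIdl a <+>\<^bsub>R\<^esub> PIdl b"
    using g cgenideal_self by simp
  then obtain p q where pq: "p \<in> carrier R" "q \<in> carrier R" "g = p \<otimes> a \<oplus> q \<otimes> b"
    unfolding set_add_def' cgenideal_def by blast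
  have "a = g \<otimes> x" "b = g \<otimes> y" "g = a \<otimes> p \<oplus> b \<otimes> q"
    using xy(3,4) pq(3) R.m_comm xy(1,2) pq(1,2) g(1) assms by metis+
  then show thesis
    using that xy(1,2) pq(1,2) g(1) by blast
qed

text \<open>Here \<open>g\<close> is the greatest common divisor of the first \<open>n\<close>
  coefficients, \<open>d\<close> the cofactors and \<open>u\<close> the Bezout coefficients; the
  Bezout identity is stated through its action on \<open>M\<close>. A new coefficient multiplies the
  old cofactors by \<open>x\<close> and the old Bezout coefficients by \<open>p\<close>.\<close>

lemma gcd_coefficients:
  assumes "\<And>j. c j \<in> carrier R"
  shows "\<exists>g d u. g \<in> carrier R \<and> (\<forall>j. d j \<in> carrier R) \<and> (\<forall>j. u j \<in> carrier R) \<and>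
    (\<forall>j<n. c j = g \<otimes> d j) \<and>
    (\<forall>t\<in>carrier M. linear_sum M n c (\<lambda>j. u j \<odot>\<^bsub>M\<^esub> t) = g \<odot>\<^bsub>M\<^esub> t)"
proof (induction n)
  case 0
  show ?case
    by (intro exI[of _ \<zero>] exI[of _ "\<lambda>_. \<zero>"]) auto
next
  case (Suc n)
  then obtain g d u where g: "g \<in> carrier R" "\<And>j. d j \<in> carrier R" "\<And>j. u j \<in> carrier R"
    "\<And>j. j < n \<Longrightarrow> c j = g \<otimes> d j"
    "\<And>t. t \<in> carrier M \<Longrightarrow> linear_sum M n c (\<lambda>j. u j \<odot>\<^bsub>M\<^esub> t) = g \<odot>\<^bsub>M\<^esub> t"
    by blast
  obtain h x y p q where h: "h \<in> carrier R" "x \<in> carrier R" "y \<in> carrier R"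
    "p \<in> carrier R" "q \<in> carrier R" "g = h \<otimes> x" "c n = h \<otimes> y" "h = g \<otimes> p \<oplus> c n \<otimes> q"
    using gcd_two[OF g(1) assms] by metis
  let ?d = "\<lambda>j. if j < n then x \<otimes> d j else y" and ?u = "\<lambda>j. if j < n then p \<otimes> u j else q"
  have "linear_sum M (Suc n) c (\<lambda>j. ?u j \<odot>\<^bsub>M\<^esub> t) = h \<odot>\<^bsub>M\<^esub> t" if t: "t \<in> carrier M" for t
  proof -
    have "linear_sum M m c (\<lambda>j. ?u j \<odot>\<^bsub>M\<^esub> t) = linear_sum M m c (\<lambda>j. u j \<odot>\<^bsub>M\<^esub> (p \<odot>\<^bsub>M\<^esub> t))"
      if "m \<le> n" for m
      using that t g(1-3) h(1-5) by (induction m) (auto simp: smult_assoc1 smult_smult_comm[of p])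
    then have "linear_sum M (Suc n) c (\<lambda>j. ?u j \<odot>\<^bsub>M\<^esub> t) = g \<odot>\<^bsub>M\<^esub> (p \<odot>\<^bsub>M\<^esub> t) \<oplus>\<^bsub>M\<^esub> c n \<odot>\<^bsub>M\<^esub> (q \<odot>\<^bsub>M\<^esub> t)"
      using g(1-3,5) h(1-5) t assms by simp
    also have "\<dots> = (g \<otimes> p \<oplus> c n \<otimes> q) \<odot>\<^bsub>M\<^esub> t"
      using t g(1) h(1-5) assms by (simp add: smult_assoc1 smult_l_distr)
    finally show ?thesis
      using h(8) by simp
  qed
  moreover have "\<forall>j<Suc n. c j = h \<otimes> ?d j"
    using g(1-4) h(1-7) by (auto simp: R.m_assoc less_Suc_eq)
  ultimately show ?case
    using g(1-3) h(1-5) by (intro exI[of _ h] exI[of _ ?d] exI[of _ ?u] conjI) auto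
qed

text \<open>Read together, the two equations say that the assignment with entries \<open>u j\<close>
  times \<open>e v\<close> has the same value of \<open>f\<close> as \<open>v\<close>. In
  \<open>elimination\<close> this turns a defect in the image of a form into an explicit correction
  that is linear in \<open>v\<close>.\<close>

lemma linear_form_factor:
  assumes "(f :: (nat \<Rightarrow> 'a) \<Rightarrow> 'a) \<in> linear_forms R M"
  obtains g e u where "g \<in> carrier R" "e \<in> linear_forms R M" "\<And>j. u j \<in> carrier R"
    "\<And>v. v \<in> assignments M \<Longrightarrow> f v = g \<odot>\<^bsub>M\<^esub> e v"
    "\<And>t. t \<in> carrier M \<Longrightarrow> f (\<lambda>j. u j \<odot>\<^bsub>M\<^esub> t) = g \<odot>\<^bsub>M\<^esub> t"
proof -
  obtain c n where c: "\<And>j. c j \<in> carrier R"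
    "\<And>v. v \<in> assignments M \<Longrightarrow> f v = linear_sum M n c v"
    using linear_form_coefficients[OF assms] by blast
  obtain g d u where g: "g \<in> carrier R" "\<And>j. d j \<in> carrier R" "\<And>j. u j \<in> carrier R"
    "\<And>j. j < n \<Longrightarrow> c j = g \<otimes> d j"
    "\<And>t. t \<in> carrier M \<Longrightarrow> linear_sum M n c (\<lambda>j. u j \<odot>\<^bsub>M\<^esub> t) = g \<odot>\<^bsub>M\<^esub> t"
    using gcd_coefficients[of c n, OF c(1)] by blast
  have "linear_sum M m c v = g \<odot>\<^bsub>M\<^esub> linear_sum M m d v" if "v \<in> assignments M" "m \<le> n" for v m
    using that(2) by (induction m) (use that(1) g in \<open>auto simp: smult_assoc1 smult_r_distr\<close>)
  then have "f v = g \<odot>\<^bsub>M\<^esub> linear_sum M n d v" if "v \<in> assignments M" for v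
    using c(2) that by simp
  moreover have "f (\<lambda>j. u j \<odot>\<^bsub>M\<^esub> t) = g \<odot>\<^bsub>M\<^esub> t" if "t \<in> carrier M" for t
    using c(2)[of "\<lambda>j. u j \<odot>\<^bsub>M\<^esub> t"] g(5) g(3) that by simp
  ultimately show thesis
    using that g(1,3) linear_sum_in_linear_forms[of d R M n, OF g(2)] by blast
qed

section \<open>Uniform purity\<close>

text \<open>
  \<open>C\<close> replaces a solution \<open>w\<close> of a linear system by one that is annihilated by a fixed multiple of
  every scalar annihilating the right-hand sides. A further equation \<open>a\<close> only matters on the
  image of \<open>E = 1 - C\<close>, where it is \<open>g\<close> times a form \<open>e\<close>, and \<open>D = C + E u e\<close> repairs it.
\<close>

lemma elimination:
  assumes "finite fs" "fs \<subseteq> linear_forms R M"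
  shows "\<exists>C N. N \<in> carrier R - {\<zero>} \<and> (\<forall>j. C j \<in> linear_forms R M) \<and>
    (\<forall>f\<in>fs. \<forall>w\<in>assignments M. f (\<lambda>j. C j w) = f w) \<and>
    (\<forall>w\<in>assignments M. \<forall>s\<in>carrier R. (\<forall>f\<in>fs. s \<odot>\<^bsub>M\<^esub> f w = \<zero>\<^bsub>M\<^esub>) \<longrightarrow>
       (\<forall>j::nat. (s \<otimes> N) \<odot>\<^bsub>M\<^esub> C j w = \<zero>\<^bsub>M\<^esub>))"
  using assms
proof (induction fs)
  case empty
  \<comment> \<open>With no equation to respect, the zero solution and the factor
    \<open>\<one>\<close> serve.\<close>
  show ?case
    by (intro exI[of _ "\<lambda>_ _. \<zero>\<^bsub>M\<^esub>"] exI[of _ \<one>]) (auto intro: linear_forms.Zero)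
next
  case (insert a fs)
  have "fs \<subseteq> linear_forms R M"
    using insert.prems by simp
  from insert.IH[OF this] obtain C N where IH: "N \<in> carrier R - {\<zero>}"
    "\<forall>j. C j \<in> linear_forms R M"
    "\<forall>f\<in>fs. \<forall>w\<in>assignments M. f (\<lambda>j. C j w) = f w"
    "\<forall>w\<in>assignments M. \<forall>s\<in>carrier R. (\<forall>f\<in>fs. s \<odot>\<^bsub>M\<^esub> f w = \<zero>\<^bsub>M\<^esub>) \<longrightarrow>
       (\<forall>j. (s \<otimes> N) \<odot>\<^bsub>M\<^esub> C j w = \<zero>\<^bsub>M\<^esub>)"
    by (elim exE conjE) (rule that; assumption)
  have N: "N \<in> carrier R" "N \<noteq> \<zero>" and CL: "C j \<in> linear_forms R M" for j
    using IH(1,2) by auto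
  have C: "f (\<lambda>j. C j w) = f w" if "f \<in> fs" "w \<in> assignments M" for f w
    using IH(3) that by blast
  have CN: "(s \<otimes> N) \<odot>\<^bsub>M\<^esub> C j w = \<zero>\<^bsub>M\<^esub>"
    if "w \<in> assignments M" "s \<in> carrier R" "\<forall>f\<in>fs. s \<odot>\<^bsub>M\<^esub> f w = \<zero>\<^bsub>M\<^esub>" for w s j
    using IH(4) that by blast
  have aL: "a \<in> linear_forms R M" and fsL: "\<And>f. f \<in> fs \<Longrightarrow> f \<in> linear_forms R M"
    using insert by auto
  \<comment> \<open>\<open>E w\<close> is the difference of two solutions, so the forms in
    \<open>fs\<close> vanish on it, and corrections taken from the range of \<open>E\<close> leave
    the earlier equations alone.\<close>
  define E where "E = (\<lambda>j w. w j \<oplus>\<^bsub>M\<^esub> (\<ominus> \<one>) \<odot>\<^bsub>M\<^esub> C j w)"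
  have EL: "E j \<in> linear_forms R M" for j
    unfolding E_def by (intro linear_forms.intros linear_forms_minus CL)
  have fE: "f (\<lambda>j. E j w) = f w \<ominus>\<^bsub>M\<^esub> f (\<lambda>j. C j w)" if "f \<in> linear_forms R M" "w \<in> assignments M" for f w
    using linear_form_diff[OF that(1), of w "\<lambda>j. C j w"] that CL unfolding E_def
    by (simp add: M.minus_eq minus_one_smult)
  obtain g e u where g: "g \<in> carrier R" and eL: "e \<in> linear_forms R M" and u: "\<And>j. u j \<in> carrier R" and
    ge: "\<And>w. w \<in> assignments M \<Longrightarrow> a (\<lambda>j. E j w) = g \<odot>\<^bsub>M\<^esub> e w" and
    gu: "\<And>t. t \<in> carrier M \<Longrightarrow> a (\<lambda>j. E j (\<lambda>j. u j \<odot>\<^bsub>M\<^esub> t)) = g \<odot>\<^bsub>M\<^esub> t"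
    using linear_form_factor[OF linear_form_subst[of a R M E, OF aL EL]] by blast
  show ?case
  proof (cases "g = \<zero>")
    case True
    \<comment> \<open>The new form vanishes on the range of \<open>E\<close>, hence \<open>C\<close>
      already respects it.\<close>
    have "a w \<ominus>\<^bsub>M\<^esub> a (\<lambda>j. C j w) = \<zero>\<^bsub>M\<^esub>" if "w \<in> assignments M" for w
      using ge[OF that] fE[OF aL that] True eL that by simp
    then have "a (\<lambda>j. C j w) = a w" if "w \<in> assignments M" for w
      using that aL CL M.diff_eq_zero_iff[of "a w" "a (\<lambda>j. C j w)"] by auto
    then show ?thesis
      using N CL C CN by (intro exI[of _ C] exI[of _ N]) auto
  next
    case False
    define D where "D = (\<lambda>j w. C j w \<oplus>\<^bsub>M\<^esub> E j (\<lambda>i. u i \<odot>\<^bsub>M\<^esub> e w))"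
    have DL: "D j \<in> linear_forms R M" for j
      unfolding D_def by (intro linear_forms.Plus CL linear_form_subst[OF EL] linear_forms.Scal u eL)
    have fD: "f (\<lambda>j. D j w) = f (\<lambda>j. C j w) \<oplus>\<^bsub>M\<^esub> f (\<lambda>j. E j (\<lambda>i. u i \<odot>\<^bsub>M\<^esub> e w))"
      if "f \<in> linear_forms R M" "w \<in> assignments M" for f w
      unfolding D_def using linear_form_add[OF that(1)] CL EL u eL that by simp
    have 1: "f (\<lambda>j. D j w) = f w" if "f \<in> fs" "w \<in> assignments M" for f w
      using that fsL[OF that(1)] fD[of f w] fE[of f "\<lambda>i. u i \<odot>\<^bsub>M\<^esub> e w"] C[of f "\<lambda>i. u i \<odot>\<^bsub>M\<^esub> e w"] C[of f w] u eL
      by (simp add: M.diff_eq_zero_iff)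
    have 2: "a (\<lambda>j. D j w) = a w" if "w \<in> assignments M" for w
    proof -
      \<comment> \<open>The correction contributes \<open>g\<close> times \<open>e w\<close>,
        exactly the defect of \<open>a\<close> at \<open>C w\<close>.\<close>
      have "a (\<lambda>j. D j w) = a (\<lambda>j. C j w) \<oplus>\<^bsub>M\<^esub> (a w \<ominus>\<^bsub>M\<^esub> a (\<lambda>j. C j w))"
        using fD[OF aL that] gu[of "e w"] ge[OF that] fE[OF aL that] eL that by simp
      then show ?thesis
        using aL CL that by (simp add: M.minus_eq M.a_ac M.r_neg M.r_neg1)
    qed
    \<comment> \<open>The factor \<open>g\<close> is the price of the correction: \<open>s N\<close>
      kills both \<open>C w\<close> and \<open>a w\<close>, hence the defect \<open>g e(w)\<close>;
      so \<open>s N g\<close> kills \<open>e w\<close> itself and, by linearity of \<open>E\<close>,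
      the correction.\<close>
    have 3: "(s \<otimes> (N \<otimes> g)) \<odot>\<^bsub>M\<^esub> D j w = \<zero>\<^bsub>M\<^esub>"
      if w: "w \<in> assignments M" and s: "s \<in> carrier R" and k: "\<forall>f\<in>insert a fs. s \<odot>\<^bsub>M\<^esub> f w = \<zero>\<^bsub>M\<^esub>" for w s j
    proof -
      have sN: "s \<otimes> N \<in> carrier R" using s N by simp
      have c0: "(s \<otimes> N) \<odot>\<^bsub>M\<^esub> C j w = \<zero>\<^bsub>M\<^esub>" for j
        using CN[OF w s] k by auto
      have "(s \<otimes> N) \<odot>\<^bsub>M\<^esub> a (\<lambda>j. C j w) = \<zero>\<^bsub>M\<^esub>"
        using linear_form_smult[OF aL, of "\<lambda>j. C j w" "s \<otimes> N"] CL w sN aL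
        by (simp add: c0 linear_form_zero)
      moreover have "(s \<otimes> N) \<odot>\<^bsub>M\<^esub> a w = N \<odot>\<^bsub>M\<^esub> (s \<odot>\<^bsub>M\<^esub> a w)"
        using s N aL w by (simp add: smult_assoc1 smult_smult_comm)
      then have "(s \<otimes> N) \<odot>\<^bsub>M\<^esub> a w = \<zero>\<^bsub>M\<^esub>"
        using k N by simp
      ultimately have "(s \<otimes> N) \<odot>\<^bsub>M\<^esub> (g \<odot>\<^bsub>M\<^esub> e w) = \<zero>\<^bsub>M\<^esub>"
        using sN aL CL w
        by (simp flip: ge[OF w] add: fE[OF aL w] M.minus_eq minus_one_smult smult_r_distr smult_smult_comm[of _ "\<ominus> \<one>"])
      then have e0: "(s \<otimes> (N \<otimes> g)) \<odot>\<^bsub>M\<^esub> e w = \<zero>\<^bsub>M\<^esub>"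
        using s N g eL w by (simp add: smult_assoc1)
      have "(s \<otimes> (N \<otimes> g)) \<odot>\<^bsub>M\<^esub> E j (\<lambda>i. u i \<odot>\<^bsub>M\<^esub> e w) = E j (\<lambda>i. u i \<odot>\<^bsub>M\<^esub> ((s \<otimes> (N \<otimes> g)) \<odot>\<^bsub>M\<^esub> e w))"
        using linear_form_smult[OF EL, of "\<lambda>i. u i \<odot>\<^bsub>M\<^esub> e w" "s \<otimes> (N \<otimes> g)" j] u eL w s N g
        by (simp add: smult_smult_comm[of "s \<otimes> (N \<otimes> g)"])
      then have "(s \<otimes> (N \<otimes> g)) \<odot>\<^bsub>M\<^esub> E j (\<lambda>i. u i \<odot>\<^bsub>M\<^esub> e w) = \<zero>\<^bsub>M\<^esub>"
        using e0 u linear_form_zero[OF EL] by simp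
      moreover have "(s \<otimes> (N \<otimes> g)) \<odot>\<^bsub>M\<^esub> C j w = g \<odot>\<^bsub>M\<^esub> ((s \<otimes> N) \<odot>\<^bsub>M\<^esub> C j w)"
        using s N g CL w by (simp flip: smult_assoc1 add: R.m_comm R.m_assoc R.m_lcomm)
      then have "(s \<otimes> (N \<otimes> g)) \<odot>\<^bsub>M\<^esub> C j w = \<zero>\<^bsub>M\<^esub>"
        using c0 g by simp
      ultimately show ?thesis
        unfolding D_def using CL EL u eL w s N g by (simp add: smult_r_distr)
    qed
    have "N \<otimes> g \<in> carrier R - {\<zero>}"
      using N g False by (simp add: integral_iff)
    then show ?thesis
      using DL 1 2 3 by (intro exI[of _ D] exI[of _ "N \<otimes> g"] conjI) blast+
  qed
qed

end

section \<open>Primitive positive sets with parameters\<close>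

text \<open>
  The values \<open>b\<close> of the linear forms are parameters from \<open>M\<close>, and \<open>w\<close> interprets the quantified
  variables.
\<close>

definition pp_set ::
    "('r, 'x) ring_scheme \<Rightarrow> ('r, 'a) LR_struct \<Rightarrow> ('v \<Rightarrow> 'a) set \<Rightarrow> bool" where
  "pp_set R M D \<longleftrightarrow> (\<exists>P. finite P \<and> P \<subseteq> linear_forms R M \<times> carrier M \<and>
     D = {v \<in> assignments M. \<exists>w\<in>assignments M. \<forall>(f, b)\<in>P. f (case_sum v (w :: nat \<Rightarrow> 'a)) = b})"

lemma pp_setI:
  assumes "finite P" "P \<subseteq> linear_forms R M \<times> carrier M"
    and "\<And>v. v \<in> D \<longleftrightarrow> v \<in> assignments M \<and>
      (\<exists>w\<in>assignments M. \<forall>(f, b)\<in>P. f (case_sum v (w :: nat \<Rightarrow> 'a)) = b)"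
  shows "pp_set R (M :: ('r, 'a) LR_struct) D"
  unfolding pp_set_def using assms by (intro exI[of _ P] conjI) (assumption | blast)+

lemma pp_set_CollectI:
  assumes "finite P" "P \<subseteq> linear_forms R M \<times> carrier M"
    and "\<And>v. v \<in> assignments M \<Longrightarrow> Q v \<longleftrightarrow>
      (\<exists>w\<in>assignments M. \<forall>(f, b)\<in>P. f (case_sum v (w :: nat \<Rightarrow> 'a)) = b)"
  shows "pp_set R (M :: ('r, 'a) LR_struct) {v \<in> assignments M. Q v}"
  using assms(3) by (intro pp_setI[OF assms(1,2)]) blast

lemma pp_set_subset: "pp_set R M D \<Longrightarrow> D \<subseteq> assignments M"
  by (auto simp: pp_set_def)

lemma linear_form_case_sum:
  assumes "f \<in> linear_forms R M" "\<And>j. A j \<in> linear_forms R M" "\<And>j. B j \<in> linear_forms R M"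
  shows "(\<lambda>u. f (case_sum (\<lambda>j. A j u) (\<lambda>j. B j u))) \<in> linear_forms R M"
proof -
  have "case_sum A B i \<in> linear_forms R M" for i
    using assms by (cases i) auto
  moreover have "(\<lambda>i. case_sum A B i u) = case_sum (\<lambda>j. A j u) (\<lambda>j. B j u)" for u
    by (auto split: sum.split)
  ultimately show ?thesis
    using linear_form_subst[OF assms(1), of "case_sum A B"] by simp
qed

context pid_module
begin

section \<open>Closure properties of positive primitive sets\<close>

lemma zero_assignment: "(\<lambda>j. \<zero>\<^bsub>M\<^esub>) \<in> assignments M"
  by simp

lemma pp_set_assignments: "pp_set R M (assignments M)"
  unfolding pp_set_def using zero_assignment by (intro exI[of _ "{}"]) auto

lemma pp_set_Int:
  fixes D D' :: "('v \<Rightarrow> 'a) set"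
  assumes "pp_set R M D" "pp_set R M D'"
  shows "pp_set R M (D \<inter> D')"
proof -
  obtain P where P: "finite P" "P \<subseteq> linear_forms R M \<times> carrier M"
    "D = {v \<in> assignments M. \<exists>w\<in>assignments M. \<forall>(f, b)\<in>P. f (case_sum v (w :: nat \<Rightarrow> 'a)) = b}"
    using assms(1) unfolding pp_set_def by blast
  obtain Q where Q: "finite Q" "Q \<subseteq> linear_forms R M \<times> carrier M"
    "D' = {v \<in> assignments M. \<exists>w\<in>assignments M. \<forall>(f, b)\<in>Q. f (case_sum v (w :: nat \<Rightarrow> 'a)) = b}"
    using assms(2) unfolding pp_set_def by blast
  \<comment> \<open>The quantified variables of the two systems are renamed apart, those of
    \<open>P\<close> to even and those of \<open>Q\<close> to odd indices.\<close>
  define p where "p = (\<lambda>(f :: ('v + nat \<Rightarrow> 'a) \<Rightarrow> 'a, b :: 'a).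
    (\<lambda>u. f (case_sum (\<lambda>j. u (Inl j :: 'v + nat)) (\<lambda>j. u (Inr (2 * j)))), b))"
  define q where "q = (\<lambda>(f :: ('v + nat \<Rightarrow> 'a) \<Rightarrow> 'a, b :: 'a).
    (\<lambda>u. f (case_sum (\<lambda>j. u (Inl j :: 'v + nat)) (\<lambda>j. u (Inr (2 * j + 1)))), b))"
  have "p ` P \<union> q ` Q \<subseteq> linear_forms R M \<times> carrier M"
    using P(2) Q(2) by (auto simp: p_def q_def intro!: linear_form_case_sum linear_forms.Proj)
  moreover have "v \<in> D \<inter> D' \<longleftrightarrow> v \<in> assignments M \<and>
    (\<exists>w\<in>assignments M. \<forall>(f, b)\<in>p ` P \<union> q ` Q. f (case_sum v (w :: nat \<Rightarrow> 'a)) = b)" for v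
  proof
    assume v: "v \<in> D \<inter> D'"
    obtain w1 :: "nat \<Rightarrow> 'a" where w1: "w1 \<in> assignments M" "\<forall>(f, b)\<in>P. f (case_sum v w1) = b"
      using v unfolding P(3) by blast
    obtain w2 :: "nat \<Rightarrow> 'a" where w2: "w2 \<in> assignments M" "\<forall>(f, b)\<in>Q. f (case_sum v w2) = b"
      using v unfolding Q(3) by blast
    define w where "w j = (if even j then w1 (j div 2) else w2 (j div 2))" for j
    have "w \<in> assignments M"
      using w1 w2 by (auto simp: w_def)
    moreover have "(\<lambda>j. w (2 * j)) = w1" "(\<lambda>j. w (Suc (2 * j))) = w2"
      by (auto simp: w_def)
    ultimately show "v \<in> assignments M \<and>
        (\<exists>w\<in>assignments M. \<forall>(f, b)\<in>p ` P \<union> q ` Q. f (case_sum v (w :: nat \<Rightarrow> 'a)) = b)"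
      using v w1 w2 P(3) by (intro conjI bexI[of _ w]) (auto simp: p_def q_def)
  next
    assume v: "v \<in> assignments M \<and>
      (\<exists>w\<in>assignments M. \<forall>(f, b)\<in>p ` P \<union> q ` Q. f (case_sum v (w :: nat \<Rightarrow> 'a)) = b)"
    then obtain w :: "nat \<Rightarrow> 'a" where w: "w \<in> assignments M"
      "\<forall>(f, b)\<in>p ` P \<union> q ` Q. f (case_sum v w) = b"
      by blast
    have "\<forall>(f, b)\<in>P. f (case_sum v (\<lambda>j. w (2 * j))) = b"
      "\<forall>(f, b)\<in>Q. f (case_sum v (\<lambda>j. w (2 * j + 1))) = b"
      using w(2) by (auto simp: p_def q_def ball_Un)
    then show "v \<in> D \<inter> D'"
      unfolding P(3) Q(3) using v w(1)
      by (auto intro!: bexI[of _ "\<lambda>j. w (2 * j)"] bexI[of _ "\<lambda>j. w (Suc (2 * j))"])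
  qed
  ultimately show ?thesis
    using P(1) Q(1) by (intro pp_setI[of "p ` P \<union> q ` Q"]) simp_all
qed

lemma pp_set_INT:
  assumes "finite \<D>" "\<And>D. D \<in> \<D> \<Longrightarrow> pp_set R M (F D)"
  shows "pp_set R M {v \<in> assignments M. \<forall>D\<in>\<D>. v \<in> F D}"
  using assms
proof (induction \<D>)
  case empty
  then show ?case
    using pp_set_assignments by simp
next
  case (insert D \<D>)
  have "{v \<in> assignments M. \<forall>D\<in>insert D \<D>. v \<in> F D} = F D \<inter> {v \<in> assignments M. \<forall>D\<in>\<D>. v \<in> F D}"
    using pp_set_subset[OF insert.prems[of D]] by auto
  then show ?case
    using insert by (simp add: pp_set_Int)
qed

lemma pp_set_Ex:
  fixes D :: "('v \<Rightarrow> 'a) set"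
  assumes "pp_set R M D"
  shows "pp_set R M {v \<in> assignments M. \<exists>x\<in>carrier M. v(k := x) \<in> D}"
proof -
  obtain P where P: "finite P" "P \<subseteq> linear_forms R M \<times> carrier M"
    "D = {v \<in> assignments M. \<exists>w\<in>assignments M. \<forall>(f, b)\<in>P. f (case_sum v (w :: nat \<Rightarrow> 'a)) = b}"
    using assms(1) unfolding pp_set_def by blast
  \<comment> \<open>Coordinate \<open>k\<close> becomes the quantified variable 0 and the old ones
    move up by one. The index type of the free variables is kept; coordinate \<open>k\<close> is
    merely no longer read.\<close>
  define p where "p = (\<lambda>(f :: ('v + nat \<Rightarrow> 'a) \<Rightarrow> 'a, b :: 'a).
    (\<lambda>u. f (case_sum (\<lambda>j :: 'v. u (if j = k then Inr 0 else Inl j)) (\<lambda>j. u (Inr (Suc j)))), b))"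
  have "p ` P \<subseteq> linear_forms R M \<times> carrier M"
    using P(2) by (auto simp: p_def intro!: linear_form_case_sum linear_forms.Proj)
  moreover have "(\<exists>x\<in>carrier M. v(k := x) \<in> D) \<longleftrightarrow>
    (\<exists>w\<in>assignments M. \<forall>(f, b)\<in>p ` P. f (case_sum v (w :: nat \<Rightarrow> 'a)) = b)"
    if v: "v \<in> assignments M" for v
  proof -
    have *: "(\<lambda>j. case_sum v w (if j = k then Inr 0 else Inl j)) = v(k := w 0)" for w :: "nat \<Rightarrow> 'a"
      by auto
    have "(\<exists>w\<in>assignments M. \<forall>(f, b)\<in>p ` P. f (case_sum v (w :: nat \<Rightarrow> 'a)) = b) \<longleftrightarrow>
      (\<exists>w\<in>assignments M. \<forall>(f, b)\<in>P. f (case_sum (v(k := w 0)) (\<lambda>j. w (Suc j))) = b)"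
      by (simp add: p_def split_beta *)
    also have "\<dots> \<longleftrightarrow> (\<exists>x\<in>carrier M. \<exists>w\<in>assignments M. \<forall>(f, b)\<in>P. f (case_sum (v(k := x)) (w :: nat \<Rightarrow> 'a)) = b)"
    proof
      assume "\<exists>w\<in>assignments M. \<forall>(f, b)\<in>P. f (case_sum (v(k := w 0)) (\<lambda>j. w (Suc j))) = b"
      then obtain w where "w \<in> assignments M"
        "\<forall>(f, b)\<in>P. f (case_sum (v(k := w 0)) (\<lambda>j. w (Suc j))) = b"
        by blast
      then show "\<exists>x\<in>carrier M. \<exists>w\<in>assignments M. \<forall>(f, b)\<in>P. f (case_sum (v(k := x)) (w :: nat \<Rightarrow> 'a)) = b"
        by (intro bexI[of _ "w 0"] bexI[of _ "\<lambda>j. w (Suc j)"]) auto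
    next
      assume "\<exists>x\<in>carrier M. \<exists>w\<in>assignments M. \<forall>(f, b)\<in>P. f (case_sum (v(k := x)) (w :: nat \<Rightarrow> 'a)) = b"
      then obtain x w where "x \<in> carrier M" "w \<in> assignments M"
        "\<forall>(f, b)\<in>P. f (case_sum (v(k := x)) (w :: nat \<Rightarrow> 'a)) = b"
        by blast
      then show "\<exists>w\<in>assignments M. \<forall>(f, b)\<in>P. f (case_sum (v(k := w 0)) (\<lambda>j. w (Suc j))) = b"
        by (intro bexI[of _ "case_nat x w"]) (auto split: nat.split)
    qed
    also have "\<dots> \<longleftrightarrow> (\<exists>x\<in>carrier M. v(k := x) \<in> D)"
      unfolding P(3) using v by auto
    finally show ?thesis
      by (rule sym)
  qed
  ultimately show ?thesis
    using P(1) by (intro pp_set_CollectI[of "p ` P"] finite_imageI)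
qed

lemma pp_set_equation:
  fixes s t :: "('v \<Rightarrow> 'a) \<Rightarrow> 'a"
  assumes "s \<in> linear_forms R M" "t \<in> linear_forms R M"
  shows "pp_set R M {v \<in> assignments M. s v = t v}"
proof -
  let ?f = "\<lambda>u. s (\<lambda>j. u (Inl j :: 'v + nat)) \<oplus>\<^bsub>M\<^esub> (\<ominus> \<one>) \<odot>\<^bsub>M\<^esub> t (\<lambda>j. u (Inl j))"
  have "?f \<in> linear_forms R M"
    by (rule linear_forms.Plus[OF linear_form_subst linear_forms_minus[OF linear_form_subst]])
      (rule assms linear_forms.Proj)+
  moreover have "?f (case_sum v w) = \<zero>\<^bsub>M\<^esub> \<longleftrightarrow> s v = t v" if "v \<in> assignments M" for v and w :: "nat \<Rightarrow> 'a"
    using that assms M.diff_eq_zero_iff[of "s v" "t v"] by (simp add: M.minus_eq minus_one_smult)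
  ultimately show ?thesis
    using zero_assignment by (intro pp_set_CollectI[of "{(?f, \<zero>\<^bsub>M\<^esub>)}"]) auto
qed

lemma linear_form_shift:
  fixes f :: "('v + nat \<Rightarrow> 'a) \<Rightarrow> 'a"
  assumes "f \<in> linear_forms R M" "v \<in> assignments M" "w \<in> assignments M" "w' \<in> assignments M"
    "t \<in> carrier M"
  shows "f (case_sum (v(k := v k \<oplus>\<^bsub>M\<^esub> t)) (\<lambda>j. w j \<oplus>\<^bsub>M\<^esub> w' j)) =
    f (case_sum v w) \<oplus>\<^bsub>M\<^esub> f (case_sum ((\<lambda>j. \<zero>\<^bsub>M\<^esub>)(k := t)) w')"
proof -
  have "case_sum (v(k := v k \<oplus>\<^bsub>M\<^esub> t)) (\<lambda>j. w j \<oplus>\<^bsub>M\<^esub> w' j) i =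
    case_sum v w i \<oplus>\<^bsub>M\<^esub> case_sum ((\<lambda>j. \<zero>\<^bsub>M\<^esub>)(k := t)) w' i" for i
    using assms(2-) by (cases i) auto
  then have *: "case_sum (v(k := v k \<oplus>\<^bsub>M\<^esub> t)) (\<lambda>j. w j \<oplus>\<^bsub>M\<^esub> w' j) =
    (\<lambda>i. case_sum v w i \<oplus>\<^bsub>M\<^esub> case_sum ((\<lambda>j. \<zero>\<^bsub>M\<^esub>)(k := t)) w' i)"
    by blast
  show ?thesis
    unfolding * using assms(2-) by (intro linear_form_add[OF assms(1)]) (auto split: sum.split)
qed

text \<open>A constant shift moves to the right-hand side and changes \<open>b\<close> by a value of
  the form. This is where right-hand sides other than zero arise: the translations needed later are
  by coset representatives.\<close>

lemma pp_set_shift: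
  fixes D :: "('v \<Rightarrow> 'a) set"
  assumes "pp_set R M D" "t \<in> carrier M"
  shows "pp_set R M {v \<in> assignments M. v(k := v k \<oplus>\<^bsub>M\<^esub> t) \<in> D}"
proof -
  obtain P where P: "finite P" "P \<subseteq> linear_forms R M \<times> carrier M"
    "D = {v \<in> assignments M. \<exists>w\<in>assignments M. \<forall>(f, b)\<in>P. f (case_sum v (w :: nat \<Rightarrow> 'a)) = b}"
    using assms(1) unfolding pp_set_def by blast
  let ?t = "case_sum ((\<lambda>j. \<zero>\<^bsub>M\<^esub>)(k := t)) (\<lambda>j. \<zero>\<^bsub>M\<^esub>) :: 'v + nat \<Rightarrow> 'a"
  have t: "?t i \<in> carrier M" for i
    using assms(2) by (cases i) auto
  define p where "p = (\<lambda>(f :: ('v + nat \<Rightarrow> 'a) \<Rightarrow> 'a, b :: 'a). (f, b \<ominus>\<^bsub>M\<^esub> f ?t))"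
  have pP: "p ` P \<subseteq> linear_forms R M \<times> carrier M"
    using P(2) t by (auto simp: p_def)
  have eq: "f (case_sum (v(k := v k \<oplus>\<^bsub>M\<^esub> t)) w) = b \<longleftrightarrow> f (case_sum v w) = b \<ominus>\<^bsub>M\<^esub> f ?t"
    if "v \<in> assignments M" "w \<in> assignments M" "(f, b) \<in> P" for f b v and w :: "nat \<Rightarrow> 'a"
  proof -
    have f: "f \<in> linear_forms R M" "b \<in> carrier M"
      using that P by auto
    moreover have "case_sum v w i \<in> carrier M" for i
      using that by (cases i) auto
    ultimately have c: "f (case_sum v w) \<in> carrier M" "f ?t \<in> carrier M"
      using t by auto
    have "f (case_sum (v(k := v k \<oplus>\<^bsub>M\<^esub> t)) w) = f (case_sum v w) \<oplus>\<^bsub>M\<^esub> f ?t"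
      using linear_form_shift[OF f(1), of v w "\<lambda>_. \<zero>\<^bsub>M\<^esub>" t k] that assms(2) by simp
    then show ?thesis
      using M.add.inv_solve_right[of "f (case_sum v w)" b "f ?t"] c f by (auto simp: M.minus_eq)
  qed
  have "v(k := v k \<oplus>\<^bsub>M\<^esub> t) \<in> D \<longleftrightarrow>
    (\<exists>w\<in>assignments M. \<forall>(f, b)\<in>p ` P. f (case_sum v (w :: nat \<Rightarrow> 'a)) = b)"
    if v: "v \<in> assignments M" for v
  proof -
    have "v(k := v k \<oplus>\<^bsub>M\<^esub> t) \<in> D \<longleftrightarrow>
      (\<exists>w\<in>assignments M. \<forall>(f, b)\<in>P. f (case_sum (v(k := v k \<oplus>\<^bsub>M\<^esub> t)) (w :: nat \<Rightarrow> 'a)) = b)"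
      unfolding P(3) using v assms(2) by auto
    also have "\<dots> \<longleftrightarrow> (\<exists>w\<in>assignments M. \<forall>(f, b)\<in>P. f (case_sum v (w :: nat \<Rightarrow> 'a)) = b \<ominus>\<^bsub>M\<^esub> f ?t)"
      by (intro bex_cong ball_cong refl) (use eq[OF v] in \<open>auto split: prod.splits\<close>)
    finally show ?thesis
      by (simp add: p_def split_beta)
  qed
  then show ?thesis
    using P(1) pP by (intro pp_set_CollectI[of "p ` P"] finite_imageI)
qed

text \<open>\<open>H\<close> consists of the shifts of coordinate \<open>k\<close> that solve the
  homogeneous system for some choice of the quantified variables. Differences of solutions do not
  see the right-hand sides, so the nonempty fibres of \<open>D\<close> in direction \<open>k\<close>
  are cosets of one and the same subgroup.\<close>

lemma pp_set_fibre:
  fixes D :: "('v \<Rightarrow> 'a) set"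
  assumes "pp_set R M D"
  shows "\<exists>H. additive_subgroup H M \<and>
    (\<forall>v\<in>D. \<forall>h\<in>carrier M. v(k := v k \<oplus>\<^bsub>M\<^esub> h) \<in> D \<longleftrightarrow> h \<in> H)"
proof -
  obtain P where P: "finite P" "P \<subseteq> linear_forms R M \<times> carrier M"
    "D = {v \<in> assignments M. \<exists>w\<in>assignments M. \<forall>(f, b)\<in>P. f (case_sum v (w :: nat \<Rightarrow> 'a)) = b}"
    using assms(1) unfolding pp_set_def by blast
  have PL: "f \<in> linear_forms R M" "b \<in> carrier M" if "(f, b) \<in> P" for f b
    using P(2) that by auto
  define Z where "Z h w \<longleftrightarrow> (\<forall>f b. (f, b) \<in> P \<longrightarrow> f (case_sum ((\<lambda>j. \<zero>\<^bsub>M\<^esub>)(k := h)) w) = \<zero>\<^bsub>M\<^esub>)" for h and w :: "nat \<Rightarrow> 'a"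
  have cs: "case_sum v w i \<in> carrier M" if "v \<in> assignments M" "w \<in> assignments M"
    for v :: "'v \<Rightarrow> 'a" and w :: "nat \<Rightarrow> 'a" and i
    using that by (cases i) auto
  have zh: "(\<lambda>j. \<zero>\<^bsub>M\<^esub>)(k := h) \<in> assignments M" if "h \<in> carrier M" for h
    using that by auto
  have zd: "\<zero>\<^bsub>M\<^esub> \<ominus>\<^bsub>M\<^esub> \<zero>\<^bsub>M\<^esub> = \<zero>\<^bsub>M\<^esub>"
    by (simp add: M.diff_eq_zero_iff)
  have Zdiff: "Z (h \<ominus>\<^bsub>M\<^esub> h') (\<lambda>j. w j \<ominus>\<^bsub>M\<^esub> w' j)"
    if "Z h w" "Z h' w'" "h \<in> carrier M" "h' \<in> carrier M" "w \<in> assignments M" "w' \<in> assignments M" for h h' w w'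
    unfolding Z_def
  proof safe
    fix f b assume fb: "(f, b) \<in> P"
    have "case_sum ((\<lambda>j. \<zero>\<^bsub>M\<^esub>)(k := h \<ominus>\<^bsub>M\<^esub> h')) (\<lambda>j. w j \<ominus>\<^bsub>M\<^esub> w' j) i =
      case_sum ((\<lambda>j. \<zero>\<^bsub>M\<^esub>)(k := h)) w i \<ominus>\<^bsub>M\<^esub> case_sum ((\<lambda>j. \<zero>\<^bsub>M\<^esub>)(k := h')) w' i" for i
      using that zd by (cases i) auto
    then have e: "case_sum ((\<lambda>j. \<zero>\<^bsub>M\<^esub>)(k := h \<ominus>\<^bsub>M\<^esub> h')) (\<lambda>j. w j \<ominus>\<^bsub>M\<^esub> w' j) =
      (\<lambda>i. case_sum ((\<lambda>j. \<zero>\<^bsub>M\<^esub>)(k := h)) w i \<ominus>\<^bsub>M\<^esub> case_sum ((\<lambda>j. \<zero>\<^bsub>M\<^esub>)(k := h')) w' i)"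
      by blast
    have "f (case_sum ((\<lambda>j. \<zero>\<^bsub>M\<^esub>)(k := h \<ominus>\<^bsub>M\<^esub> h')) (\<lambda>j. w j \<ominus>\<^bsub>M\<^esub> w' j)) =
      f (case_sum ((\<lambda>j. \<zero>\<^bsub>M\<^esub>)(k := h)) w) \<ominus>\<^bsub>M\<^esub> f (case_sum ((\<lambda>j. \<zero>\<^bsub>M\<^esub>)(k := h')) w')"
      unfolding e by (rule linear_form_diff[OF PL(1)[OF fb] cs cs]) (rule zh that)+
    also have "\<dots> = \<zero>\<^bsub>M\<^esub>"
      using that(1,2)[unfolded Z_def, rule_format, OF fb] by (simp only: zd)
    finally show "f (case_sum ((\<lambda>j. \<zero>\<^bsub>M\<^esub>)(k := h \<ominus>\<^bsub>M\<^esub> h')) (\<lambda>j. w j \<ominus>\<^bsub>M\<^esub> w' j)) = \<zero>\<^bsub>M\<^esub>" .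
  qed
  define H where "H = {h \<in> carrier M. \<exists>w\<in>assignments M. Z h w}"
  have "Z \<zero>\<^bsub>M\<^esub> (\<lambda>j. \<zero>\<^bsub>M\<^esub>)"
  proof -
    have "case_sum (\<lambda>j. \<zero>\<^bsub>M\<^esub>) (\<lambda>j. \<zero>\<^bsub>M\<^esub>) = (\<lambda>j. \<zero>\<^bsub>M\<^esub> :: 'a)"
      by (auto split: sum.split)
    then show ?thesis
      using linear_form_zero[OF PL(1)] by (auto simp: Z_def fun_upd_idem)
  qed
  then have "\<zero>\<^bsub>M\<^esub> \<in> H"
    using zero_assignment by (auto simp: H_def)
  moreover have "x \<ominus>\<^bsub>M\<^esub> y \<in> H" if xy: "x \<in> H" "y \<in> H" for x y
  proof -
    obtain w w' where "w \<in> assignments M" "w' \<in> assignments M" "Z x w" "Z y w'" "x \<in> carrier M" "y \<in> carrier M"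
      using xy unfolding H_def by blast
    then show ?thesis
      using Zdiff[of x w y w'] unfolding H_def by (auto intro!: exI[of _ "\<lambda>j. w j \<ominus>\<^bsub>M\<^esub> w' j"])
  qed
  ultimately have "additive_subgroup H M"
    unfolding M.additive_subgroup_iff by (auto simp: H_def)
  moreover have "v(k := v k \<oplus>\<^bsub>M\<^esub> h) \<in> D \<longleftrightarrow> h \<in> H" if v: "v \<in> D" and h: "h \<in> carrier M" for v h
  proof -
    obtain w :: "nat \<Rightarrow> 'a" where w: "w \<in> assignments M" "\<forall>(f, b)\<in>P. f (case_sum v w) = b"
      using v unfolding P(3) by blast
    have w2: "f (case_sum v w) = b" if "(f, b) \<in> P" for f b
      using bspec[OF w(2) that] by simp
    have va: "v \<in> assignments M"
      using v P(3) by blast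
    have shift: "f (case_sum (v(k := v k \<oplus>\<^bsub>M\<^esub> h)) (\<lambda>j. w j \<oplus>\<^bsub>M\<^esub> w' j)) = b \<longleftrightarrow>
        f (case_sum ((\<lambda>j. \<zero>\<^bsub>M\<^esub>)(k := h)) w') = \<zero>\<^bsub>M\<^esub>" if "(f, b) \<in> P" "w' \<in> assignments M" for f b w'
      using linear_form_shift[OF PL(1)[OF that(1)] va w(1) that(2) h, of k] w2[OF that(1)] PL(2)[OF that(1)]
        linear_form_closed[OF PL(1)[OF that(1)] cs[OF zh[OF h] that(2)]]
        M.add.l_cancel_one by auto
    show ?thesis
    proof
      assume "h \<in> H"
      then obtain w' where "w' \<in> assignments M" "Z h w'"
        unfolding H_def by blast
      then show "v(k := v k \<oplus>\<^bsub>M\<^esub> h) \<in> D"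
        unfolding P(3) using shift va h w(1)
        by (auto simp: Z_def intro!: exI[of _ "\<lambda>j. w j \<oplus>\<^bsub>M\<^esub> w' j"])
    next
      assume "v(k := v k \<oplus>\<^bsub>M\<^esub> h) \<in> D"
      then obtain u :: "nat \<Rightarrow> 'a" where u: "u \<in> assignments M"
        "\<forall>(f, b)\<in>P. f (case_sum (v(k := v k \<oplus>\<^bsub>M\<^esub> h)) u) = b"
        unfolding P(3) by blast
      have u2: "f (case_sum (v(k := v k \<oplus>\<^bsub>M\<^esub> h)) u) = b" if "(f, b) \<in> P" for f b
        using bspec[OF u(2) that] by simp
      define w' where "w' j = u j \<ominus>\<^bsub>M\<^esub> w j" for j
      have w': "w' \<in> assignments M" "(\<lambda>j. w j \<oplus>\<^bsub>M\<^esub> w' j) = u"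
        using u(1) w(1) by (auto simp: w'_def M.minus_eq M.a_ac M.r_neg M.r_neg1)
      have "Z h w'"
        unfolding Z_def using shift[OF _ w'(1)] u2 w'(2) by auto
      then show "h \<in> H"
        unfolding H_def using h w' by blast
    qed
  qed
  ultimately show ?thesis
    by blast
qed

end

section \<open>Torsion modules and annihilated solutions\<close>

locale torsion_pid_module = pid_module R M
  for R :: "('r, 'x) ring_scheme" (structure) and M :: "('r, 'a) LR_struct" (structure) +
  assumes torsion: "m \<in> carrier M \<Longrightarrow> \<exists>r\<in>carrier R - {\<zero>}. r \<odot>\<^bsub>M\<^esub> m = \<zero>\<^bsub>M\<^esub>"
begin

lemma common_annihilator:
  assumes "finite B" "B \<subseteq> carrier M"
  shows "\<exists>r\<in>carrier R - {\<zero>}. \<forall>b\<in>B. r \<odot>\<^bsub>M\<^esub> b = \<zero>\<^bsub>M\<^esub>"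
proof -
  \<comment> \<open>Membership in \<open>carrier M\<close> is carried along to make the condition
    stable under multiples.\<close>
  have "\<exists>r\<in>carrier R - {\<zero>}. \<forall>b\<in>B. b \<in> carrier M \<and> r \<odot>\<^bsub>M\<^esub> b = \<zero>\<^bsub>M\<^esub>"
    using torsion assms by (intro uniform_scalar) (auto simp: smult_assoc1)
  then show ?thesis
    by blast
qed

text \<open>With \<open>x\<close> and the quantified variables as unknowns, everything coming from
  \<open>v\<close> goes to the right-hand side. The new right-hand sides are killed by
  \<open>s q\<close>, where \<open>q\<close> kills the finitely many parameters \<open>b\<close>,
  and \<open>elimination\<close> finds a solution killed by \<open>s q N\<close>. Neither
  \<open>q\<close> nor \<open>N\<close> depends on \<open>v\<close> or \<open>x\<close>.\<close>

lemma pp_set_torsion_witness: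
  fixes D :: "('v \<Rightarrow> 'a) set"
  assumes "pp_set R M D" "s \<in> carrier R - {\<zero>}"
  shows "\<exists>r\<in>carrier R - {\<zero>}. \<forall>v\<in>assignments M. \<forall>x\<in>carrier M.
    (\<forall>j. s \<odot>\<^bsub>M\<^esub> v j = \<zero>\<^bsub>M\<^esub>) \<longrightarrow> v(k := x) \<in> D \<longrightarrow>
    (\<exists>y\<in>carrier M. r \<odot>\<^bsub>M\<^esub> y = \<zero>\<^bsub>M\<^esub> \<and> v(k := y) \<in> D)"
proof -
  obtain P where P: "finite P" "P \<subseteq> linear_forms R M \<times> carrier M"
    "D = {v \<in> assignments M. \<exists>w\<in>assignments M. \<forall>(f, b)\<in>P. f (case_sum v (w :: nat \<Rightarrow> 'a)) = b}"
    using assms(1) unfolding pp_set_def by blast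
  have PL: "f \<in> linear_forms R M" "b \<in> carrier M" if "(f, b) \<in> P" for f b
    using P(2) that by auto
  have "finite (snd ` P)" "snd ` P \<subseteq> carrier M"
    using P(1,2) by auto
  from common_annihilator[OF this] obtain q where q: "q \<in> carrier R" "q \<noteq> \<zero>"
    "\<And>f b. (f, b) \<in> P \<Longrightarrow> q \<odot>\<^bsub>M\<^esub> b = \<zero>\<^bsub>M\<^esub>"
    by force
  \<comment> \<open>\<open>a f\<close> is \<open>f\<close> as a form in the unknowns alone: unknown
    0 stands in coordinate \<open>k\<close>, the later ones are the quantified variables, and the
    other coordinates are zero.\<close>
  define a where "a f w = f (case_sum ((\<lambda>j :: 'v. \<zero>\<^bsub>M\<^esub>)(k := w 0)) (\<lambda>j. w (Suc j)))"
    for f :: "('v + nat \<Rightarrow> 'a) \<Rightarrow> 'a" and w :: "nat \<Rightarrow> 'a"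
  have aL: "a f \<in> linear_forms R M" if "f \<in> linear_forms R M" for f
  proof -
    have "(\<lambda>w :: nat \<Rightarrow> 'a. if j = k then w 0 else \<zero>\<^bsub>M\<^esub>) \<in> linear_forms R M" for j
      by (cases "j = k") (auto intro: linear_forms.intros)
    from linear_form_case_sum[OF that this linear_forms.Proj] show ?thesis
      unfolding a_def fun_upd_def .
  qed
  have "finite (a ` fst ` P)" "a ` fst ` P \<subseteq> linear_forms R M"
    using P(1) aL PL by auto
  from elimination[OF this] obtain C N where IH: "N \<in> carrier R - {\<zero>}"
    "\<forall>j. C j \<in> linear_forms R M"
    "\<forall>f\<in>a ` fst ` P. \<forall>w\<in>assignments M. f (\<lambda>j. C j w) = f w"
    "\<forall>w\<in>assignments M. \<forall>s\<in>carrier R. (\<forall>f\<in>a ` fst ` P. s \<odot>\<^bsub>M\<^esub> f w = \<zero>\<^bsub>M\<^esub>) \<longrightarrow>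
       (\<forall>j. (s \<otimes> N) \<odot>\<^bsub>M\<^esub> C j w = \<zero>\<^bsub>M\<^esub>)"
    by (elim exE conjE) (rule that; assumption)
  have "\<exists>y\<in>carrier M. (s \<otimes> q \<otimes> N) \<odot>\<^bsub>M\<^esub> y = \<zero>\<^bsub>M\<^esub> \<and> v(k := y) \<in> D"
    if v: "v \<in> assignments M" "\<forall>j. s \<odot>\<^bsub>M\<^esub> v j = \<zero>\<^bsub>M\<^esub>" and x: "x \<in> carrier M" "v(k := x) \<in> D" for v x
  proof -
    obtain w :: "nat \<Rightarrow> 'a" where w: "w \<in> assignments M" "\<forall>(f, b)\<in>P. f (case_sum (v(k := x)) w) = b"
      using x(2) unfolding P(3) by blast
    have w2: "f (case_sum (v(k := x)) w) = b" if "(f, b) \<in> P" for f b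
      using bspec[OF w(2) that] by simp
    \<comment> \<open>The known part is \<open>v\<close> with coordinate \<open>k\<close> cleared;
      \<open>f\<close> splits into its value here and \<open>a f\<close>.\<close>
    define v0 where "v0 = case_sum (v(k := \<zero>\<^bsub>M\<^esub>)) (\<lambda>j :: nat. \<zero>\<^bsub>M\<^esub>)"
    have v0: "v0 i \<in> carrier M" "s \<odot>\<^bsub>M\<^esub> v0 i = \<zero>\<^bsub>M\<^esub>" for i
      using v assms(2) by (auto simp: v0_def split: sum.split)
    have split: "f (case_sum (v(k := u 0)) (\<lambda>j. u (Suc j))) = f v0 \<oplus>\<^bsub>M\<^esub> a f u"
      if "(f, b) \<in> P" "u \<in> assignments M" for f b u
      using linear_form_shift[OF PL(1)[OF that(1)], of "v(k := \<zero>\<^bsub>M\<^esub>)" "\<lambda>_. \<zero>\<^bsub>M\<^esub>" "\<lambda>j. u (Suc j)" "u 0" k] v(1) that(2)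
      by (simp add: a_def v0_def)
    define w1 where "w1 = case_nat x w"
    have w1: "w1 \<in> assignments M"
      using w(1) x(1) by (auto simp: w1_def split: nat.split)
    have fb: "f v0 \<oplus>\<^bsub>M\<^esub> a f w1 = b" if "(f, b) \<in> P" for f b
      using split[OF that w1] w2[OF that] by (simp add: w1_def)
    have "(s \<otimes> q) \<odot>\<^bsub>M\<^esub> a f w1 = \<zero>\<^bsub>M\<^esub>" if "(f, b) \<in> P" for f b
    proof -
      have c: "f v0 \<in> carrier M" "a f w1 \<in> carrier M"
        using PL[OF that] v0 aL w1 by auto
      have "s \<odot>\<^bsub>M\<^esub> f v0 = \<zero>\<^bsub>M\<^esub>"
        using linear_form_smult[OF PL(1)[OF that], of v0 s] v0 assms(2) linear_form_zero[OF PL(1)[OF that]] by simp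
      then have "(s \<otimes> q) \<odot>\<^bsub>M\<^esub> f v0 = \<zero>\<^bsub>M\<^esub>"
        using c q(1) assms(2) by (simp add: smult_assoc1 smult_smult_comm[of s])
      moreover have "(s \<otimes> q) \<odot>\<^bsub>M\<^esub> b = \<zero>\<^bsub>M\<^esub>"
        using q(1) q(3)[OF that] assms(2) PL(2)[OF that] by (simp add: smult_assoc1)
      ultimately show ?thesis
        unfolding fb[OF that, symmetric] using c q(1) assms(2) by (simp add: smult_r_distr)
    qed
    then have k0: "\<forall>f\<in>a ` fst ` P. (s \<otimes> q) \<odot>\<^bsub>M\<^esub> f w1 = \<zero>\<^bsub>M\<^esub>"
      by auto
    define u where "u j = C j w1" for j
    have u: "u \<in> assignments M"
      using IH(2) w1 by (auto simp: u_def)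
    have "f (case_sum (v(k := u 0)) (\<lambda>j. u (Suc j))) = b" if "(f, b) \<in> P" for f b
    proof -
      have "a f u = a f w1"
        using IH(3) that w1 unfolding u_def by force
      then show ?thesis
        using split[OF that u] fb[OF that] by simp
    qed
    then have "v(k := u 0) \<in> D"
      unfolding P(3) using v(1) u by (auto intro!: exI[of _ "\<lambda>j. u (Suc j)"])
    moreover have "(s \<otimes> q \<otimes> N) \<odot>\<^bsub>M\<^esub> u 0 = \<zero>\<^bsub>M\<^esub>"
      unfolding u_def using IH(4) k0 w1 assms(2) q(1) by blast
    ultimately show ?thesis
      using u by blast
  qed
  moreover have "s \<otimes> q \<otimes> N \<in> carrier R - {\<zero>}"
    using assms(2) q IH(1) by (auto simp: integral_iff)
  ultimately show ?thesis
    by blast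
qed

end

section \<open>Coverings by cosets\<close>

text \<open>\<open>H\<close> need not lie in \<open>K\<close>: for subgroups this says that the
  intersection of \<open>H\<close> and \<open>K\<close> has finite index in
  \<open>K\<close>.\<close>

definition finite_index :: "('a, 'b) ring_scheme \<Rightarrow> 'a set \<Rightarrow> 'a set \<Rightarrow> bool" where
  "finite_index G H K \<longleftrightarrow> (\<exists>T. finite T \<and> T \<subseteq> K \<and> (\<forall>x\<in>K. \<exists>t\<in>T. x \<ominus>\<^bsub>G\<^esub> t \<in> H))"

context abelian_group
begin

section \<open>Subgroups of finite index and their representatives\<close>

lemma subgroup_diff_closed:
  assumes "additive_subgroup H G" "x \<in> H" "y \<in> H"
  shows "x \<ominus> y \<in> H"
  using assms by (simp add: minus_eq additive_subgroup.a_closed additive_subgroup.a_inv_closed)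

lemma subgroup_diff_sym:
  assumes "additive_subgroup H G" "x \<in> carrier G" "y \<in> carrier G" "x \<ominus> y \<in> H"
  shows "y \<ominus> x \<in> H"
proof -
  have "\<ominus> (x \<ominus> y) \<in> H"
    by (rule additive_subgroup.a_inv_closed[OF assms(1,4)])
  then show ?thesis
    using assms by (simp add: minus_eq minus_add a_comm)
qed

lemma subgroup_diff_trans:
  assumes "additive_subgroup H G" "x \<in> carrier G" "y \<in> carrier G" "z \<in> carrier G"
    "x \<ominus> y \<in> H" "y \<ominus> z \<in> H"
  shows "x \<ominus> z \<in> H"
proof -
  have "(x \<ominus> y) \<oplus> (y \<ominus> z) \<in> H"
    by (rule additive_subgroup.a_closed[OF assms(1,5,6)])
  then show ?thesis
    using assms by (simp add: minus_eq a_assoc r_neg1)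
qed

text \<open>A class for the intersection is determined by a pair of classes, one for the earlier
  subgroups and one for the new one, so there are finitely many. The representatives are good for
  all subgroups at once, which makes \<open>KS S\<close> of finite index in \<open>HS S\<close>
  later on.\<close>

lemma finite_index_INT:
  assumes "finite F" "additive_subgroup K G"
    and "\<And>Q. Q \<in> F \<Longrightarrow> additive_subgroup (H Q) G" "\<And>Q. Q \<in> F \<Longrightarrow> finite_index G (H Q) K"
  shows "\<exists>T. finite T \<and> T \<subseteq> K \<and> (\<forall>x\<in>K. \<exists>t\<in>T. \<forall>Q\<in>F. x \<ominus> t \<in> H Q)"
  using assms(1,3,4)
proof induction
  case empty
  show ?case
    using additive_subgroup.zero_closed[OF assms(2)] by (intro exI[of _ "{\<zero>}"]) auto
next
  case (insert P F)
  have K: "x \<in> carrier G" if "x \<in> K" for x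
    using additive_subgroup.a_Hcarr[OF assms(2)] that by blast
  obtain T where T: "finite T" "T \<subseteq> K" "\<forall>x\<in>K. \<exists>t\<in>T. \<forall>Q\<in>F. x \<ominus> t \<in> H Q"
    using insert.IH insert.prems by auto
  obtain T' where T': "finite T'" "T' \<subseteq> K" "\<forall>x\<in>K. \<exists>t\<in>T'. x \<ominus> t \<in> H P"
    using insert.prems(2)[of P] unfolding finite_index_def by auto
  \<comment> \<open>Not every pair of representatives is realised by an element of \<open>K\<close>.
    For a pair that is, \<open>c p\<close> is one such element and represents all of them.\<close>
  define near where "near x p \<longleftrightarrow> x \<in> K \<and> (\<forall>Q\<in>F. x \<ominus> fst p \<in> H Q) \<and> x \<ominus> snd p \<in> H P" for x p
  define c where "c p = (SOME x. near x p)" for p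
  let ?N = "{p \<in> T \<times> T'. \<exists>x. near x p}"
  have c: "near (c p) p" if "p \<in> ?N" for p
    using that unfolding c_def by (auto intro: someI_ex)
  have "\<exists>t\<in>c ` ?N. \<forall>Q\<in>insert P F. x \<ominus> t \<in> H Q" if x: "x \<in> K" for x
  proof -
    obtain t t' where t: "t \<in> T" "\<forall>Q\<in>F. x \<ominus> t \<in> H Q" "t' \<in> T'" "x \<ominus> t' \<in> H P"
      using T(3) T'(3) x by blast
    then have N: "(t, t') \<in> ?N"
      using x by (auto simp: near_def)
    have carr: "x \<in> carrier G" "c (t, t') \<in> carrier G" "t \<in> carrier G" "t' \<in> carrier G"
      using K x t T(2) T'(2) c[OF N] by (auto simp: near_def)
    have "x \<ominus> c (t, t') \<in> H Q" if "Q \<in> F" for Q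
      using that t(2) c[OF N] carr insert.prems(1)[of Q] subgroup_diff_trans[of "H Q" x t "c (t, t')"]
        subgroup_diff_sym[of "H Q" "c (t, t')" t] by (auto simp: near_def)
    moreover have "x \<ominus> c (t, t') \<in> H P"
      using t(4) c[OF N] carr insert.prems(1)[of P] subgroup_diff_trans[of "H P" x t' "c (t, t')"]
        subgroup_diff_sym[of "H P" "c (t, t')" t'] by (auto simp: near_def)
    ultimately show ?thesis
      using N by blast
  qed
  moreover have "c ` ?N \<subseteq> K"
    using c by (auto simp: near_def)
  moreover have "finite (c ` ?N)"
    using T(1) T'(1) by (intro finite_imageI finite_subset[of ?N "T \<times> T'"]) auto
  ultimately show ?case
    by blast
qed

lemma finite_index_trans:
  assumes "finite_index G H L" "finite_index G L K" "L \<subseteq> K" "additive_subgroup K G"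
  shows "finite_index G H K"
proof -
  obtain T where T: "finite T" "T \<subseteq> L" "\<forall>x\<in>L. \<exists>t\<in>T. x \<ominus> t \<in> H"
    using assms(1) unfolding finite_index_def by blast
  obtain T' where T': "finite T'" "T' \<subseteq> K" "\<forall>x\<in>K. \<exists>t\<in>T'. x \<ominus> t \<in> L"
    using assms(2) unfolding finite_index_def by blast
  have K: "x \<in> carrier G" if "x \<in> K" for x
    using additive_subgroup.a_Hcarr[OF assms(4)] that by blast
  have "\<exists>t\<in>(\<lambda>(a, b). a \<oplus> b) ` (T' \<times> T). x \<ominus> t \<in> H" if x: "x \<in> K" for x
  proof -
    obtain t' where t': "t' \<in> T'" "x \<ominus> t' \<in> L"
      using T' x by blast
    obtain t where t: "t \<in> T" "x \<ominus> t' \<ominus> t \<in> H"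
      using T t' by blast
    have "x \<ominus> t' \<ominus> t = x \<ominus> (t' \<oplus> t)"
      using x t t' T T' assms(3) K by (auto simp: minus_eq minus_add a_assoc subset_iff)
    then show ?thesis
      using t t' by force
  qed
  moreover have "(\<lambda>(a, b). a \<oplus> b) ` (T' \<times> T) \<subseteq> K"
    using T T' assms(3) additive_subgroup.a_closed[OF assms(4)] by (auto simp: subset_iff)
  moreover have "finite ((\<lambda>(a, b). a \<oplus> b) ` (T' \<times> T))"
    using T(1) T'(1) by simp
  ultimately show ?thesis
    unfolding finite_index_def by (intro exI[of _ "(\<lambda>(a, b). a \<oplus> b) ` (T' \<times> T)"]) simp
qed

text \<open>Greedy choice: a finite inequivalent set that could not be enlarged would be a set of
  representatives.\<close>

lemma infinite_index_inequivalent: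
  assumes "additive_subgroup H G" "additive_subgroup K G" "\<not> finite_index G H K"
  shows "\<exists>Z. finite Z \<and> card Z = n \<and> Z \<subseteq> K \<and> (\<forall>x\<in>Z. \<forall>y\<in>Z. x \<ominus> y \<in> H \<longrightarrow> x = y)"
proof (induction n)
  case 0
  show ?case by (intro exI[of _ "{}"]) auto
next
  case (Suc n)
  then obtain Z where Z: "finite Z" "card Z = n" "Z \<subseteq> K" "\<forall>x\<in>Z. \<forall>y\<in>Z. x \<ominus> y \<in> H \<longrightarrow> x = y"
    by blast
  have "\<not> (\<forall>x\<in>K. \<exists>t\<in>Z. x \<ominus> t \<in> H)"
    using assms(3) Z(1,3) unfolding finite_index_def by auto
  then obtain x where x: "x \<in> K" "\<forall>z\<in>Z. x \<ominus> z \<notin> H"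
    by blast
  have c: "y \<in> carrier G" if "y \<in> K" for y
    using additive_subgroup.a_Hcarr[OF assms(2)] that by blast
  have "x \<notin> Z"
    using x c additive_subgroup.zero_closed[OF assms(1)] by (auto simp: minus_eq r_neg)
  moreover have "z \<ominus> x \<notin> H" if "z \<in> Z" for z
    using x that c Z(3) subgroup_diff_sym[OF assms(1), of z x] by blast
  ultimately show ?case
    using Z x by (intro exI[of _ "insert x Z"]) auto
qed

text \<open>
  As in Neumann's lemma, a coset of \<open>H m\<close> that is not used in a covering is covered by cosets of
  the other subgroups, and hence so are all of its translates.
\<close>

lemma finite_neumann:
  assumes "finite J" "additive_subgroup K G"
    and "\<And>i. i \<in> J \<Longrightarrow> additive_subgroup (H i) G" "\<And>i. i \<in> J \<Longrightarrow> \<not> finite_index G (H i) K"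
  shows "\<exists>Y. finite Y \<and> Y \<subseteq> K \<and>
    (\<forall>A. (\<forall>i\<in>J. finite (A i) \<and> card (A i) \<le> n \<and> A i \<subseteq> carrier G) \<longrightarrow>
      (\<exists>y\<in>Y. \<forall>i\<in>J. \<forall>a\<in>A i. y \<ominus> a \<notin> H i))"
  using assms(1,3,4)
proof (induction arbitrary: n)
  case empty
  show ?case
    using additive_subgroup.zero_closed[OF assms(2)] by (intro exI[of _ "{\<zero>}"]) auto
next
  case (insert m J)
  have K: "x \<in> carrier G" if "x \<in> K" for x
    using additive_subgroup.a_Hcarr[OF assms(2)] that by blast
  have Hm: "additive_subgroup (H m) G"
    using insert.prems by blast
  \<comment> \<open>One point more than the number of cosets of \<open>H m\<close> that may be used,
    so that some point of \<open>Z\<close> escapes them all.\<close>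
  obtain Z where Z: "finite Z" "card Z = Suc n" "Z \<subseteq> K" "\<forall>x\<in>Z. \<forall>y\<in>Z. x \<ominus> y \<in> H m \<longrightarrow> x = y"
    using infinite_index_inequivalent[OF Hm assms(2) insert.prems(2)[OF insertI1], of "Suc n"] by blast
  \<comment> \<open>The bound grows because cosets of \<open>H m\<close> are traded for translates
    of cosets of \<open>H i\<close>: at most \<open>n\<close> given ones, and one more for each pair
    from \<open>A i\<close> and \<open>A m\<close>.\<close>
  have "\<exists>Y. finite Y \<and> Y \<subseteq> K \<and>
    (\<forall>A. (\<forall>i\<in>J. finite (A i) \<and> card (A i) \<le> n + n * n \<and> A i \<subseteq> carrier G) \<longrightarrow>
      (\<exists>y\<in>Y. \<forall>i\<in>J. \<forall>a\<in>A i. y \<ominus> a \<notin> H i))"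
    using insert.IH[of "n + n * n"] insert.prems by simp
  then obtain X where X: "finite X" "X \<subseteq> K"
    "\<And>A. \<forall>i\<in>J. finite (A i) \<and> card (A i) \<le> n + n * n \<and> A i \<subseteq> carrier G \<Longrightarrow>
      \<exists>y\<in>X. \<forall>i\<in>J. \<forall>a\<in>A i. y \<ominus> a \<notin> H i"
    by blast
  \<comment> \<open>\<open>Y\<close> must not depend on \<open>A\<close>. It collects all points at
    which the argument tests an alleged covering: those of \<open>X\<close>, and the translates of
    points of \<open>Z\<close> by differences within \<open>X\<close>.\<close>
  define Y where "Y = X \<union> (\<lambda>(z, x, y). z \<oplus> (x \<ominus> y)) ` (Z \<times> X \<times> X)"
  have "Y \<subseteq> K"
    using X(2) Z(3) subgroup_diff_closed[OF assms(2)] additive_subgroup.a_closed[OF assms(2)]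
    unfolding Y_def by (auto simp: subset_iff)
  moreover have "finite Y"
    using X(1) Z(1) by (simp add: Y_def)
  moreover have "\<exists>y\<in>Y. \<forall>i\<in>insert m J. \<forall>a\<in>A i. y \<ominus> a \<notin> H i"
    if A: "\<forall>i\<in>insert m J. finite (A i) \<and> card (A i) \<le> n \<and> A i \<subseteq> carrier G" for A
  proof (rule ccontr)
    assume "\<not> ?thesis"
    then have cover: "\<exists>i\<in>insert m J. \<exists>a\<in>A i. y \<ominus> a \<in> H i" if "y \<in> Y" for y
      using that by blast
    have Ac: "a \<in> carrier G" if "a \<in> A i" "i \<in> insert m J" for a i
      using A that by blast
    have "\<exists>z\<in>Z. \<forall>a\<in>A m. z \<ominus> a \<notin> H m"
    proof (rule ccontr)
      assume "\<not> ?thesis"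
      then have "\<forall>z\<in>Z. \<exists>a. a \<in> A m \<and> z \<ominus> a \<in> H m"
        by blast
      then obtain \<alpha> where \<alpha>: "\<forall>z\<in>Z. \<alpha> z \<in> A m \<and> z \<ominus> \<alpha> z \<in> H m"
        by metis
      have "inj_on \<alpha> Z"
      proof (rule inj_onI)
        fix z z' assume z: "z \<in> Z" "z' \<in> Z" "\<alpha> z = \<alpha> z'"
        have "z \<in> carrier G" "z' \<in> carrier G" "\<alpha> z \<in> carrier G"
          using z Z(3) K \<alpha> Ac by blast+
        then have "z \<ominus> z' \<in> H m"
          using subgroup_diff_trans[OF Hm, of z "\<alpha> z" z'] subgroup_diff_sym[OF Hm, of z' "\<alpha> z"] \<alpha> z by auto
        then show "z = z'"
          using Z(4) z by blast
      qed
      then have "card Z \<le> card (A m)"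
        using \<alpha> A by (intro card_inj_on_le[of \<alpha>]) auto
      then show False
        using A Z(2) by auto
    qed
    then obtain z where z: "z \<in> Z" "\<forall>a\<in>A m. z \<ominus> a \<notin> H m"
      by blast
    have zc: "z \<in> carrier G"
      using z Z(3) K by blast
    \<comment> \<open>The cosets of \<open>H m\<close> that meet \<open>X\<close>; below,
      \<open>q a\<close> is a point of \<open>X\<close> in the coset of \<open>a\<close>.\<close>
    define A' where "A' = {a \<in> A m. \<exists>y\<in>X. y \<ominus> a \<in> H m}"
    have "\<forall>a\<in>A'. \<exists>y. y \<in> X \<and> y \<ominus> a \<in> H m"
      by (auto simp: A'_def)
    then obtain q where q: "\<forall>a\<in>A'. q a \<in> X \<and> q a \<ominus> a \<in> H m"
      by metis
    \<comment> \<open>If \<open>y\<close> lies in the coset of \<open>a\<close>, then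
      \<open>z + (y - q a)\<close> is congruent to \<open>z\<close> modulo \<open>H m\<close>, so
      only some \<open>b + H i\<close> with \<open>i\<close> in \<open>J\<close> can cover it, and
      then \<open>y\<close> lies in \<open>b + (q a - z) + H i\<close>. \<open>B\<close> lists these
      translates besides the given cosets, so a point of \<open>X\<close> avoiding \<open>B\<close>
      refutes the covering.\<close>
    define B where "B i = A i \<union> (\<lambda>(b, a). b \<oplus> (q a \<ominus> z)) ` (A i \<times> A')" for i
    have "finite (B i) \<and> card (B i) \<le> n + n * n \<and> B i \<subseteq> carrier G" if i: "i \<in> J" for i
    proof (intro conjI)
      have fin: "finite (A i)" "finite A'" and le: "card (A i) \<le> n" "card A' \<le> n"
        using A i card_mono[of "A m" A'] by (auto simp: A'_def)
      then show "finite (B i)"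
        by (simp add: B_def)
      have "card (B i) \<le> card (A i) + card (A i \<times> A')"
        unfolding B_def using fin
        by (intro order_trans[OF card_Un_le] add_mono card_image_le) auto
      also have "\<dots> \<le> n + n * n"
        using le by (auto simp: card_cartesian_product intro!: add_mono mult_le_mono)
      finally show "card (B i) \<le> n + n * n" .
      show "B i \<subseteq> carrier G"
        using Ac[of _ i] i q X(2) K zc by (auto simp: B_def subset_iff)
    qed
    then obtain y where y: "y \<in> X" "\<forall>i\<in>J. \<forall>b\<in>B i. y \<ominus> b \<notin> H i"
      using X(3)[of B] by blast
    have yc: "y \<in> carrier G"
      using y X(2) K by blast
    obtain i a where "i \<in> insert m J" "a \<in> A i" "y \<ominus> a \<in> H i"
      using cover[of y] y(1) by (auto simp: Y_def)
    then have a: "a \<in> A m" "y \<ominus> a \<in> H m"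
      using y(2) by (auto simp: B_def)
    then have aA: "a \<in> A'"
      using y(1) by (auto simp: A'_def)
    define x where "x = q a"
    have x: "x \<in> X" "x \<ominus> a \<in> H m"
      using q aA by (auto simp: x_def)
    have xc: "x \<in> carrier G" and ac: "a \<in> carrier G"
      using x X(2) K Ac a by auto
    have yx: "y \<ominus> x \<in> H m"
      using subgroup_diff_trans[OF Hm, of y a x] subgroup_diff_sym[OF Hm, of x a] a(2) x(2) yc xc ac by blast
    have "z \<oplus> (y \<ominus> x) \<in> Y"
      using z(1) x(1) y(1) unfolding Y_def by (intro UnI2 image_eqI[of _ _ "(z, y, x)"]) simp_all
    then obtain i b where b: "i \<in> insert m J" "b \<in> A i" "z \<oplus> (y \<ominus> x) \<ominus> b \<in> H i"
      using cover by blast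
    have bc: "b \<in> carrier G"
      using Ac b by blast
    show False
    proof (cases "i \<in> J")
      case True
      have "z \<oplus> (y \<ominus> x) \<ominus> b = y \<ominus> (b \<oplus> (x \<ominus> z))"
        using zc yc xc bc by (simp add: minus_eq minus_add a_ac)
      moreover have "b \<oplus> (x \<ominus> z) \<in> B i"
        using b(2) aA by (auto simp: B_def x_def)
      ultimately show False
        using y(2) True b(3) by auto
    next
      case False
      then have im: "i = m"
        using b(1) by simp
      have "z \<ominus> (z \<oplus> d) = \<ominus> d" if "d \<in> carrier G" for d
        using zc that by (simp add: minus_eq minus_add r_neg2)
      then have "z \<ominus> (z \<oplus> (y \<ominus> x)) \<in> H m"
        using additive_subgroup.a_inv_closed[OF Hm yx] xc yc by simp
      then have "z \<ominus> b \<in> H m"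
        using subgroup_diff_trans[OF Hm, of z "z \<oplus> (y \<ominus> x)" b] b(3) im zc yc xc bc by simp
      then show False
        using z(2) b(2) im by blast
    qed
  qed
  ultimately show ?case
    by blast
qed

end

section \<open>Back and forth\<close>

context torsion_pid_module
begin

text \<open>
  Let \<open>S\<close> be the set of the conditions that hold of \<open>x\<close>. The admissible \<open>x'\<close> lie in a coset of
  \<open>HS S\<close>. Conditions of finite index in it, those in \<open>F S\<close>, depend only on the coset of
  \<open>KS S\<close>; the set \<open>E (S, S', j)\<close> says that some \<open>x\<close> satisfying \<open>S\<close> has the representatives
  \<open>j Q\<close> as its distances to the conditions \<open>Q\<close> in \<open>S'\<close>. Those of infinite index are avoided by
  adding an element of \<open>Y S\<close>.
\<close>

lemma back_and_forth:
  fixes \<P> :: "('v \<Rightarrow> 'a) set set"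
  assumes fin: "finite \<P>" and all_pp: "\<forall>D\<in>\<P>. pp_set R M D"
  shows "\<exists>\<Q>. finite \<Q> \<and> (\<forall>D\<in>\<Q>. pp_set R M D) \<and>
    (\<forall>s\<in>carrier R - {\<zero>}. \<exists>r\<in>carrier R - {\<zero>}.
       \<forall>v\<in>assignments M. \<forall>v'\<in>assignments M. \<forall>x\<in>carrier M.
         (\<forall>D\<in>\<Q>. v \<in> D \<longleftrightarrow> v' \<in> D) \<longrightarrow>
         (\<exists>x'\<in>carrier M. (\<forall>D\<in>\<P>. v(k := x) \<in> D \<longleftrightarrow> v'(k := x') \<in> D) \<and>
           ((\<forall>j. s \<odot>\<^bsub>M\<^esub> v' j = \<zero>\<^bsub>M\<^esub>) \<longrightarrow> r \<odot>\<^bsub>M\<^esub> x' = \<zero>\<^bsub>M\<^esub>)))"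
proof -
  note pp = bspec[OF all_pp]
  have "\<forall>D\<in>\<P>. \<exists>H. additive_subgroup H M \<and>
    (\<forall>v\<in>D. \<forall>h\<in>carrier M. v(k := v k \<oplus>\<^bsub>M\<^esub> h) \<in> D \<longleftrightarrow> h \<in> H)"
    by (intro ballI pp_set_fibre pp)
  then obtain H where H: "\<forall>D\<in>\<P>. additive_subgroup (H D) M \<and>
    (\<forall>v\<in>D. \<forall>h\<in>carrier M. v(k := v k \<oplus>\<^bsub>M\<^esub> h) \<in> D \<longleftrightarrow> h \<in> H D)"
    by (rule bchoice[THEN exE])
  have HG: "additive_subgroup (H D) M" if "D \<in> \<P>" for D
    using H that by blast
  have fib: "v(k := y) \<in> D \<longleftrightarrow> y \<ominus>\<^bsub>M\<^esub> x \<in> H D"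
    if "D \<in> \<P>" "v(k := x) \<in> D" "x \<in> carrier M" "y \<in> carrier M" for D v x y
  proof -
    have "(v(k := x))(k := (v(k := x)) k \<oplus>\<^bsub>M\<^esub> (y \<ominus>\<^bsub>M\<^esub> x)) \<in> D \<longleftrightarrow> y \<ominus>\<^bsub>M\<^esub> x \<in> H D"
      using bspec[OF conjunct2[OF bspec[OF H that(1)]] that(2)] that(3,4) by simp
    moreover have "x \<oplus>\<^bsub>M\<^esub> (y \<ominus>\<^bsub>M\<^esub> x) = y"
      using that by (simp add: M.minus_eq M.a_lcomm[of x y] M.r_neg)
    ultimately show ?thesis
      by simp
  qed
  have fib_add: "v(k := x \<oplus>\<^bsub>M\<^esub> h) \<in> D \<longleftrightarrow> v(k := x) \<in> D"
    if "D \<in> \<P>" "h \<in> H D" "x \<in> carrier M" for D v x h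
  proof -
    have h: "h \<in> carrier M"
      using additive_subgroup.a_Hcarr[OF HG[OF that(1)] that(2)] .
    have e: "x \<oplus>\<^bsub>M\<^esub> h \<ominus>\<^bsub>M\<^esub> x = h" "x \<ominus>\<^bsub>M\<^esub> (x \<oplus>\<^bsub>M\<^esub> h) = \<ominus>\<^bsub>M\<^esub> h"
      using that(3) h by (simp_all add: M.minus_eq M.minus_add M.a_assoc M.a_comm[of h] M.r_neg1 M.r_neg2)
    show ?thesis
      using fib[OF that(1), of v x "x \<oplus>\<^bsub>M\<^esub> h"] fib[OF that(1), of v "x \<oplus>\<^bsub>M\<^esub> h" x] that h e
        additive_subgroup.a_inv_closed[OF HG[OF that(1)] that(2)] by auto
  qed
  define HS where "HS S = {h \<in> carrier M. \<forall>D\<in>S. h \<in> H D}" for S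
  define F where "F S = {Q \<in> \<P>. finite_index M (H Q) (HS S)}" for S
  define KS where "KS S = {h \<in> HS S. \<forall>Q\<in>F S. h \<in> H Q}" for S
  have FP: "F S \<subseteq> \<P>" and finF: "finite (F S)" for S
    using fin by (auto simp: F_def)
  have INT: "additive_subgroup {h \<in> carrier M. \<forall>D\<in>S. h \<in> H D} M" if "S \<subseteq> \<P>" for S
    using that HG unfolding M.additive_subgroup_iff by auto
  have HSG: "additive_subgroup (HS S) M" if "S \<subseteq> \<P>" for S
    using INT[OF that] by (simp add: HS_def)
  have KSG: "additive_subgroup (KS S) M" if "S \<subseteq> \<P>" for S
  proof -
    have "KS S = {h \<in> carrier M. \<forall>D\<in>S \<union> F S. h \<in> H D}"
      by (auto simp: KS_def HS_def)
    then show ?thesis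
      using INT[of "S \<union> F S"] that FP by auto
  qed
  have "\<exists>T. finite T \<and> T \<subseteq> HS S \<and> (\<forall>x\<in>HS S. \<exists>t\<in>T. \<forall>Q\<in>F S. x \<ominus>\<^bsub>M\<^esub> t \<in> H Q)" if "S \<subseteq> \<P>" for S
    using FP HG by (intro M.finite_index_INT finF HSG that) (auto simp: F_def)
  then have "\<forall>S\<in>Pow \<P>. \<exists>T. finite T \<and> T \<subseteq> HS S \<and> (\<forall>x\<in>HS S. \<exists>t\<in>T. \<forall>Q\<in>F S. x \<ominus>\<^bsub>M\<^esub> t \<in> H Q)"
    by blast
  then obtain T where T: "\<forall>S\<in>Pow \<P>. finite (T S) \<and> T S \<subseteq> HS S \<and>
      (\<forall>x\<in>HS S. \<exists>t\<in>T S. \<forall>Q\<in>F S. x \<ominus>\<^bsub>M\<^esub> t \<in> H Q)"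
    by (rule bchoice[THEN exE])
  have KSfin: "finite_index M (KS S) (HS S)" if "S \<subseteq> \<P>" for S
  proof -
    have "x \<ominus>\<^bsub>M\<^esub> t \<in> KS S" if "x \<in> HS S" "t \<in> HS S" "\<forall>Q\<in>F S. x \<ominus>\<^bsub>M\<^esub> t \<in> H Q" for x t
      using that M.subgroup_diff_closed[OF HSG[OF \<open>S \<subseteq> \<P>\<close>]] by (auto simp: KS_def)
    then show ?thesis
      unfolding finite_index_def using T that by (intro exI[of _ "T S"]) blast
  qed
  \<comment> \<open>One coset for each condition suffices: the shifts that bring a given point into
    \<open>Q\<close> form a single coset of \<open>H Q\<close> or the empty set.\<close>
  have "\<exists>Y. finite Y \<and> Y \<subseteq> KS S \<and>
    (\<forall>A. (\<forall>i\<in>\<P> - F S. finite (A i) \<and> card (A i) \<le> 1 \<and> A i \<subseteq> carrier M) \<longrightarrow>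
      (\<exists>y\<in>Y. \<forall>i\<in>\<P> - F S. \<forall>a\<in>A i. y \<ominus>\<^bsub>M\<^esub> a \<notin> H i))" if "S \<subseteq> \<P>" for S
  proof (intro M.finite_neumann KSG that)
    show "finite (\<P> - F S)"
      using fin by simp
    fix Q assume Q: "Q \<in> \<P> - F S"
    then show "additive_subgroup (H Q) M"
      using HG by blast
    \<comment> \<open>Infinite index passes down from \<open>HS S\<close> to \<open>KS S\<close>,
      because the latter has finite index in the former.\<close>
    show "\<not> finite_index M (H Q) (KS S)"
    proof
      assume "finite_index M (H Q) (KS S)"
      moreover have "KS S \<subseteq> HS S"
        by (auto simp: KS_def)
      ultimately have "finite_index M (H Q) (HS S)"
        using M.finite_index_trans KSfin[OF that] HSG[OF that] by blast
      then show False
        using Q by (simp add: F_def)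
    qed
  qed
  then have "\<forall>S\<in>Pow \<P>. \<exists>Y. finite Y \<and> Y \<subseteq> KS S \<and>
    (\<forall>A. (\<forall>i\<in>\<P> - F S. finite (A i) \<and> card (A i) \<le> 1 \<and> A i \<subseteq> carrier M) \<longrightarrow>
      (\<exists>y\<in>Y. \<forall>i\<in>\<P> - F S. \<forall>a\<in>A i. y \<ominus>\<^bsub>M\<^esub> a \<notin> H i))"
    by blast
  then obtain Y where Y: "\<forall>S\<in>Pow \<P>. finite (Y S) \<and> Y S \<subseteq> KS S \<and>
    (\<forall>A. (\<forall>i\<in>\<P> - F S. finite (A i) \<and> card (A i) \<le> 1 \<and> A i \<subseteq> carrier M) \<longrightarrow>
      (\<exists>y\<in>Y S. \<forall>i\<in>\<P> - F S. \<forall>a\<in>A i. y \<ominus>\<^bsub>M\<^esub> a \<notin> H i))"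
    by (rule bchoice[THEN exE])
  define B where "B = (\<lambda>(S, S', j). {u \<in> assignments M. \<forall>D\<in>S. u \<in> D} \<inter>
    {u \<in> assignments M. \<forall>Q\<in>S'. u \<in> {u \<in> assignments M. u(k := u k \<oplus>\<^bsub>M\<^esub> j Q) \<in> Q}})"
  \<comment> \<open>Extensional functions on \<open>S'\<close> with values in \<open>T S\<close>
    keep the set of indices finite.\<close>
  define \<Omega> where "\<Omega> = (SIGMA S:Pow \<P>. SIGMA S':Pow (F S). PiE S' (\<lambda>_. T S))"
  have fin\<Omega>: "finite \<Omega>"
    unfolding \<Omega>_def using fin finF T
    by (intro finite_SigmaI finite_PiE) (auto intro: finite_subset)
  have Tc: "t \<in> carrier M" if "t \<in> T S" "S \<subseteq> \<P>" for t S
    using T that by (auto simp: HS_def)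
  have ppB: "pp_set R M (B \<omega>)" if "\<omega> \<in> \<Omega>" for \<omega>
  proof -
    obtain S S' j where \<omega>: "\<omega> = (S, S', j)" "S \<subseteq> \<P>" "S' \<subseteq> F S" "j \<in> PiE S' (\<lambda>_. T S)"
      using \<open>\<omega> \<in> \<Omega>\<close> unfolding \<Omega>_def by auto
    have "pp_set R M {u \<in> assignments M. u(k := u k \<oplus>\<^bsub>M\<^esub> j Q) \<in> Q}" if "Q \<in> S'" for Q
    proof -
      have "Q \<in> \<P>"
        using that \<omega>(3) FP by blast
      then show ?thesis
        using that \<omega> by (intro pp_set_shift pp Tc[of _ S]) auto
    qed
    moreover have "finite S" "finite S'"
      using \<omega> fin finF by (auto intro: finite_subset)
    ultimately show ?thesis
      using \<omega> pp unfolding \<omega>(1) B_def prod.case by (intro pp_set_Int pp_set_INT) auto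
  qed
  have memB: "v(k := x) \<in> B (S, S', j) \<longleftrightarrow>
    (\<forall>D\<in>S. v(k := x) \<in> D) \<and> (\<forall>Q\<in>S'. v(k := x \<oplus>\<^bsub>M\<^esub> j Q) \<in> Q)"
    if "v \<in> assignments M" "x \<in> carrier M" for v x S S' j
    using that by (auto simp: B_def)
  define E where "E \<omega> = {v \<in> assignments M. \<exists>x\<in>carrier M. v(k := x) \<in> B \<omega>}" for \<omega>
  have "\<exists>r\<in>carrier R - {\<zero>}.
       \<forall>v\<in>assignments M. \<forall>v'\<in>assignments M. \<forall>x\<in>carrier M.
         (\<forall>D\<in>E ` \<Omega>. v \<in> D \<longleftrightarrow> v' \<in> D) \<longrightarrow>
         (\<exists>x'\<in>carrier M. (\<forall>D\<in>\<P>. v(k := x) \<in> D \<longleftrightarrow> v'(k := x') \<in> D) \<and>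
           ((\<forall>j. s \<odot>\<^bsub>M\<^esub> v' j = \<zero>\<^bsub>M\<^esub>) \<longrightarrow> r \<odot>\<^bsub>M\<^esub> x' = \<zero>\<^bsub>M\<^esub>))"
    if s: "s \<in> carrier R - {\<zero>}" for s
  proof -
    have "\<exists>r\<in>carrier R - {\<zero>}. \<forall>\<omega>\<in>\<Omega>. \<forall>v\<in>assignments M. \<forall>x\<in>carrier M.
      (\<forall>j. s \<odot>\<^bsub>M\<^esub> v j = \<zero>\<^bsub>M\<^esub>) \<longrightarrow> v(k := x) \<in> B \<omega> \<longrightarrow>
      (\<exists>y\<in>carrier M. r \<odot>\<^bsub>M\<^esub> y = \<zero>\<^bsub>M\<^esub> \<and> v(k := y) \<in> B \<omega>)"
    proof (rule uniform_scalar[OF fin\<Omega>])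
      fix \<omega> q r
      assume *: "\<forall>v\<in>assignments M. \<forall>x\<in>carrier M.
        (\<forall>j. s \<odot>\<^bsub>M\<^esub> v j = \<zero>\<^bsub>M\<^esub>) \<longrightarrow> v(k := x) \<in> B \<omega> \<longrightarrow>
        (\<exists>y\<in>carrier M. r \<odot>\<^bsub>M\<^esub> y = \<zero>\<^bsub>M\<^esub> \<and> v(k := y) \<in> B \<omega>)" and qr: "q \<in> carrier R" "r \<in> carrier R"
      have "(q \<otimes> r) \<odot>\<^bsub>M\<^esub> y = \<zero>\<^bsub>M\<^esub>" if "y \<in> carrier M" "r \<odot>\<^bsub>M\<^esub> y = \<zero>\<^bsub>M\<^esub>" for y
        using that qr by (simp add: smult_assoc1)
      then show "\<forall>v\<in>assignments M. \<forall>x\<in>carrier M.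
        (\<forall>j. s \<odot>\<^bsub>M\<^esub> v j = \<zero>\<^bsub>M\<^esub>) \<longrightarrow> v(k := x) \<in> B \<omega> \<longrightarrow>
        (\<exists>y\<in>carrier M. (q \<otimes> r) \<odot>\<^bsub>M\<^esub> y = \<zero>\<^bsub>M\<^esub> \<and> v(k := y) \<in> B \<omega>)"
        using * by meson
    qed (use pp_set_torsion_witness[OF ppB s] in blast)
    then obtain r1 where r1: "r1 \<in> carrier R - {\<zero>}" "\<forall>\<omega>\<in>\<Omega>. \<forall>v\<in>assignments M. \<forall>x\<in>carrier M.
      (\<forall>j. s \<odot>\<^bsub>M\<^esub> v j = \<zero>\<^bsub>M\<^esub>) \<longrightarrow> v(k := x) \<in> B \<omega> \<longrightarrow>
      (\<exists>y\<in>carrier M. r1 \<odot>\<^bsub>M\<^esub> y = \<zero>\<^bsub>M\<^esub> \<and> v(k := y) \<in> B \<omega>)"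
      by blast
    have "finite (\<Union> (Y ` Pow \<P>))" "\<Union> (Y ` Pow \<P>) \<subseteq> carrier M"
      using fin Y by (auto simp: KS_def HS_def subset_iff)
    from common_annihilator[OF this] obtain r2 where
      r2: "r2 \<in> carrier R - {\<zero>}" "\<forall>b\<in>\<Union> (Y ` Pow \<P>). r2 \<odot>\<^bsub>M\<^esub> b = \<zero>\<^bsub>M\<^esub>"
      by blast
    have main: "\<exists>x'\<in>carrier M. (\<forall>D\<in>\<P>. v(k := x) \<in> D \<longleftrightarrow> v'(k := x') \<in> D) \<and>
           ((\<forall>j. s \<odot>\<^bsub>M\<^esub> v' j = \<zero>\<^bsub>M\<^esub>) \<longrightarrow> (r1 \<otimes> r2) \<odot>\<^bsub>M\<^esub> x' = \<zero>\<^bsub>M\<^esub>)"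
      if v: "v \<in> assignments M" "v' \<in> assignments M" and x: "x \<in> carrier M"
        and eq: "\<forall>D\<in>E ` \<Omega>. v \<in> D \<longleftrightarrow> v' \<in> D" for v v' x
    proof -
      define S where "S = {D \<in> \<P>. v(k := x) \<in> D}"
      have S: "S \<subseteq> \<P>"
        by (auto simp: S_def)
      \<comment> \<open>The conditions of finite index that are compatible with \<open>S\<close>
        over \<open>v\<close>, whether or not \<open>x\<close> satisfies them; \<open>j\<close>
        records how far \<open>x\<close> is from each.\<close>
      define S' where "S' = {Q \<in> F S. \<exists>y\<in>carrier M. v(k := y) \<in> Q \<and> (\<forall>D\<in>S. v(k := y) \<in> D)}"
      have S': "S' \<subseteq> F S"
        by (auto simp: S'_def)
      have "\<exists>t. t \<in> T S \<and> v(k := x \<oplus>\<^bsub>M\<^esub> t) \<in> Q" if "Q \<in> S'" for Q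
      proof -
        obtain y where y: "y \<in> carrier M" "v(k := y) \<in> Q" "\<forall>D\<in>S. v(k := y) \<in> D" and Q: "Q \<in> F S" "Q \<in> \<P>"
          using \<open>Q \<in> S'\<close> FP by (auto simp: S'_def)
        have "y \<ominus>\<^bsub>M\<^esub> x \<in> HS S"
          using fib[of _ v x y] x y by (auto simp: HS_def S_def)
        then obtain t where t: "t \<in> T S" "y \<ominus>\<^bsub>M\<^esub> x \<ominus>\<^bsub>M\<^esub> t \<in> H Q"
          using T S Q by blast
        have tc: "t \<in> carrier M"
          using Tc[OF t(1) S] .
        have "y \<ominus>\<^bsub>M\<^esub> (x \<oplus>\<^bsub>M\<^esub> t) \<in> H Q"
          using t(2) x y tc by (simp add: M.minus_eq M.minus_add M.a_assoc)
        then have "(x \<oplus>\<^bsub>M\<^esub> t) \<ominus>\<^bsub>M\<^esub> y \<in> H Q"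
          using M.subgroup_diff_sym[OF HG[OF Q(2)]] x y tc by blast
        then show ?thesis
          using fib[OF Q(2) y(2,1), of "x \<oplus>\<^bsub>M\<^esub> t"] x tc t(1) by blast
      qed
      then obtain j0 where j0: "\<forall>Q\<in>S'. j0 Q \<in> T S \<and> v(k := x \<oplus>\<^bsub>M\<^esub> j0 Q) \<in> Q"
        by metis
      define j where "j = restrict j0 S'"
      have j: "j \<in> PiE S' (\<lambda>_. T S)" "\<forall>Q\<in>S'. v(k := x \<oplus>\<^bsub>M\<^esub> j Q) \<in> Q"
        using j0 by (auto simp: j_def)
      have \<omega>: "(S, S', j) \<in> \<Omega>"
        using S S' j by (auto simp: \<Omega>_def)
      have "v(k := x) \<in> B (S, S', j)"
        using memB[OF v(1) x] j by (auto simp: S_def)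
      then have "v \<in> E (S, S', j)"
        using v x by (auto simp: E_def)
      then have "v' \<in> E (S, S', j)"
        using eq \<omega> by blast
      then obtain x1 where x1: "x1 \<in> carrier M" "v'(k := x1) \<in> B (S, S', j)"
        by (auto simp: E_def)
      \<comment> \<open>The point \<open>x1\<close> lies in the right set but need not be
        annihilated. If \<open>s\<close> kills \<open>v'\<close>, the bound \<open>r1\<close>
        supplies a point that is; otherwise nothing is claimed about annihilation.\<close>
      obtain x0 where x0: "x0 \<in> carrier M" "v'(k := x0) \<in> B (S, S', j)"
        "(\<forall>j. s \<odot>\<^bsub>M\<^esub> v' j = \<zero>\<^bsub>M\<^esub>) \<longrightarrow> r1 \<odot>\<^bsub>M\<^esub> x0 = \<zero>\<^bsub>M\<^esub>"
      proof (cases "\<forall>j. s \<odot>\<^bsub>M\<^esub> v' j = \<zero>\<^bsub>M\<^esub>")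
        case True
        then show thesis
          using bspec[OF bspec[OF bspec[OF r1(2) \<omega>] v(2)] x1(1)] x1(2) that by blast
      next
        case False
        then show thesis
          using that[OF x1] by blast
      qed
      have x0S: "\<forall>D\<in>S. v'(k := x0) \<in> D" and x0S': "\<forall>Q\<in>S'. v'(k := x0 \<oplus>\<^bsub>M\<^esub> j Q) \<in> Q"
        using x0(2) memB[OF v(2) x0(1)] by auto
      define A where "A Q = (if \<exists>a\<in>carrier M. v'(k := x0 \<oplus>\<^bsub>M\<^esub> a) \<in> Q
        then {SOME a. a \<in> carrier M \<and> v'(k := x0 \<oplus>\<^bsub>M\<^esub> a) \<in> Q} else {})" for Q
      have A: "a \<in> carrier M \<and> v'(k := x0 \<oplus>\<^bsub>M\<^esub> a) \<in> Q" if "a \<in> A Q" for a Q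
        using that someI_ex[of "\<lambda>a. a \<in> carrier M \<and> v'(k := x0 \<oplus>\<^bsub>M\<^esub> a) \<in> Q"]
        by (auto simp: A_def split: if_splits)
      have "\<forall>i\<in>\<P> - F S. finite (A i) \<and> card (A i) \<le> 1 \<and> A i \<subseteq> carrier M"
      proof (intro ballI conjI)
        fix Q
        show "finite (A Q)" "card (A Q) \<le> 1"
          by (simp_all add: A_def)
        show "A Q \<subseteq> carrier M"
          using A by blast
      qed
      then obtain h where h: "h \<in> Y S" "\<forall>i\<in>\<P> - F S. \<forall>a\<in>A i. h \<ominus>\<^bsub>M\<^esub> a \<notin> H i"
        using Y S by blast
      have hK: "h \<in> KS S" "h \<in> carrier M" "\<And>D. D \<in> S \<Longrightarrow> h \<in> H D" "\<And>D. D \<in> F S \<Longrightarrow> h \<in> H D"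
        using h(1) Y S by (auto simp: KS_def HS_def subset_iff)
      have "v(k := x) \<in> D \<longleftrightarrow> v'(k := x0 \<oplus>\<^bsub>M\<^esub> h) \<in> D" if D: "D \<in> \<P>" for D
      proof (cases "D \<in> S")
        case True
        then show ?thesis
          using fib_add[OF D hK(3) x0(1)] x0S by (auto simp: S_def)
      next
        case False
        then have vD: "v(k := x) \<notin> D"
          using D by (auto simp: S_def)
        have "v'(k := x0 \<oplus>\<^bsub>M\<^esub> h) \<notin> D"
        proof
          assume in_D: "v'(k := x0 \<oplus>\<^bsub>M\<^esub> h) \<in> D"
          show False
          proof (cases "D \<in> F S")
            case True
            have x0D: "v'(k := x0) \<in> D"
              using in_D fib_add[OF D hK(4)[OF True] x0(1)] by blast
            show False
            proof (cases "D \<in> S'")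
              case True
              have jc: "j D \<in> carrier M"
                using j(1) True Tc[OF _ S] by blast
              \<comment> \<open>Both \<open>x0\<close> and its shift by \<open>j D\<close> lie in
                \<open>D\<close>, so \<open>j D\<close> lies in \<open>H D\<close>. Then
                \<open>x\<close> and its shift by \<open>j D\<close> lie in \<open>D\<close>
                together, against \<open>vD\<close>.\<close>
              have "x0 \<oplus>\<^bsub>M\<^esub> j D \<ominus>\<^bsub>M\<^esub> x0 \<in> H D"
                using fib[OF D x0D x0(1), of "x0 \<oplus>\<^bsub>M\<^esub> j D"] x0S' True jc x0(1) by blast
              then have "j D \<in> H D"
                using jc x0(1) by (simp add: M.minus_eq M.a_assoc M.a_comm[of "j D"] M.r_neg2)
              then show False
                using fib_add[OF D _ x] j(2) True vD by blast
            next
              case nS': False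
              have "\<zero>\<^bsub>M\<^esub> \<in> HS S"
                using additive_subgroup.zero_closed[OF HSG[OF S]] .
              \<comment> \<open>\<open>T S\<close> need not contain zero, so \<open>t\<close>
                represents the class of zero; it lies in \<open>H D\<close>, and shifting by it does
                not affect \<open>D\<close>. Agreement on the set with index
                \<open>(S, {D}, ?j)\<close> gives \<open>v\<close> a point that satisfies
                \<open>S\<close> and \<open>D\<close>, which would put \<open>D\<close> into
                \<open>S'\<close>.\<close>
              then obtain t where t: "t \<in> T S" "\<zero>\<^bsub>M\<^esub> \<ominus>\<^bsub>M\<^esub> t \<in> H D"
                using T S True by blast
              have tc: "t \<in> carrier M"
                using Tc[OF t(1) S] .
              have tH: "t \<in> H D"
                using additive_subgroup.a_inv_closed[OF HG[OF D] t(2)] tc by (simp add: M.minus_eq)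
              let ?j = "\<lambda>Q\<in>{D}. t"
              have \<omega>': "(S, {D}, ?j) \<in> \<Omega>"
                using S True t(1) by (auto simp: \<Omega>_def)
              have "v'(k := x0) \<in> B (S, {D}, ?j)"
                using memB[OF v(2) x0(1)] x0S fib_add[OF D tH x0(1)] x0D by simp
              then have "v' \<in> E (S, {D}, ?j)"
                using v x0 by (auto simp: E_def)
              then have "v \<in> E (S, {D}, ?j)"
                using eq \<omega>' by blast
              then obtain y where y: "y \<in> carrier M" "v(k := y) \<in> B (S, {D}, ?j)"
                by (auto simp: E_def)
              then have "\<forall>D\<in>S. v(k := y) \<in> D" "v(k := y \<oplus>\<^bsub>M\<^esub> t) \<in> D"
                using memB[OF v(1) y(1)] by auto
              then show False
                using nS' True fib_add[OF D tH y(1)] y(1) by (auto simp: S'_def)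
            qed
          next
            case False
            then have "A D \<noteq> {}"
              using in_D hK(2) by (auto simp: A_def)
            then obtain a where a: "a \<in> A D" "a \<in> carrier M" "v'(k := x0 \<oplus>\<^bsub>M\<^esub> a) \<in> D"
              using A by blast
            have "x0 \<oplus>\<^bsub>M\<^esub> h \<ominus>\<^bsub>M\<^esub> (x0 \<oplus>\<^bsub>M\<^esub> a) \<in> H D"
              using fib[OF D a(3), of "x0 \<oplus>\<^bsub>M\<^esub> h"] in_D x0(1) a(2) hK(2) by blast
            moreover have "x0 \<oplus>\<^bsub>M\<^esub> h \<ominus>\<^bsub>M\<^esub> (x0 \<oplus>\<^bsub>M\<^esub> a) = h \<ominus>\<^bsub>M\<^esub> a"
              using x0(1) a(2) hK(2)
              by (simp add: M.minus_eq M.minus_add M.a_assoc M.a_lcomm[of h "\<ominus>\<^bsub>M\<^esub> x0"] M.r_neg2)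
            ultimately show False
              using h(2) a(1) False D by auto
          qed
        qed
        then show ?thesis
          using vD by blast
      qed
      moreover have "(r1 \<otimes> r2) \<odot>\<^bsub>M\<^esub> (x0 \<oplus>\<^bsub>M\<^esub> h) = \<zero>\<^bsub>M\<^esub>" if "\<forall>j. s \<odot>\<^bsub>M\<^esub> v' j = \<zero>\<^bsub>M\<^esub>"
      proof -
        have "r1 \<odot>\<^bsub>M\<^esub> x0 = \<zero>\<^bsub>M\<^esub>" "r2 \<odot>\<^bsub>M\<^esub> h = \<zero>\<^bsub>M\<^esub>"
          using x0(3) that r2(2) h(1) S by auto
        then show ?thesis
          using r1(1) r2(1) x0(1) hK(2)
          by (simp add: smult_r_distr smult_assoc1 smult_smult_comm[of r1])
      qed
      ultimately show ?thesis
        using x0(1) hK(2) by blast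
    qed
    have "r1 \<otimes> r2 \<in> carrier R - {\<zero>}"
      using r1(1) r2(1) by (auto simp: integral_iff)
    then show ?thesis
      by (rule bexI[rotated]) (intro ballI impI, rule main)
  qed
  moreover have "\<forall>D\<in>E ` \<Omega>. pp_set R M D"
    unfolding E_def using pp_set_Ex[OF ppB] by blast
  moreover have "finite (E ` \<Omega>)"
    using fin\<Omega> by simp
  ultimately show ?thesis
    by (intro exI[of _ "E ` \<Omega>"] conjI ballI[of "carrier R - {\<zero>}"])
qed

end

section \<open>Formulas in a torsion module\<close>

context torsion_pid_module
begin

lemma term_linear_form:
  assumes "\<And>a. a \<in> carrier M \<Longrightarrow> uneg M a = \<ominus>\<^bsub>M\<^esub> a" "set_LR_term t \<subseteq> carrier R"
  shows "\<exists>f\<in>linear_forms R M. \<forall>v\<in>assignments M. f v = term_val M v t"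
  using assms(2)
proof (induction t)
  case (Var k)
  show ?case by (rule bexI[OF _ linear_forms.Proj[of k]]) simp
next
  case Zero
  show ?case by (rule bexI[OF _ linear_forms.Zero]) simp
next
  case (Plus s t)
  obtain f where f: "f \<in> linear_forms R M" "\<forall>v\<in>assignments M. f v = term_val M v s"
    using Plus by auto
  obtain g where g: "g \<in> linear_forms R M" "\<forall>v\<in>assignments M. g v = term_val M v t"
    using Plus by auto
  show ?case
    using f g by (intro bexI[of _ "\<lambda>v. f v \<oplus>\<^bsub>M\<^esub> g v"] linear_forms.Plus) auto
next
  case (Uminus t)
  then obtain f where f: "f \<in> linear_forms R M" "\<forall>v\<in>assignments M. f v = term_val M v t"
    by auto
  have "uneg M (f v) = (\<ominus> \<one>) \<odot>\<^bsub>M\<^esub> f v" if "v \<in> assignments M" for v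
    using assms(1) minus_one_smult linear_form_closed[OF f(1)] that by simp
  then show ?case
    using f linear_forms_minus[OF f(1)] by (intro bexI[of _ "\<lambda>v. (\<ominus> \<one>) \<odot>\<^bsub>M\<^esub> f v"]) auto
next
  case (Scal r t)
  then obtain f where "f \<in> linear_forms R M" "\<forall>v\<in>assignments M. f v = term_val M v t"
    by auto
  then show ?case
    using Scal by (intro bexI[of _ "\<lambda>v. r \<odot>\<^bsub>M\<^esub> f v"] linear_forms.Scal) auto
qed

text \<open>Instead of a Boolean combination equivalent to \<phi>, only the dependence of its truth
  value on finitely many sets is kept. Negation then uses the same sets, conjunction their union,
  and a quantifier is one application of \<open>back_and_forth\<close>, read in both
  directions.\<close>

lemma formula_decided:
  assumes "\<And>a. a \<in> carrier M \<Longrightarrow> uneg M a = \<ominus>\<^bsub>M\<^esub> a" "LR_formula R \<phi>"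
  shows "\<exists>\<P>. finite \<P> \<and> (\<forall>D\<in>\<P>. pp_set R M D) \<and>
    (\<forall>v\<in>assignments M. \<forall>v'\<in>assignments M.
      (\<forall>D\<in>\<P>. v \<in> D \<longleftrightarrow> v' \<in> D) \<longrightarrow> (sat M v \<phi> \<longleftrightarrow> sat M v' \<phi>))"
  using assms(2)
proof (induction \<phi>)
  case (Eq s t)
  then have "set_LR_term s \<subseteq> carrier R" "set_LR_term t \<subseteq> carrier R"
    by (auto simp: LR_formula_def)
  then have "\<exists>f\<in>linear_forms R M. \<forall>v\<in>assignments M. f v = term_val M v s"
    "\<exists>f\<in>linear_forms R M. \<forall>v\<in>assignments M. f v = term_val M v t"
    by (intro term_linear_form assms(1); simp)+
  then obtain f g where fg: "f \<in> linear_forms R M" "\<forall>v\<in>assignments M. f v = term_val M v s"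
    "g \<in> linear_forms R M" "\<forall>v\<in>assignments M. g v = term_val M v t"
    by (elim bexE) (rule that; assumption)
  show ?case
    using pp_set_equation[OF fg(1,3)] fg(2,4)
    by (intro exI[of _ "{{v \<in> assignments M. f v = g v}}"]) auto
next
  case (Neg \<phi>)
  then show ?case
    by (simp add: LR_formula_def)
next
  case (Conj \<phi> \<psi>)
  then have "LR_formula R \<phi>" "LR_formula R \<psi>"
    by (auto simp: LR_formula_def)
  obtain \<P> where P: "finite \<P>" "\<forall>D\<in>\<P>. pp_set R M D"
    "\<forall>v\<in>assignments M. \<forall>v'\<in>assignments M. (\<forall>D\<in>\<P>. v \<in> D \<longleftrightarrow> v' \<in> D) \<longrightarrow> (sat M v \<phi> \<longleftrightarrow> sat M v' \<phi>)"
    using Conj.IH(1)[OF \<open>LR_formula R \<phi>\<close>] by (elim exE conjE) (rule that; assumption)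
  obtain \<Q> where Q: "finite \<Q>" "\<forall>D\<in>\<Q>. pp_set R M D"
    "\<forall>v\<in>assignments M. \<forall>v'\<in>assignments M. (\<forall>D\<in>\<Q>. v \<in> D \<longleftrightarrow> v' \<in> D) \<longrightarrow> (sat M v \<psi> \<longleftrightarrow> sat M v' \<psi>)"
    using Conj.IH(2)[OF \<open>LR_formula R \<psi>\<close>] by (elim exE conjE) (rule that; assumption)
  show ?case
  proof (intro exI[of _ "\<P> \<union> \<Q>"] conjI ballI impI)
    fix v v'
    assume v: "v \<in> assignments M" "v' \<in> assignments M" "\<forall>D\<in>\<P> \<union> \<Q>. v \<in> D \<longleftrightarrow> v' \<in> D"
    have "sat M v \<phi> \<longleftrightarrow> sat M v' \<phi>"
      using bspec[OF bspec[OF P(3) v(1)] v(2)] v(3) by blast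
    moreover have "sat M v \<psi> \<longleftrightarrow> sat M v' \<psi>"
      using bspec[OF bspec[OF Q(3) v(1)] v(2)] v(3) by blast
    ultimately show "sat M v (Conj \<phi> \<psi>) \<longleftrightarrow> sat M v' (Conj \<phi> \<psi>)"
      by simp
  qed (use P(1,2) Q(1,2) in auto)
next
  case (Exi k \<phi>)
  then obtain \<P> where P: "finite \<P>" "\<forall>D\<in>\<P>. pp_set R M D"
    "\<forall>v\<in>assignments M. \<forall>v'\<in>assignments M. (\<forall>D\<in>\<P>. v \<in> D \<longleftrightarrow> v' \<in> D) \<longrightarrow> (sat M v \<phi> \<longleftrightarrow> sat M v' \<phi>)"
    by (auto simp: LR_formula_def)
  obtain \<Q> where Q: "finite \<Q>" "\<forall>D\<in>\<Q>. pp_set R M D"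
    "\<forall>s\<in>carrier R - {\<zero>}. \<exists>r\<in>carrier R - {\<zero>}.
       \<forall>v\<in>assignments M. \<forall>v'\<in>assignments M. \<forall>x\<in>carrier M.
         (\<forall>D\<in>\<Q>. v \<in> D \<longleftrightarrow> v' \<in> D) \<longrightarrow>
         (\<exists>x'\<in>carrier M. (\<forall>D\<in>\<P>. v(k := x) \<in> D \<longleftrightarrow> v'(k := x') \<in> D) \<and>
           ((\<forall>j. s \<odot>\<^bsub>M\<^esub> v' j = \<zero>\<^bsub>M\<^esub>) \<longrightarrow> r \<odot>\<^bsub>M\<^esub> x' = \<zero>\<^bsub>M\<^esub>))"
    using back_and_forth[OF P(1,2), of k] by (elim exE conjE) (rule that; assumption)
  have ext: "\<exists>x'\<in>carrier M. \<forall>D\<in>\<P>. v(k := x) \<in> D \<longleftrightarrow> v'(k := x') \<in> D"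
    if "v \<in> assignments M" "v' \<in> assignments M" "x \<in> carrier M" "\<forall>D\<in>\<Q>. v \<in> D \<longleftrightarrow> v' \<in> D" for v v' x
  proof -
    \<comment> \<open>Any nonzero scalar would do, as the clause on annihilators is dropped
      here.\<close>
    have "\<one> \<in> carrier R - {\<zero>}"
      by simp
    from bspec[OF Q(3) this] that show ?thesis
      by blast
  qed
  have imp: "sat M v' (Exi k \<phi>)"
    if v: "v \<in> assignments M" "v' \<in> assignments M" "\<forall>D\<in>\<Q>. v \<in> D \<longleftrightarrow> v' \<in> D" "sat M v (Exi k \<phi>)" for v v'
  proof -
    obtain x where x: "x \<in> carrier M" "sat M (v(k := x)) \<phi>"
      using v(4) by auto
    obtain x' where x': "x' \<in> carrier M" "\<forall>D\<in>\<P>. v(k := x) \<in> D \<longleftrightarrow> v'(k := x') \<in> D"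
      using ext[OF v(1,2) x(1) v(3)] by blast
    have "v(k := x) \<in> assignments M" "v'(k := x') \<in> assignments M"
      using v x x' by auto
    then have "sat M (v'(k := x')) \<phi>"
      using P(3) x' x(2) by blast
    then show ?thesis
      using x' by auto
  qed
  have "sat M v (Exi k \<phi>) \<longleftrightarrow> sat M v' (Exi k \<phi>)"
    if "v \<in> assignments M" "v' \<in> assignments M" "\<forall>D\<in>\<Q>. v \<in> D \<longleftrightarrow> v' \<in> D" for v v'
    using imp[OF that] imp[OF that(2,1)] that(3) by blast
  then show ?case
    using Q(1,2) by (intro exI[of _ \<Q>]) blast
qed

text \<open>In \<open>back_and_forth\<close> both assignments are taken to be \<open>v\<close>. The
  required agreement is then trivial, and the point returned satisfies the same deciding conditions
  as \<open>x\<close> while being killed by \<open>r\<close>.\<close>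

lemma torsion_witness:
  assumes "\<And>a. a \<in> carrier M \<Longrightarrow> uneg M a = \<ominus>\<^bsub>M\<^esub> a" "LR_formula R \<phi>" "s \<in> carrier R - {\<zero>}"
  shows "\<exists>r\<in>carrier R - {\<zero>}. \<forall>v\<in>assignments M. \<forall>x\<in>carrier M.
    (\<forall>j. s \<odot>\<^bsub>M\<^esub> v j = \<zero>\<^bsub>M\<^esub>) \<longrightarrow> sat M (v(k := x)) \<phi> \<longrightarrow>
    (\<exists>y\<in>carrier M. r \<odot>\<^bsub>M\<^esub> y = \<zero>\<^bsub>M\<^esub> \<and> sat M (v(k := y)) \<phi>)"
proof -
  obtain \<P> where P: "finite \<P>" "\<forall>D\<in>\<P>. pp_set R M D"
    "\<forall>v\<in>assignments M. \<forall>v'\<in>assignments M. (\<forall>D\<in>\<P>. v \<in> D \<longleftrightarrow> v' \<in> D) \<longrightarrow> (sat M v \<phi> \<longleftrightarrow> sat M v' \<phi>)"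
    using formula_decided[OF assms(1,2)] by blast
  obtain \<Q> where Q:
    "\<forall>s\<in>carrier R - {\<zero>}. \<exists>r\<in>carrier R - {\<zero>}.
       \<forall>v\<in>assignments M. \<forall>v'\<in>assignments M. \<forall>x\<in>carrier M.
         (\<forall>D\<in>\<Q>. v \<in> D \<longleftrightarrow> v' \<in> D) \<longrightarrow>
         (\<exists>x'\<in>carrier M. (\<forall>D\<in>\<P>. v(k := x) \<in> D \<longleftrightarrow> v'(k := x') \<in> D) \<and>
           ((\<forall>j. s \<odot>\<^bsub>M\<^esub> v' j = \<zero>\<^bsub>M\<^esub>) \<longrightarrow> r \<odot>\<^bsub>M\<^esub> x' = \<zero>\<^bsub>M\<^esub>))"
    using back_and_forth[OF P(1,2), of k] by (elim exE conjE) (rule that; assumption)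
  obtain r where r: "r \<in> carrier R - {\<zero>}"
    "\<forall>v\<in>assignments M. \<forall>v'\<in>assignments M. \<forall>x\<in>carrier M.
         (\<forall>D\<in>\<Q>. v \<in> D \<longleftrightarrow> v' \<in> D) \<longrightarrow>
         (\<exists>x'\<in>carrier M. (\<forall>D\<in>\<P>. v(k := x) \<in> D \<longleftrightarrow> v'(k := x') \<in> D) \<and>
           ((\<forall>j. s \<odot>\<^bsub>M\<^esub> v' j = \<zero>\<^bsub>M\<^esub>) \<longrightarrow> r \<odot>\<^bsub>M\<^esub> x' = \<zero>\<^bsub>M\<^esub>))"
    using bspec[OF Q assms(3)] by (elim bexE) (rule that; assumption)
  have "\<exists>y\<in>carrier M. r \<odot>\<^bsub>M\<^esub> y = \<zero>\<^bsub>M\<^esub> \<and> sat M (v(k := y)) \<phi>"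
    if v: "v \<in> assignments M" "x \<in> carrier M" "\<forall>j. s \<odot>\<^bsub>M\<^esub> v j = \<zero>\<^bsub>M\<^esub>" "sat M (v(k := x)) \<phi>" for v x
  proof -
    obtain y where y: "y \<in> carrier M" "\<forall>D\<in>\<P>. v(k := x) \<in> D \<longleftrightarrow> v(k := y) \<in> D" "r \<odot>\<^bsub>M\<^esub> y = \<zero>\<^bsub>M\<^esub>"
      using bspec[OF bspec[OF bspec[OF r(2) v(1)] v(1)] v(2)] v(3) by blast
    have "v(k := x) \<in> assignments M" "v(k := y) \<in> assignments M"
      using v y by auto
    then have "sat M (v(k := y)) \<phi>"
      using P(3) y(2) v(4) by blast
    then show ?thesis
      using y by blast
  qed
  then show ?thesis
    using r(1) by blast
qed

end

section \<open>Sentences\<close>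

lemma term_val_cong:
  "\<forall>j\<in>term_vars t. v j = w j \<Longrightarrow> term_val M v t = term_val M w t"
  by (induction t) auto

lemma sat_cong:
  "\<forall>j\<in>free_vars \<phi>. v j = w j \<Longrightarrow> sat M v \<phi> \<longleftrightarrow> sat M w \<phi>"
proof (induction \<phi> arbitrary: v w)
  case (Eq s t)
  then show ?case
    using term_val_cong[of s v w M] term_val_cong[of t v w M] by simp
next
  case (Conj \<phi> \<psi>)
  then show ?case
    by (metis UnCI free_vars.simps(3) sat.simps(3))
next
  case (Exi k \<phi>)
  have "sat M (v(k := a)) \<phi> \<longleftrightarrow> sat M (w(k := a)) \<phi>" for a
    using Exi.prems by (intro Exi.IH) auto
  then show ?case
    by simp
qed auto

lemma finite_free_vars: "finite (free_vars \<phi>)"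
proof -
  have "finite (term_vars t)" for t :: "'r LR_term"
    by (induction t) auto
  then show ?thesis
    by (induction \<phi>) auto
qed

section \<open>The witness bound as a sentence\<close>

primrec closure :: "nat \<Rightarrow> 'r LR_form \<Rightarrow> 'r LR_form" where
  "closure 0 \<phi> = \<phi>"
| "closure (Suc n) \<phi> = closure n (Univ n \<phi>)"

lemma LR_sentence_closure:
  assumes "LR_formula R \<phi>" "free_vars \<phi> \<subseteq> {..<n}"
  shows "LR_sentence R (closure n \<phi>)"
  using assms
proof (induction n arbitrary: \<phi>)
  case 0
  then show ?case by (simp add: LR_sentence_def)
next
  case (Suc n)
  have "LR_sentence R (closure n (Univ n \<phi>))"
    using Suc.prems by (intro Suc.IH) (auto simp: LR_formula_def less_Suc_eq)
  then show ?case by simp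
qed

lemma true_in_closure:
  fixes M :: "('r, 'a) LR_struct"
  shows "true_in M (closure n \<phi>) \<longleftrightarrow> (\<forall>v\<in>assignments M. sat M v \<phi>)"
proof (induction n arbitrary: \<phi>)
  case 0
  show ?case by (simp add: true_in_def)
next
  case (Suc n)
  have "(\<forall>v\<in>assignments M. sat M v (Univ n \<phi>)) \<longleftrightarrow> (\<forall>v\<in>assignments M. sat M v \<phi>)"
  proof
    assume *: "\<forall>v\<in>assignments M. sat M v (Univ n \<phi>)"
    show "\<forall>v\<in>assignments M. sat M v \<phi>"
    proof
      fix v :: "nat \<Rightarrow> 'a" assume v: "v \<in> assignments M"
      then have "sat M (v(n := v n)) \<phi>"
        using bspec[OF * v] by (simp del: fun_upd_triv)
      then show "sat M v \<phi>"
        by simp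
    qed
  next
    assume *: "\<forall>v\<in>assignments M. sat M v \<phi>"
    have "v(n := a) \<in> assignments M" if "v \<in> assignments M" "a \<in> carrier M"
      for v :: "nat \<Rightarrow> 'a" and a
      using that by simp
    then show "\<forall>v\<in>assignments M. sat M v (Univ n \<phi>)"
      using * by simp
  qed
  then show ?case
    using Suc.IH by simp
qed

primrec annihilated :: "'r \<Rightarrow> nat \<Rightarrow> 'r LR_form" where
  "annihilated s 0 = Eq Zero Zero"
| "annihilated s (Suc n) = Conj (annihilated s n) (Eq (Scal s (Var n)) Zero)"

lemma sat_annihilated: "sat M v (annihilated s n) \<longleftrightarrow> (\<forall>j<n. s \<odot>\<^bsub>M\<^esub> v j = \<zero>\<^bsub>M\<^esub>)"
  by (induction n) (auto simp: less_Suc_eq)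

lemma free_vars_annihilated: "free_vars (annihilated s n) = {..<n}"
  by (induction n) (simp_all add: lessThan_Suc)

lemma LR_formula_annihilated: "s \<in> carrier R \<Longrightarrow> LR_formula R (annihilated s n)"
  by (induction n) (auto simp: LR_formula_def)

text \<open>An implication spelled with negation and conjunction. The two scalars are symbols of the
  language and no parameters occur, so the models of a complete theory agree on it.\<close>

definition witness_bound :: "'r \<Rightarrow> 'r \<Rightarrow> nat \<Rightarrow> nat \<Rightarrow> 'r LR_form \<Rightarrow> 'r LR_form" where
  "witness_bound s r n k \<phi> = closure n (Neg (Conj (annihilated s n) (Conj (Exi k \<phi>)
     (Neg (Exi k (Conj (Eq (Scal r (Var k)) Zero) \<phi>))))))"

lemma LR_sentence_witness_bound:
  assumes "LR_formula R \<phi>" "s \<in> carrier R" "r \<in> carrier R" "free_vars \<phi> - {k} \<subseteq> {..<n}"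
  shows "LR_sentence R (witness_bound s r n k \<phi>)"
  unfolding witness_bound_def
  using assms LR_formula_annihilated[OF assms(2), of n]
  by (intro LR_sentence_closure) (auto simp: LR_formula_def free_vars_annihilated)

lemma true_in_witness_bound:
  "true_in M (witness_bound s r n k \<phi>) \<longleftrightarrow>
    (\<forall>v\<in>assignments M. (\<forall>j<n. s \<odot>\<^bsub>M\<^esub> v j = \<zero>\<^bsub>M\<^esub>) \<longrightarrow> sat M v (Exi k \<phi>) \<longrightarrow>
      (\<exists>y\<in>carrier M. r \<odot>\<^bsub>M\<^esub> y = \<zero>\<^bsub>M\<^esub> \<and> sat M (v(k := y)) \<phi>))"
  unfolding witness_bound_def true_in_closure by (auto simp: sat_annihilated)

lemma (in torsion_pid_module) witness_bound_exists:
  assumes "\<And>a. a \<in> carrier M \<Longrightarrow> uneg M a = \<ominus>\<^bsub>M\<^esub> a" "LR_formula R \<phi>" "s \<in> carrier R - {\<zero>}"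
    and "free_vars \<phi> - {k} \<subseteq> {..<n}"
  shows "\<exists>r\<in>carrier R - {\<zero>}. true_in M (witness_bound s r n k \<phi>)"
proof -
  obtain r where r: "r \<in> carrier R - {\<zero>}" "\<forall>v\<in>assignments M. \<forall>x\<in>carrier M.
    (\<forall>j. s \<odot>\<^bsub>M\<^esub> v j = \<zero>\<^bsub>M\<^esub>) \<longrightarrow> sat M (v(k := x)) \<phi> \<longrightarrow>
    (\<exists>y\<in>carrier M. r \<odot>\<^bsub>M\<^esub> y = \<zero>\<^bsub>M\<^esub> \<and> sat M (v(k := y)) \<phi>)"
    using torsion_witness[OF assms(1-3), of k] by blast
  have "\<exists>y\<in>carrier M. r \<odot>\<^bsub>M\<^esub> y = \<zero>\<^bsub>M\<^esub> \<and> sat M (v(k := y)) \<phi>"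
    if v: "v \<in> assignments M" "\<forall>j<n. s \<odot>\<^bsub>M\<^esub> v j = \<zero>\<^bsub>M\<^esub>" "sat M v (Exi k \<phi>)" for v
  proof -
    \<comment> \<open>\<open>torsion_witness\<close> wants every coordinate annihilated, so those
      from \<open>n\<close> on are set to zero. None of them is free in \<phi> except possibly
      \<open>k\<close>, which is overwritten.\<close>
    define w where "w j = (if j < n then v j else \<zero>\<^bsub>M\<^esub>)" for j
    have w: "w \<in> assignments M" "\<forall>j. s \<odot>\<^bsub>M\<^esub> w j = \<zero>\<^bsub>M\<^esub>"
      using v assms(3) by (auto simp: w_def)
    have eq: "sat M (v(k := a)) \<phi> \<longleftrightarrow> sat M (w(k := a)) \<phi>" for a
      using assms(4) by (intro sat_cong) (auto simp: w_def)
    obtain x where "x \<in> carrier M" "sat M (v(k := x)) \<phi>"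
      using v(3) by auto
    then show ?thesis
      using r(2) w eq by blast
  qed
  then show ?thesis
    unfolding true_in_witness_bound using r(1) by blast
qed

section \<open>The downward Loewenheim-Skolem theorem\<close>

text \<open>Codes for the assignments with values in the Skolem hull of the empty set.\<close>

datatype 'r skolem =
    Base
  | Witness "'r LR_form" nat "'r skolem"
  | Update "'r skolem" nat "'r skolem" nat

text \<open>A code denotes a whole assignment, so a Skolem function takes its parameters from one
  code, whatever their number; \<open>Update\<close> assembles elements of the hull into such an
  assignment. Zero is the default where no witness exists.\<close>

primrec skolem_val :: "('r, 'a) LR_struct \<Rightarrow> 'r skolem \<Rightarrow> nat \<Rightarrow> 'a" where
  "skolem_val M Base = (\<lambda>_. \<zero>\<^bsub>M\<^esub>)"
| "skolem_val M (Witness \<phi> k a) = (skolem_val M a)(k :=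
     if \<exists>x\<in>carrier M. sat M ((skolem_val M a)(k := x)) \<phi>
     then SOME x. x \<in> carrier M \<and> sat M ((skolem_val M a)(k := x)) \<phi>
     else \<zero>\<^bsub>M\<^esub>)"
| "skolem_val M (Update a j b k) = (skolem_val M a)(j := skolem_val M b k)"

definition skolem_hull :: "('r, 'a) LR_struct \<Rightarrow> 'a set" where
  "skolem_hull M = (\<Union>a. range (skolem_val M a))"

lemma skolem_val_in_hull: "skolem_val M a k \<in> skolem_hull M"
  unfolding skolem_hull_def by blast

lemma skolem_witness:
  assumes "\<exists>x\<in>carrier M. sat M ((skolem_val M a)(k := x)) \<phi>"
  shows "skolem_val M (Witness \<phi> k a) k \<in> carrier M \<and>
    sat M ((skolem_val M a)(k := skolem_val M (Witness \<phi> k a) k)) \<phi>"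
proof -
  have "\<exists>x. x \<in> carrier M \<and> sat M ((skolem_val M a)(k := x)) \<phi>"
    using assms by blast
  from someI_ex[OF this] show ?thesis
    using assms by simp
qed

lemma skolem_val_in_carrier:
  assumes "\<zero>\<^bsub>M\<^esub> \<in> carrier M"
  shows "skolem_val M a j \<in> carrier M"
proof (induction a arbitrary: j)
  case (Witness \<phi> k a)
  show ?case
  proof (cases "\<exists>x\<in>carrier M. sat M ((skolem_val M a)(k := x)) \<phi>")
    case True
    then show ?thesis
      using skolem_witness[OF True] Witness by (cases "j = k") auto
  next
    case False
    then show ?thesis
      using Witness assms by auto
  qed
qed (auto simp: assms)

lemma skolem_hull_subset:
  assumes "\<zero>\<^bsub>M\<^esub> \<in> carrier M"
  shows "skolem_hull M \<subseteq> carrier M"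
  using skolem_val_in_carrier[OF assms] by (auto simp: skolem_hull_def)

lemma skolem_code:
  assumes "finite J" "\<forall>j\<in>J. v j \<in> skolem_hull M"
  shows "\<exists>a. \<forall>j\<in>J. skolem_val M a j = v j"
  using assms
proof induction
  case (insert i J)
  obtain a where a: "\<forall>j\<in>J. skolem_val M a j = v j"
    using insert by auto
  obtain b k where "v i = skolem_val M b k"
    using insert.prems by (auto simp: skolem_hull_def)
  then show ?case
    using a insert.hyps by (intro exI[of _ "Update a i b k"]) auto
qed simp

text \<open>This is the Tarski-Vaught test for the hull. A formula sees finitely many values of
  \<open>v\<close>, and by \<open>skolem_code\<close> one code supplies them together.\<close>

lemma skolem_hull_witness:
  assumes "\<forall>j. v j \<in> skolem_hull M" "sat M v (Exi k \<phi>)"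
  shows "\<exists>x\<in>skolem_hull M. x \<in> carrier M \<and> sat M (v(k := x)) \<phi>"
proof -
  obtain a where a: "\<forall>j\<in>free_vars \<phi>. skolem_val M a j = v j"
    using skolem_code[OF finite_free_vars[of \<phi>], of v M] assms(1) by blast
  have eq: "sat M ((skolem_val M a)(k := x)) \<phi> \<longleftrightarrow> sat M (v(k := x)) \<phi>" for x
    using a by (intro sat_cong) auto
  then have "\<exists>x\<in>carrier M. sat M ((skolem_val M a)(k := x)) \<phi>"
    using assms(2) by simp
  from skolem_witness[OF this] show ?thesis
    unfolding eq using skolem_val_in_hull[of M "Witness \<phi> k a" k] by blast
qed

text \<open>The value of a term is the only witness for the equation of a fresh variable with it, so
  closure under the operations is a case of the witness property and takes no constructor of its own
  among the codes.\<close>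

lemma skolem_hull_term:
  assumes "\<forall>j. v j \<in> skolem_hull M" "k \<notin> term_vars t" "term_val M v t \<in> carrier M"
  shows "term_val M v t \<in> skolem_hull M"
proof -
  have eq: "term_val M (v(k := x)) t = term_val M v t" for x
    using assms(2) by (intro term_val_cong) auto
  have "sat M v (Exi k (Eq (Var k) t))"
    using assms(3) by (auto simp: eq)
  from skolem_hull_witness[OF assms(1) this] show ?thesis
    by (auto simp: eq)
qed

lemma skolem_hull_closed:
  assumes "LR_structure R M"
  shows "\<zero>\<^bsub>M\<^esub> \<in> skolem_hull M"
    and "a \<in> skolem_hull M \<Longrightarrow> b \<in> skolem_hull M \<Longrightarrow> a \<oplus>\<^bsub>M\<^esub> b \<in> skolem_hull M"
    and "a \<in> skolem_hull M \<Longrightarrow> uneg M a \<in> skolem_hull M"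
    and "r \<in> carrier R \<Longrightarrow> a \<in> skolem_hull M \<Longrightarrow> r \<odot>\<^bsub>M\<^esub> a \<in> skolem_hull M"
proof -
  have z: "\<zero>\<^bsub>M\<^esub> \<in> carrier M"
    using assms by (simp add: LR_structure_def)
  note sub = subsetD[OF skolem_hull_subset[OF z]]
  show "\<zero>\<^bsub>M\<^esub> \<in> skolem_hull M"
    using skolem_val_in_hull[of M Base 0] by simp
  show "a \<oplus>\<^bsub>M\<^esub> b \<in> skolem_hull M" if "a \<in> skolem_hull M" "b \<in> skolem_hull M"
    using skolem_hull_term[of "\<lambda>j. if j = 0 then a else b" M 2 "Plus (Var 0) (Var 1)"] that sub assms
    by (auto simp: LR_structure_def)
  show "uneg M a \<in> skolem_hull M" if "a \<in> skolem_hull M"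
    using skolem_hull_term[of "\<lambda>j. a" M 2 "Uminus (Var 0)"] that sub assms
    by (auto simp: LR_structure_def)
  show "r \<odot>\<^bsub>M\<^esub> a \<in> skolem_hull M" if "r \<in> carrier R" "a \<in> skolem_hull M"
    using skolem_hull_term[of "\<lambda>j. a" M 2 "Scal r (Var 0)"] that sub assms
    by (auto simp: LR_structure_def)
qed

text \<open>Syntax trees are coded by an injective pairing \<open>p\<close>, with numerals as
  constructor tags; such a pairing exists because \<open>'r + nat\<close> is infinite. The target is
  the type that \<open>satisfiable\<close> and \<open>entails\<close> quantify over.\<close>

primrec term_code :: "(('r + nat) \<times> ('r + nat) \<Rightarrow> 'r + nat) \<Rightarrow> 'r LR_term \<Rightarrow> 'r + nat" where
  "term_code p (Var k) = p (Inr 0, Inr k)"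
| "term_code p Zero = p (Inr 1, Inr 0)"
| "term_code p (Plus s t) = p (Inr 2, p (term_code p s, term_code p t))"
| "term_code p (Uminus t) = p (Inr 3, term_code p t)"
| "term_code p (Scal r t) = p (Inr 4, p (Inl r, term_code p t))"

primrec form_code :: "(('r + nat) \<times> ('r + nat) \<Rightarrow> 'r + nat) \<Rightarrow> 'r LR_form \<Rightarrow> 'r + nat" where
  "form_code p (Eq s t) = p (Inr 0, p (term_code p s, term_code p t))"
| "form_code p (Neg \<phi>) = p (Inr 1, form_code p \<phi>)"
| "form_code p (Conj \<phi> \<psi>) = p (Inr 2, p (form_code p \<phi>, form_code p \<psi>))"
| "form_code p (Exi k \<phi>) = p (Inr 3, p (Inr k, form_code p \<phi>))"

primrec skolem_number :: "(('r + nat) \<times> ('r + nat) \<Rightarrow> 'r + nat) \<Rightarrow> 'r skolem \<Rightarrow> 'r + nat" where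
  "skolem_number p Base = p (Inr 0, Inr 0)"
| "skolem_number p (Witness \<phi> k a) = p (Inr 1, p (form_code p \<phi>, p (Inr k, skolem_number p a)))"
| "skolem_number p (Update a j b k) =
     p (Inr 2, p (p (Inr j, Inr k), p (skolem_number p a, skolem_number p b)))"

lemma inj_term_code:
  assumes "inj p"
  shows "inj (term_code p)"
proof -
  have "term_code p s = term_code p t \<longrightarrow> s = t" for s t
    by (induction s arbitrary: t; case_tac t) (auto simp: inj_eq[OF assms])
  then show ?thesis
    by (auto intro: injI)
qed

lemma inj_form_code:
  assumes "inj p"
  shows "inj (form_code p)"
proof -
  have "form_code p \<phi> = form_code p \<psi> \<longrightarrow> \<phi> = \<psi>" for \<phi> \<psi>
    by (induction \<phi> arbitrary: \<psi>; case_tac \<psi>)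
      (auto simp: inj_eq[OF assms] inj_eq[OF inj_term_code[OF assms]])
  then show ?thesis
    by (auto intro: injI)
qed

lemma inj_skolem_number:
  assumes "inj p"
  shows "inj (skolem_number p)"
proof -
  have "skolem_number p a = skolem_number p b \<longrightarrow> a = b" for a b
    by (induction a arbitrary: b; case_tac b)
      (auto simp: inj_eq[OF assms] inj_eq[OF inj_form_code[OF assms]])
  then show ?thesis
    by (auto intro: injI)
qed

lemma skolem_hull_embeds:
  fixes M :: "('r, 'a) LR_struct"
  shows "\<exists>g :: 'a \<Rightarrow> 'r + nat. inj_on g (skolem_hull M)"
proof -
  have "infinite (UNIV :: ('r + nat) set)"
    by (simp add: finite_Plus_UNIV_iff)
  then obtain p :: "('r + nat) \<times> ('r + nat) \<Rightarrow> 'r + nat" where "bij_betw p (UNIV \<times> UNIV) UNIV"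
    using card_of_Times_same_infinite card_of_ordIso by blast
  then have p: "inj p"
    by (simp add: bij_betw_def)
  have "\<forall>x\<in>skolem_hull M. \<exists>c. x = skolem_val M (fst c) (snd c)"
    by (auto simp: skolem_hull_def)
  then obtain c where c: "\<forall>x\<in>skolem_hull M. x = skolem_val M (fst (c x)) (snd (c x))"
    by (rule bchoice[THEN exE])
  define g where "g x = p (skolem_number p (fst (c x)), Inr (snd (c x)))" for x
  have "x = y" if "x \<in> skolem_hull M" "y \<in> skolem_hull M" "g x = g y" for x y
  proof -
    have "fst (c x) = fst (c y)" "snd (c x) = snd (c y)"
      using that(3) by (auto simp: g_def inj_eq[OF p] inj_eq[OF inj_skolem_number[OF p]])
    then show ?thesis
      using c that(1,2) by metis
  qed
  then show ?thesis
    by (auto intro: inj_onI)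
qed

section \<open>Transfer to the type of structures behind completeness\<close>

lemma true_in_sentence:
  assumes "LR_sentence R \<sigma>" "v \<in> assignments M"
  shows "true_in M \<sigma> \<longleftrightarrow> sat M v \<sigma>"
  using sat_cong[of \<sigma> _ v M] assms by (auto simp: true_in_def LR_sentence_def)

text \<open>By the Tarski-Vaught test the hull is an elementary substructure, and its operations are
  transported along an injection into \<open>'r + nat\<close>. The comparison is confined to scalars
  from \<open>carrier R\<close>, under which the hull is closed.\<close>

lemma lowenheim_skolem:
  fixes M :: "('r, 'a) LR_struct"
  assumes M: "LR_structure R M"
  shows "\<exists>N :: ('r, 'r + nat) LR_struct. LR_structure R N \<and>
    (\<forall>\<sigma>. LR_sentence R \<sigma> \<longrightarrow> (true_in N \<sigma> \<longleftrightarrow> true_in M \<sigma>))"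
proof -
  let ?S = "skolem_hull M"
  have z: "\<zero>\<^bsub>M\<^esub> \<in> carrier M"
    using M by (simp add: LR_structure_def)
  note sub = subsetD[OF skolem_hull_subset[OF z]]
  note closed = skolem_hull_closed[OF M]
  obtain g :: "'a \<Rightarrow> 'r + nat" where g: "inj_on g ?S"
    using skolem_hull_embeds by blast
  define h where "h = the_inv_into ?S g"
  have h [simp]: "h (g x) = x" if "x \<in> ?S" for x
    unfolding h_def using the_inv_into_f_f[OF g that] .
  define N :: "('r, 'r + nat) LR_struct" where
    "N = \<lparr>carrier = g ` ?S, mult = undefined, one = undefined, zero = g \<zero>\<^bsub>M\<^esub>,
      add = (\<lambda>x y. g (h x \<oplus>\<^bsub>M\<^esub> h y)), smult = (\<lambda>r x. g (r \<odot>\<^bsub>M\<^esub> h x)),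
      uneg = (\<lambda>x. g (uneg M (h x)))\<rparr>"
  have N: "LR_structure R N"
    using closed by (auto simp: N_def LR_structure_def)
  have tv: "term_val M v t \<in> ?S \<and> term_val N (\<lambda>j. g (v j)) t = g (term_val M v t)"
    if "\<forall>j. v j \<in> ?S" "set_LR_term t \<subseteq> carrier R" for v t
    using that(2) by (induction t) (use that(1) closed in \<open>auto simp: N_def\<close>)
  have sat: "sat N (\<lambda>j. g (v j)) \<phi> \<longleftrightarrow> sat M v \<phi>"
    if "\<forall>j. v j \<in> ?S" "LR_formula R \<phi>" for v \<phi>
    using that
  proof (induction \<phi> arbitrary: v)
    case (Eq s t)
    then have "set_LR_term s \<subseteq> carrier R" "set_LR_term t \<subseteq> carrier R"
      by (auto simp: LR_formula_def)
    from tv[OF Eq.prems(1) this(1)] tv[OF Eq.prems(1) this(2)] show ?case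
      using inj_onD[OF g] by auto
  next
    case (Exi k \<phi>)
    have IH: "sat N ((\<lambda>j. g (v j))(k := g x)) \<phi> \<longleftrightarrow> sat M (v(k := x)) \<phi>" if "x \<in> ?S" for x
    proof -
      have e: "(\<lambda>j. g (v j))(k := g x) = (\<lambda>j. g ((v(k := x)) j))"
        by auto
      show ?thesis
        unfolding e by (rule Exi.IH) (use Exi.prems that in \<open>auto simp: LR_formula_def\<close>)
    qed
    have "sat N (\<lambda>j. g (v j)) (Exi k \<phi>) \<longleftrightarrow> (\<exists>x\<in>?S. sat M (v(k := x)) \<phi>)"
      using IH by (simp add: N_def)
    also have "\<dots> \<longleftrightarrow> sat M v (Exi k \<phi>)"
      using skolem_hull_witness[OF Exi.prems(1), of k \<phi>] sub by auto
    finally show ?case .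
  qed (auto simp: LR_formula_def)
  have "true_in N \<sigma> \<longleftrightarrow> true_in M \<sigma>" if \<sigma>: "LR_sentence R \<sigma>" for \<sigma>
  proof -
    have "sat N (\<lambda>j. g \<zero>\<^bsub>M\<^esub>) \<sigma> \<longleftrightarrow> sat M (\<lambda>j. \<zero>\<^bsub>M\<^esub>) \<sigma>"
      using sat[of "\<lambda>j. \<zero>\<^bsub>M\<^esub>" \<sigma>] closed(1) \<sigma> by (simp add: LR_sentence_def)
    moreover have "true_in N \<sigma> \<longleftrightarrow> sat N (\<lambda>j. g \<zero>\<^bsub>M\<^esub>) \<sigma>"
      using closed(1) by (intro true_in_sentence[OF \<sigma>]) (auto simp: N_def)
    moreover have "true_in M \<sigma> \<longleftrightarrow> sat M (\<lambda>j. \<zero>\<^bsub>M\<^esub>) \<sigma>"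
      using z by (intro true_in_sentence[OF \<sigma>]) auto
    ultimately show ?thesis
      by blast
  qed
  then show ?thesis
    using N by blast
qed

text \<open>\<open>entails\<close> speaks about structures on one fixed type, so the model
  \<open>M\<close> is first replaced by an elementarily equivalent one on that type. The right-hand
  side does not mention \<open>M\<close>; hence any two models agree on the sentence, even if they
  live on different types.\<close>

lemma true_in_complete_theory:
  assumes "complete_theory R T" "is_model R M T" "LR_sentence R \<sigma>"
  shows "true_in M \<sigma> \<longleftrightarrow> entails R T \<sigma>"
proof -
  obtain N :: "('a, 'a + nat) LR_struct" where N: "LR_structure R N"
    "\<And>\<tau>. LR_sentence R \<tau> \<Longrightarrow> true_in N \<tau> \<longleftrightarrow> true_in M \<tau>"
    using lowenheim_skolem[of R M] assms(2) unfolding is_model_def by blast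
  have model: "is_model R N T"
    using N assms(1,2) by (auto simp: is_model_def complete_theory_def LR_theory_def)
  show ?thesis
  proof
    assume "true_in M \<sigma>"
    then have "true_in N \<sigma>"
      using N(2) assms(3) by blast
    \<comment> \<open>Truth refers to all assignments, so refuting the negation takes an actual
      assignment; the zero of \<open>N\<close> provides one.\<close>
    then have "\<not> true_in N (Neg \<sigma>)"
      using N(1) by (auto simp: true_in_def LR_structure_def)
    then have "\<not> entails R T (Neg \<sigma>)"
      using model by (auto simp: entails_def)
    then show "entails R T \<sigma>"
      using assms(1,3) by (auto simp: complete_theory_def)
  next
    assume "entails R T \<sigma>"
    then show "true_in M \<sigma>"
      using model N(2) assms(3) by (auto simp: entails_def)
  qed
qed

section \<open>Ultraproducts\<close>

lemma (in "domain") regular_iff: "regular R r \<longleftrightarrow> r \<in> carrier R - {\<zero>}"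
proof
  assume *: "regular R r"
  then have "\<one> = \<zero>" if "r = \<zero>"
    using that l_null[OF one_closed] r_null[OF one_closed] one_closed unfolding regular_def by metis
  then have "r \<noteq> \<zero>"
    using one_not_zero by blast
  then show "r \<in> carrier R - {\<zero>}"
    using * unfolding regular_def by blast
qed (auto simp: regular_def dest: integral)

locale module_family = "domain" R
  for R :: "('r, 'x) ring_scheme" (structure) +
  fixes I :: "'i set" and U :: "'i set set" and M :: "'i \<Rightarrow> ('r, 'm) LR_struct"
  assumes modules: "i \<in> I \<Longrightarrow> R_module R (M i)"
    and ultrafilter: "ultrafilter_on I U"
begin

abbreviation cls :: "('i \<Rightarrow> 'm) \<Rightarrow> ('i \<Rightarrow> 'm) set" where
  "cls \<equiv> ultra_class I U M"

abbreviation choice_functions :: "('i \<Rightarrow> 'm) set" where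
  "choice_functions \<equiv> prod_carrier I M"

abbreviation UP :: "('r, ('i \<Rightarrow> 'm) set) LR_struct" where
  "UP \<equiv> ultraproduct I U M"

abbreviation TUP :: "('r, ('i \<Rightarrow> 'm) set) LR_struct" where
  "TUP \<equiv> torsion_ultraproduct R I U M"

section \<open>Calculus with sets in the ultrafilter\<close>

lemma ultra_Int: "X \<in> U \<Longrightarrow> Y \<in> U \<Longrightarrow> X \<inter> Y \<in> U"
  using ultrafilter by (auto simp: ultrafilter_on_def)

lemma ultra_superset: "X \<in> U \<Longrightarrow> X \<subseteq> Y \<Longrightarrow> Y \<subseteq> I \<Longrightarrow> Y \<in> U"
  using ultrafilter unfolding ultrafilter_on_def by blast

lemma ultra_subset: "X \<in> U \<Longrightarrow> X \<subseteq> I"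
  using ultrafilter unfolding ultrafilter_on_def by blast

lemma ultra_whole: "I \<in> U"
  using ultrafilter by (simp add: ultrafilter_on_def)

lemma ultra_nonempty: "X \<in> U \<Longrightarrow> X \<noteq> {}"
  using ultrafilter by (auto simp: ultrafilter_on_def)

lemma ultra_Collect_mono:
  assumes "{i \<in> I. P i} \<in> U" "\<And>i. i \<in> I \<Longrightarrow> P i \<Longrightarrow> Q i"
  shows "{i \<in> I. Q i} \<in> U"
  using assms by (intro ultra_superset[OF assms(1)]) auto

lemma ultra_Collect_conj:
  "{i \<in> I. P i \<and> Q i} \<in> U \<longleftrightarrow> {i \<in> I. P i} \<in> U \<and> {i \<in> I. Q i} \<in> U"
proof
  assume *: "{i \<in> I. P i \<and> Q i} \<in> U"
  show "{i \<in> I. P i} \<in> U \<and> {i \<in> I. Q i} \<in> U"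
    by (intro conjI ultra_Collect_mono[OF *]) simp_all
next
  assume "{i \<in> I. P i} \<in> U \<and> {i \<in> I. Q i} \<in> U"
  then have "{i \<in> I. P i} \<inter> {i \<in> I. Q i} \<in> U"
    by (intro ultra_Int) simp_all
  moreover have "{i \<in> I. P i} \<inter> {i \<in> I. Q i} = {i \<in> I. P i \<and> Q i}"
    by auto
  ultimately show "{i \<in> I. P i \<and> Q i} \<in> U"
    by simp
qed

lemma ultra_Collect_not: "{i \<in> I. \<not> P i} \<in> U \<longleftrightarrow> {i \<in> I. P i} \<notin> U"
proof
  assume "{i \<in> I. \<not> P i} \<in> U"
  moreover have "{i \<in> I. P i} \<inter> {i \<in> I. \<not> P i} = {}" "{} \<notin> U"
    using ultrafilter by (auto simp: ultrafilter_on_def)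
  ultimately show "{i \<in> I. P i} \<notin> U"
    using ultra_Int[of "{i \<in> I. P i}" "{i \<in> I. \<not> P i}"] by auto
next
  assume "{i \<in> I. P i} \<notin> U"
  moreover have "X \<in> U \<or> I - X \<in> U" if "X \<subseteq> I" for X
    using ultrafilter that by (simp add: ultrafilter_on_def)
  from this[of "{i \<in> I. P i}"] have "{i \<in> I. P i} \<in> U \<or> I - {i \<in> I. P i} \<in> U"
    by simp
  moreover have "I - {i \<in> I. P i} = {i \<in> I. \<not> P i}"
    by auto
  ultimately show "{i \<in> I. \<not> P i} \<in> U"
    by simp
qed

lemma ultra_Collect_ball:
  assumes "finite J" "\<And>j. j \<in> J \<Longrightarrow> {i \<in> I. P j i} \<in> U"
  shows "{i \<in> I. \<forall>j\<in>J. P j i} \<in> U"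
  using assms by induction (auto simp: ultra_whole ultra_Collect_conj)

lemma module_in_family: "i \<in> I \<Longrightarrow> module R (M i)"
  and uneg_in_family: "i \<in> I \<Longrightarrow> a \<in> carrier (M i) \<Longrightarrow> uneg (M i) a = \<ominus>\<^bsub>M i\<^esub> a"
  using modules by (auto simp: R_module_def)

lemma choice_functionsD: "f \<in> choice_functions \<Longrightarrow> i \<in> I \<Longrightarrow> f i \<in> carrier (M i)"
  by (auto simp: prod_carrier_def)

section \<open>Classes of choice functions and the operations on them\<close>

lemma equiv_ultra_rel: "equiv choice_functions (ultra_rel I U M)"
proof (rule equivI)
  show "ultra_rel I U M \<subseteq> choice_functions \<times> choice_functions"
    by (auto simp: ultra_rel_def)
  show "refl_on choice_functions (ultra_rel I U M)"
    using ultra_whole by (auto simp: ultra_rel_def refl_on_def)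
  show "sym (ultra_rel I U M)"
    by (auto simp: ultra_rel_def sym_def eq_commute)
  show "trans (ultra_rel I U M)"
  proof (rule transI)
    fix f g h assume *: "(f, g) \<in> ultra_rel I U M" "(g, h) \<in> ultra_rel I U M"
    then have "{i \<in> I. f i = g i \<and> g i = h i} \<in> U"
      unfolding ultra_Collect_conj by (simp add: ultra_rel_def)
    then have "{i \<in> I. f i = h i} \<in> U"
      by (rule ultra_Collect_mono) simp
    then show "(f, h) \<in> ultra_rel I U M"
      using * by (simp add: ultra_rel_def)
  qed
qed

lemma cls_eq_iff:
  assumes "f \<in> choice_functions" "g \<in> choice_functions"
  shows "cls f = cls g \<longleftrightarrow> {i \<in> I. f i = g i} \<in> U"
  using eq_equiv_class_iff[OF equiv_ultra_rel assms] assms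
  by (simp add: ultra_class_def ultra_rel_def)

lemma mem_cls: "g \<in> cls f \<longleftrightarrow> f \<in> choice_functions \<and> g \<in> choice_functions \<and> {i \<in> I. f i = g i} \<in> U"
  by (simp add: ultra_class_def ultra_rel_def)

lemma carrier_UP: "carrier UP = cls ` choice_functions"
  by (auto simp: ultraproduct_def quotient_def ultra_class_def)

lemma fun_zero: "(\<lambda>i\<in>I. \<zero>\<^bsub>M i\<^esub>) \<in> choice_functions"
  using abelian_monoid.zero_closed[OF abelian_group.axioms(1)[OF module.axioms(2)[OF module_in_family]]]
  by (auto simp: prod_carrier_def)

lemma fun_add: "f \<in> choice_functions \<Longrightarrow> g \<in> choice_functions \<Longrightarrow> (\<lambda>i\<in>I. f i \<oplus>\<^bsub>M i\<^esub> g i) \<in> choice_functions"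
  using abelian_monoid.a_closed[OF abelian_group.axioms(1)[OF module.axioms(2)[OF module_in_family]]]
  by (auto simp: prod_carrier_def PiE_iff)

lemma fun_smult: "r \<in> carrier R \<Longrightarrow> f \<in> choice_functions \<Longrightarrow> (\<lambda>i\<in>I. r \<odot>\<^bsub>M i\<^esub> f i) \<in> choice_functions"
  using module.smult_closed[OF module_in_family] by (auto simp: prod_carrier_def)

lemma fun_uneg: "f \<in> choice_functions \<Longrightarrow> (\<lambda>i\<in>I. uneg (M i) (f i)) \<in> choice_functions"
  using abelian_group.a_inv_closed[OF module.axioms(2)[OF module_in_family]] uneg_in_family
  by (auto simp: prod_carrier_def PiE_iff)

lemma UP_zero: "\<zero>\<^bsub>UP\<^esub> = cls (\<lambda>i\<in>I. \<zero>\<^bsub>M i\<^esub>)"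
  by (simp add: ultraproduct_def)

lemma UP_add:
  assumes "f \<in> choice_functions" "g \<in> choice_functions"
  shows "cls f \<oplus>\<^bsub>UP\<^esub> cls g = cls (\<lambda>i\<in>I. f i \<oplus>\<^bsub>M i\<^esub> g i)"
proof -
  have eq: "cls (\<lambda>i\<in>I. f' i \<oplus>\<^bsub>M i\<^esub> g' i) = cls (\<lambda>i\<in>I. f i \<oplus>\<^bsub>M i\<^esub> g i)" if "f' \<in> cls f" "g' \<in> cls g" for f' g'
  proof -
    have "{i \<in> I. f i = f' i \<and> g i = g' i} \<in> U"
      using that by (simp add: mem_cls ultra_Collect_conj)
    then have "{i \<in> I. (\<lambda>i\<in>I. f' i \<oplus>\<^bsub>M i\<^esub> g' i) i = (\<lambda>i\<in>I. f i \<oplus>\<^bsub>M i\<^esub> g i) i} \<in> U"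
      by (rule ultra_Collect_mono) simp
    then show ?thesis
      using that assms by (intro cls_eq_iff[THEN iffD2] fun_add) (auto simp: mem_cls)
  qed
  have mem: "f \<in> cls f" "g \<in> cls g"
    using assms ultra_whole by (auto simp: mem_cls)
  have "cls f \<oplus>\<^bsub>UP\<^esub> cls g = (\<Union>f'\<in>cls f. \<Union>g'\<in>cls g. cls (\<lambda>i\<in>I. f' i \<oplus>\<^bsub>M i\<^esub> g' i))"
    by (simp add: ultraproduct_def)
  also have "\<dots> = cls (\<lambda>i\<in>I. f i \<oplus>\<^bsub>M i\<^esub> g i)"
    by (intro UN_constant_eq[OF mem(1)] UN_constant_eq[OF mem(2)] ballI eq)
  finally show ?thesis .
qed

lemma UP_smult:
  assumes "f \<in> choice_functions" "r \<in> carrier R"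
  shows "r \<odot>\<^bsub>UP\<^esub> cls f = cls (\<lambda>i\<in>I. r \<odot>\<^bsub>M i\<^esub> f i)"
proof -
  have eq: "cls (\<lambda>i\<in>I. r \<odot>\<^bsub>M i\<^esub> f' i) = cls (\<lambda>i\<in>I. r \<odot>\<^bsub>M i\<^esub> f i)" if "f' \<in> cls f" for f'
  proof -
    have "{i \<in> I. f i = f' i} \<in> U"
      using that by (simp add: mem_cls)
    then have "{i \<in> I. (\<lambda>i\<in>I. r \<odot>\<^bsub>M i\<^esub> f' i) i = (\<lambda>i\<in>I. r \<odot>\<^bsub>M i\<^esub> f i) i} \<in> U"
      by (rule ultra_Collect_mono) simp
    then show ?thesis
      using that assms by (intro cls_eq_iff[THEN iffD2] fun_smult) (auto simp: mem_cls)
  qed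
  have mem: "f \<in> cls f"
    using assms ultra_whole by (auto simp: mem_cls)
  have "r \<odot>\<^bsub>UP\<^esub> cls f = (\<Union>f'\<in>cls f. cls (\<lambda>i\<in>I. r \<odot>\<^bsub>M i\<^esub> f' i))"
    by (simp add: ultraproduct_def)
  also have "\<dots> = cls (\<lambda>i\<in>I. r \<odot>\<^bsub>M i\<^esub> f i)"
    by (intro UN_constant_eq[OF mem] ballI eq)
  finally show ?thesis .
qed

lemma UP_uneg:
  assumes "f \<in> choice_functions"
  shows "uneg UP (cls f) = cls (\<lambda>i\<in>I. uneg (M i) (f i))"
proof -
  have eq: "cls (\<lambda>i\<in>I. uneg (M i) (f' i)) = cls (\<lambda>i\<in>I. uneg (M i) (f i))" if "f' \<in> cls f" for f'
  proof -
    have "{i \<in> I. f i = f' i} \<in> U"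
      using that by (simp add: mem_cls)
    then have "{i \<in> I. (\<lambda>i\<in>I. uneg (M i) (f' i)) i = (\<lambda>i\<in>I. uneg (M i) (f i)) i} \<in> U"
      by (rule ultra_Collect_mono) simp
    then show ?thesis
      using that assms by (intro cls_eq_iff[THEN iffD2] fun_uneg) (auto simp: mem_cls)
  qed
  have mem: "f \<in> cls f"
    using assms ultra_whole by (auto simp: mem_cls)
  have "uneg UP (cls f) = (\<Union>f'\<in>cls f. cls (\<lambda>i\<in>I. uneg (M i) (f' i)))"
    by (simp add: ultraproduct_def)
  also have "\<dots> = cls (\<lambda>i\<in>I. uneg (M i) (f i))"
    by (intro UN_constant_eq[OF mem] ballI eq)
  finally show ?thesis .
qed

lemma UP_structure: "LR_structure R UP"
  unfolding LR_structure_def carrier_UP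
  by (auto simp: UP_zero UP_add UP_smult UP_uneg fun_zero fun_add fun_smult fun_uneg)

section \<open>Torsion functions, their classes and their closure properties\<close>

definition torsion_functions :: "('i \<Rightarrow> 'm) set" where
  "torsion_functions = {f \<in> choice_functions. \<exists>r\<in>carrier R - {\<zero>}. {i \<in> I. r \<odot>\<^bsub>M i\<^esub> f i = \<zero>\<^bsub>M i\<^esub>} \<in> U}"

lemma torsion_functionsI:
  assumes "f \<in> choice_functions" "r \<in> carrier R - {\<zero>}" "{i \<in> I. r \<odot>\<^bsub>M i\<^esub> f i = \<zero>\<^bsub>M i\<^esub>} \<in> U"
  shows "f \<in> torsion_functions"
  unfolding torsion_functions_def using assms by blast

lemma torsion_functions_subset: "f \<in> torsion_functions \<Longrightarrow> f \<in> choice_functions"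
  by (simp add: torsion_functions_def)

lemma torsion_functions_iff:
  assumes "f \<in> choice_functions"
  shows "f \<in> torsion_functions \<longleftrightarrow> (\<exists>X\<in>U. \<exists>r\<in>carrier R. \<forall>i\<in>X. r \<in> tor_ann R (M i) (f i))"
proof
  assume "f \<in> torsion_functions"
  then obtain r where r: "r \<in> carrier R - {\<zero>}" "{i \<in> I. r \<odot>\<^bsub>M i\<^esub> f i = \<zero>\<^bsub>M i\<^esub>} \<in> U"
    by (auto simp: torsion_functions_def)
  then show "\<exists>X\<in>U. \<exists>r\<in>carrier R. \<forall>i\<in>X. r \<in> tor_ann R (M i) (f i)"
    by (intro bexI[OF _ r(2)] bexI[of _ r]) (auto simp: tor_ann_def regular_iff)
next
  assume "\<exists>X\<in>U. \<exists>r\<in>carrier R. \<forall>i\<in>X. r \<in> tor_ann R (M i) (f i)"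
  then obtain X r where X: "X \<in> U" "r \<in> carrier R" "\<forall>i\<in>X. r \<in> tor_ann R (M i) (f i)"
    by blast
  \<comment> \<open>Regularity of \<open>r\<close> is asserted only at the indices in
    \<open>X\<close>, so one such index is needed.\<close>
  then obtain i where "i \<in> X"
    using ultra_nonempty by blast
  then have "r \<in> carrier R - {\<zero>}"
    using X(3) by (auto simp: tor_ann_def regular_iff)
  moreover have "{i \<in> I. r \<odot>\<^bsub>M i\<^esub> f i = \<zero>\<^bsub>M i\<^esub>} \<in> U"
    using X(3) ultra_subset[OF X(1)] by (intro ultra_superset[OF X(1)]) (auto simp: tor_ann_def)
  ultimately show "f \<in> torsion_functions"
    using assms by (auto simp: torsion_functions_def)
qed

lemma carrier_TUP: "carrier TUP = cls ` torsion_functions"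
proof -
  have "carrier TUP = {cls f | f. f \<in> choice_functions \<and>
    (\<exists>X\<in>U. \<exists>r\<in>carrier R. \<forall>i\<in>X. r \<in> tor_ann R (M i) (f i))}"
    by (simp add: torsion_ultraproduct_def)
  moreover have "f \<in> choice_functions \<and> (\<exists>X\<in>U. \<exists>r\<in>carrier R. \<forall>i\<in>X. r \<in> tor_ann R (M i) (f i)) \<longleftrightarrow>
    f \<in> torsion_functions" for f
    using torsion_functions_iff[of f] torsion_functions_subset[of f] by blast
  ultimately show ?thesis
    by (simp only: Setcompr_eq_image Collect_mem_eq)
qed

text \<open>The definition of the carrier provides only some torsion representative of the class.
  Annihilation on a set of \<open>U\<close> passes to any other representative, because the two
  agree on a set of \<open>U\<close>.\<close>

lemma cls_in_TUP:
  assumes "f \<in> choice_functions"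
  shows "cls f \<in> carrier TUP \<longleftrightarrow> f \<in> torsion_functions"
proof
  assume "cls f \<in> carrier TUP"
  then obtain g r where g: "g \<in> choice_functions" "cls f = cls g" "r \<in> carrier R - {\<zero>}"
    "{i \<in> I. r \<odot>\<^bsub>M i\<^esub> g i = \<zero>\<^bsub>M i\<^esub>} \<in> U"
    unfolding carrier_TUP torsion_functions_def by blast
  then have "{i \<in> I. f i = g i \<and> r \<odot>\<^bsub>M i\<^esub> g i = \<zero>\<^bsub>M i\<^esub>} \<in> U"
    using cls_eq_iff[OF assms g(1)] by (simp add: ultra_Collect_conj)
  then have "{i \<in> I. r \<odot>\<^bsub>M i\<^esub> f i = \<zero>\<^bsub>M i\<^esub>} \<in> U"
    by (rule ultra_Collect_mono) simp
  then show "f \<in> torsion_functions"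
    using assms g(3) by (auto simp: torsion_functions_def)
qed (simp add: carrier_TUP)

lemma TUP_simps:
  "\<zero>\<^bsub>TUP\<^esub> = \<zero>\<^bsub>UP\<^esub>" "A \<oplus>\<^bsub>TUP\<^esub> B = A \<oplus>\<^bsub>UP\<^esub> B" "r \<odot>\<^bsub>TUP\<^esub> A = r \<odot>\<^bsub>UP\<^esub> A" "uneg TUP A = uneg UP A"
  by (simp_all add: torsion_ultraproduct_def)

lemma torsion_fun_zero: "(\<lambda>i\<in>I. \<zero>\<^bsub>M i\<^esub>) \<in> torsion_functions"
proof -
  have "{i \<in> I. \<one> \<odot>\<^bsub>M i\<^esub> (\<lambda>i\<in>I. \<zero>\<^bsub>M i\<^esub>) i = \<zero>\<^bsub>M i\<^esub>} = I"
    using module.smult_r_null[OF module_in_family] by auto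
  then show ?thesis
    using ultra_whole by (intro torsion_functionsI[of _ \<one>] fun_zero) (simp, simp only:)
qed

lemma torsion_fun_add:
  assumes "f \<in> torsion_functions" "g \<in> torsion_functions"
  shows "(\<lambda>i\<in>I. f i \<oplus>\<^bsub>M i\<^esub> g i) \<in> torsion_functions"
proof -
  obtain r where r: "r \<in> carrier R - {\<zero>}" "{i \<in> I. r \<odot>\<^bsub>M i\<^esub> f i = \<zero>\<^bsub>M i\<^esub>} \<in> U"
    using assms(1) by (auto simp: torsion_functions_def)
  obtain q where q: "q \<in> carrier R - {\<zero>}" "{i \<in> I. q \<odot>\<^bsub>M i\<^esub> g i = \<zero>\<^bsub>M i\<^esub>} \<in> U"
    using assms(2) by (auto simp: torsion_functions_def)
  have "{i \<in> I. r \<odot>\<^bsub>M i\<^esub> f i = \<zero>\<^bsub>M i\<^esub> \<and> q \<odot>\<^bsub>M i\<^esub> g i = \<zero>\<^bsub>M i\<^esub>} \<in> U"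
    using r q by (simp add: ultra_Collect_conj)
  then have "{i \<in> I. (q \<otimes> r) \<odot>\<^bsub>M i\<^esub> (\<lambda>i\<in>I. f i \<oplus>\<^bsub>M i\<^esub> g i) i = \<zero>\<^bsub>M i\<^esub>} \<in> U"
  proof (rule ultra_Collect_mono)
    fix i assume i: "i \<in> I" and *: "r \<odot>\<^bsub>M i\<^esub> f i = \<zero>\<^bsub>M i\<^esub> \<and> q \<odot>\<^bsub>M i\<^esub> g i = \<zero>\<^bsub>M i\<^esub>"
    interpret Mi: module R "M i"
      by (rule module_in_family[OF i])
    have c: "f i \<in> carrier (M i)" "g i \<in> carrier (M i)"
      using choice_functionsD[OF torsion_functions_subset i] assms by auto
    have "(q \<otimes> r) \<odot>\<^bsub>M i\<^esub> f i = q \<odot>\<^bsub>M i\<^esub> (r \<odot>\<^bsub>M i\<^esub> f i)"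
      using c r q by (simp add: Mi.smult_assoc1)
    moreover have "(q \<otimes> r) \<odot>\<^bsub>M i\<^esub> g i = r \<odot>\<^bsub>M i\<^esub> (q \<odot>\<^bsub>M i\<^esub> g i)"
      using c r q by (simp add: m_comm[of q r] Mi.smult_assoc1)
    ultimately show "(q \<otimes> r) \<odot>\<^bsub>M i\<^esub> (\<lambda>i\<in>I. f i \<oplus>\<^bsub>M i\<^esub> g i) i = \<zero>\<^bsub>M i\<^esub>"
      using i c r q * by (simp add: Mi.smult_r_distr)
  qed
  moreover have "q \<otimes> r \<in> carrier R - {\<zero>}"
    using r q by (auto simp: integral_iff)
  ultimately show ?thesis
    using torsion_functionsI[OF fun_add[OF assms[THEN torsion_functions_subset]]] by blast
qed

lemma torsion_fun_smult:
  assumes "f \<in> torsion_functions" "q \<in> carrier R"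
  shows "(\<lambda>i\<in>I. q \<odot>\<^bsub>M i\<^esub> f i) \<in> torsion_functions"
proof -
  obtain r where r: "r \<in> carrier R - {\<zero>}" "{i \<in> I. r \<odot>\<^bsub>M i\<^esub> f i = \<zero>\<^bsub>M i\<^esub>} \<in> U"
    using assms(1) by (auto simp: torsion_functions_def)
  from r(2) have "{i \<in> I. r \<odot>\<^bsub>M i\<^esub> (\<lambda>i\<in>I. q \<odot>\<^bsub>M i\<^esub> f i) i = \<zero>\<^bsub>M i\<^esub>} \<in> U"
  proof (rule ultra_Collect_mono)
    fix i assume i: "i \<in> I" and *: "r \<odot>\<^bsub>M i\<^esub> f i = \<zero>\<^bsub>M i\<^esub>"
    interpret Mi: module R "M i"
      by (rule module_in_family[OF i])
    have c: "f i \<in> carrier (M i)"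
      using choice_functionsD[OF torsion_functions_subset[OF assms(1)] i] .
    have "r \<odot>\<^bsub>M i\<^esub> (q \<odot>\<^bsub>M i\<^esub> f i) = q \<odot>\<^bsub>M i\<^esub> (r \<odot>\<^bsub>M i\<^esub> f i)"
      using c r assms(2) by (simp add: m_comm[of r q] flip: Mi.smult_assoc1)
    then show "r \<odot>\<^bsub>M i\<^esub> (\<lambda>i\<in>I. q \<odot>\<^bsub>M i\<^esub> f i) i = \<zero>\<^bsub>M i\<^esub>"
      using i * assms(2) by simp
  qed
  with fun_smult[OF assms(2) torsion_functions_subset[OF assms(1)]] r(1) show ?thesis
    by (rule torsion_functionsI)
qed

lemma uneg_eq_smult:
  assumes "f \<in> choice_functions"
  shows "(\<lambda>i\<in>I. uneg (M i) (f i)) = (\<lambda>i\<in>I. (\<ominus> \<one>) \<odot>\<^bsub>M i\<^esub> f i)"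
proof (rule restrict_ext)
  fix i assume i: "i \<in> I"
  interpret Mi: module R "M i"
    by (rule module_in_family[OF i])
  show "uneg (M i) (f i) = (\<ominus> \<one>) \<odot>\<^bsub>M i\<^esub> f i"
    using choice_functionsD[OF assms i] uneg_in_family[OF i] by (simp add: Mi.smult_l_minus)
qed

lemma torsion_fun_uneg:
  assumes "f \<in> torsion_functions"
  shows "(\<lambda>i\<in>I. uneg (M i) (f i)) \<in> torsion_functions"
  unfolding uneg_eq_smult[OF torsion_functions_subset[OF assms]]
  using assms by (rule torsion_fun_smult) simp

lemmas TUP_rules = TUP_simps UP_zero UP_add UP_smult UP_uneg torsion_functions_subset
  torsion_fun_zero torsion_fun_add torsion_fun_smult torsion_fun_uneg

lemma TUP_structure: "LR_structure R TUP"
  unfolding LR_structure_def carrier_TUP by (auto simp: TUP_rules)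

lemma TUP_substructure: "substructure R TUP UP"
  unfolding substructure_def using TUP_structure UP_structure
  by (auto simp: TUP_simps carrier_TUP carrier_UP torsion_functions_subset)

section \<open>Module laws in the torsion ultraproduct\<close>

lemma TUP_l_neg:
  assumes "x \<in> carrier TUP"
  shows "uneg TUP x \<oplus>\<^bsub>TUP\<^esub> x = \<zero>\<^bsub>TUP\<^esub>"
proof -
  obtain f where x: "x = cls f" and f: "f \<in> torsion_functions"
    using assms unfolding carrier_TUP by blast
  have ag: "abelian_group (M i)" if "i \<in> I" for i
    using module.axioms(2)[OF module_in_family[OF that]] .
  have "(\<lambda>i\<in>I. (\<lambda>i\<in>I. uneg (M i) (f i)) i \<oplus>\<^bsub>M i\<^esub> f i) = (\<lambda>i\<in>I. \<zero>\<^bsub>M i\<^esub>)"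
    using choice_functionsD[OF torsion_functions_subset[OF f]] abelian_group.l_neg[OF ag] uneg_in_family
    by (intro restrict_ext) auto
  then show ?thesis
    using f unfolding x by (simp add: TUP_rules)
qed

text \<open>The laws are checked on representatives, where both sides are the same function at every
  index and not merely on a set of \<open>U\<close>.\<close>

lemma TUP_abelian_group: "abelian_group TUP"
proof (rule abelian_groupI)
  fix x y z assume xyz: "x \<in> carrier TUP" "y \<in> carrier TUP" "z \<in> carrier TUP"
  obtain f g h where x: "x = cls f" and y: "y = cls g" and z: "z = cls h"
    and f: "f \<in> torsion_functions" and g: "g \<in> torsion_functions" and h: "h \<in> torsion_functions"
    using xyz unfolding carrier_TUP by blast
  have c: "f i \<in> carrier (M i)" "g i \<in> carrier (M i)" "h i \<in> carrier (M i)" if "i \<in> I" for i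
    using choice_functionsD[OF torsion_functions_subset that] f g h by auto
  have ag: "abelian_group (M i)" if "i \<in> I" for i
    using module.axioms(2)[OF module_in_family[OF that]] .
  show "x \<oplus>\<^bsub>TUP\<^esub> y \<oplus>\<^bsub>TUP\<^esub> z = x \<oplus>\<^bsub>TUP\<^esub> (y \<oplus>\<^bsub>TUP\<^esub> z)"
    using f g h c ag unfolding x y z
    by (auto simp: TUP_rules abelian_group_def abelian_monoid.a_assoc cong: restrict_cong)
next
  fix x y assume xy: "x \<in> carrier TUP" "y \<in> carrier TUP"
  obtain f g where x: "x = cls f" and y: "y = cls g"
    and f: "f \<in> torsion_functions" and g: "g \<in> torsion_functions"
    using xy unfolding carrier_TUP by blast
  have c: "f i \<in> carrier (M i)" "g i \<in> carrier (M i)" if "i \<in> I" for i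
    using choice_functionsD[OF torsion_functions_subset that] f g by auto
  have ag: "abelian_group (M i)" if "i \<in> I" for i
    using module.axioms(2)[OF module_in_family[OF that]] .
  show "x \<oplus>\<^bsub>TUP\<^esub> y \<in> carrier TUP"
    using f g unfolding x y carrier_TUP by (auto simp: TUP_rules)
  have "(\<lambda>i\<in>I. f i \<oplus>\<^bsub>M i\<^esub> g i) = (\<lambda>i\<in>I. g i \<oplus>\<^bsub>M i\<^esub> f i)"
    using c abelian_monoid.a_comm[OF abelian_group.axioms(1)[OF ag]] by (intro restrict_ext) auto
  then show "x \<oplus>\<^bsub>TUP\<^esub> y = y \<oplus>\<^bsub>TUP\<^esub> x"
    using f g unfolding x y by (simp add: TUP_rules)
next
  show "\<zero>\<^bsub>TUP\<^esub> \<in> carrier TUP"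
    unfolding carrier_TUP by (simp add: TUP_rules)
next
  fix x assume "x \<in> carrier TUP"
  then obtain f where x: "x = cls f" and f: "f \<in> torsion_functions"
    unfolding carrier_TUP by blast
  have c: "f i \<in> carrier (M i)" if "i \<in> I" for i
    using choice_functionsD[OF torsion_functions_subset that] f by auto
  have ag: "abelian_group (M i)" if "i \<in> I" for i
    using module.axioms(2)[OF module_in_family[OF that]] .
  have "(\<lambda>i\<in>I. (\<lambda>i\<in>I. \<zero>\<^bsub>M i\<^esub>) i \<oplus>\<^bsub>M i\<^esub> f i) = (\<lambda>i\<in>I. f i)"
    using c abelian_monoid.l_zero[OF abelian_group.axioms(1)[OF ag]] by (intro restrict_ext) auto
  also have "\<dots> = f"
    using torsion_functions_subset[OF f] by (simp add: prod_carrier_def PiE_restrict)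
  finally show "\<zero>\<^bsub>TUP\<^esub> \<oplus>\<^bsub>TUP\<^esub> x = x"
    using f unfolding x by (simp add: TUP_rules)
  show "\<exists>y\<in>carrier TUP. y \<oplus>\<^bsub>TUP\<^esub> x = \<zero>\<^bsub>TUP\<^esub>"
    using TUP_l_neg[of x] TUP_structure \<open>x \<in> carrier TUP\<close> unfolding LR_structure_def by blast
qed

lemma TUP_uneg:
  assumes "x \<in> carrier TUP"
  shows "uneg TUP x = \<ominus>\<^bsub>TUP\<^esub> x"
  using abelian_group.minus_equality[OF TUP_abelian_group] TUP_l_neg[OF assms] assms TUP_structure
  by (simp add: LR_structure_def)

lemma TUP_module: "module R TUP"
proof (rule moduleI[OF is_cring TUP_abelian_group])
  fix a x assume a: "a \<in> carrier R" and "x \<in> carrier TUP"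
  then obtain f where x: "x = cls f" and f: "f \<in> torsion_functions"
    unfolding carrier_TUP by blast
  have c: "f i \<in> carrier (M i)" if "i \<in> I" for i
    using choice_functionsD[OF torsion_functions_subset that] f by auto
  show "a \<odot>\<^bsub>TUP\<^esub> x \<in> carrier TUP"
    using a f unfolding x carrier_TUP by (simp add: TUP_rules)
  {
    fix b assume b: "b \<in> carrier R"
    have "(\<lambda>i\<in>I. (a \<oplus> b) \<odot>\<^bsub>M i\<^esub> f i) = (\<lambda>i\<in>I. (\<lambda>i\<in>I. a \<odot>\<^bsub>M i\<^esub> f i) i \<oplus>\<^bsub>M i\<^esub> (\<lambda>i\<in>I. b \<odot>\<^bsub>M i\<^esub> f i) i)"
      using a b c module.smult_l_distr[OF module_in_family] by (intro restrict_ext) auto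
    then show "(a \<oplus> b) \<odot>\<^bsub>TUP\<^esub> x = a \<odot>\<^bsub>TUP\<^esub> x \<oplus>\<^bsub>TUP\<^esub> b \<odot>\<^bsub>TUP\<^esub> x"
      using a b f unfolding x by (simp add: TUP_rules)
    have "(\<lambda>i\<in>I. (a \<otimes> b) \<odot>\<^bsub>M i\<^esub> f i) = (\<lambda>i\<in>I. a \<odot>\<^bsub>M i\<^esub> (\<lambda>i\<in>I. b \<odot>\<^bsub>M i\<^esub> f i) i)"
      using a b c module.smult_assoc1[OF module_in_family] by (intro restrict_ext) auto
    then show "(a \<otimes> b) \<odot>\<^bsub>TUP\<^esub> x = a \<odot>\<^bsub>TUP\<^esub> (b \<odot>\<^bsub>TUP\<^esub> x)"
      using a b f unfolding x by (simp add: TUP_rules)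
  next
    fix y assume "y \<in> carrier TUP"
    then obtain g where y: "y = cls g" and g: "g \<in> torsion_functions"
      unfolding carrier_TUP by blast
    have d: "g i \<in> carrier (M i)" if "i \<in> I" for i
      using choice_functionsD[OF torsion_functions_subset that] g by auto
    have "(\<lambda>i\<in>I. a \<odot>\<^bsub>M i\<^esub> (\<lambda>i\<in>I. f i \<oplus>\<^bsub>M i\<^esub> g i) i) =
      (\<lambda>i\<in>I. (\<lambda>i\<in>I. a \<odot>\<^bsub>M i\<^esub> f i) i \<oplus>\<^bsub>M i\<^esub> (\<lambda>i\<in>I. a \<odot>\<^bsub>M i\<^esub> g i) i)"
      using a c d module.smult_r_distr[OF module_in_family] by (intro restrict_ext) auto
    then show "a \<odot>\<^bsub>TUP\<^esub> (x \<oplus>\<^bsub>TUP\<^esub> y) = a \<odot>\<^bsub>TUP\<^esub> x \<oplus>\<^bsub>TUP\<^esub> a \<odot>\<^bsub>TUP\<^esub> y"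
      using a f g unfolding x y by (simp add: TUP_rules)
  }
next
  fix x assume "x \<in> carrier TUP"
  then obtain f where x: "x = cls f" and f: "f \<in> torsion_functions"
    unfolding carrier_TUP by blast
  have c: "f i \<in> carrier (M i)" if "i \<in> I" for i
    using choice_functionsD[OF torsion_functions_subset that] f by auto
  have "(\<lambda>i\<in>I. \<one> \<odot>\<^bsub>M i\<^esub> f i) = (\<lambda>i\<in>I. f i)"
    using c module.smult_one[OF module_in_family] by (intro restrict_ext) auto
  also have "\<dots> = f"
    using torsion_functions_subset[OF f] by (simp add: prod_carrier_def PiE_restrict)
  finally show "\<one> \<odot>\<^bsub>TUP\<^esub> x = x"
    using f unfolding x by (simp add: TUP_rules)
qed

lemma TUP_torsion: "torsion_module R TUP"
  unfolding torsion_module_def R_module_def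
proof (intro conjI ballI TUP_module TUP_uneg)
  fix m assume "m \<in> carrier TUP"
  then obtain f where m: "m = cls f" and f: "f \<in> torsion_functions"
    unfolding carrier_TUP by blast
  obtain r where r: "r \<in> carrier R - {\<zero>}" "{i \<in> I. r \<odot>\<^bsub>M i\<^esub> f i = \<zero>\<^bsub>M i\<^esub>} \<in> U"
    using f by (auto simp: torsion_functions_def)
  have "{i \<in> I. (\<lambda>i\<in>I. r \<odot>\<^bsub>M i\<^esub> f i) i = (\<lambda>i\<in>I. \<zero>\<^bsub>M i\<^esub>) i} \<in> U"
    using r(2) by (rule ultra_Collect_mono) simp
  then have "r \<odot>\<^bsub>TUP\<^esub> m = \<zero>\<^bsub>TUP\<^esub>"
    unfolding m using f r(1) by (simp add: TUP_rules cls_eq_iff fun_zero fun_smult)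
  then show "tor_ann R TUP m \<noteq> {}"
    using r(1) by (auto simp: tor_ann_def regular_iff)
qed

section \<open>Values of terms in the torsion ultraproduct\<close>

definition term_function :: "(nat \<Rightarrow> 'i \<Rightarrow> 'm) \<Rightarrow> 'r LR_term \<Rightarrow> 'i \<Rightarrow> 'm" where
  "term_function F t = (\<lambda>i\<in>I. term_val (M i) (\<lambda>k. F k i) t)"

lemma term_function_simps:
  "F k \<in> choice_functions \<Longrightarrow> term_function F (Var k) = F k"
  "term_function F Zero = (\<lambda>i\<in>I. \<zero>\<^bsub>M i\<^esub>)"
  "term_function F (Plus s t) = (\<lambda>i\<in>I. term_function F s i \<oplus>\<^bsub>M i\<^esub> term_function F t i)"
  "term_function F (Uminus t) = (\<lambda>i\<in>I. uneg (M i) (term_function F t i))"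
  "term_function F (Scal r t) = (\<lambda>i\<in>I. r \<odot>\<^bsub>M i\<^esub> term_function F t i)"
  by (auto simp: term_function_def prod_carrier_def PiE_def extensional_def restrict_def fun_eq_iff)

lemma TUP_term_val:
  assumes "\<forall>k. F k \<in> torsion_functions" "set_LR_term t \<subseteq> carrier R"
  shows "term_function F t \<in> torsion_functions \<and>
    term_val TUP (\<lambda>k. cls (F k)) t = cls (term_function F t)"
  using assms(2)
proof (induction t)
  case (Var k)
  have "F k \<in> choice_functions"
    using assms(1) torsion_functions_subset by blast
  then show ?case
    using assms(1) by (simp add: term_function_simps)
next
  case Zero
  show ?case
    by (simp only: term_val.simps term_function_simps TUP_simps UP_zero torsion_fun_zero simp_thms)
next
  case (Plus s t)
  then have IH: "term_function F s \<in> torsion_functions" "term_function F t \<in> torsion_functions"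
    "term_val TUP (\<lambda>k. cls (F k)) s = cls (term_function F s)"
    "term_val TUP (\<lambda>k. cls (F k)) t = cls (term_function F t)"
    by auto
  show ?case
    by (simp only: term_val.simps term_function_simps TUP_simps IH torsion_functions_subset
        UP_add torsion_fun_add simp_thms)
next
  case (Uminus t)
  then have IH: "term_function F t \<in> torsion_functions"
    "term_val TUP (\<lambda>k. cls (F k)) t = cls (term_function F t)"
    by auto
  show ?case
    by (simp only: term_val.simps term_function_simps TUP_simps IH torsion_functions_subset
        UP_uneg torsion_fun_uneg simp_thms)
next
  case (Scal r t)
  then have IH: "term_function F t \<in> torsion_functions"
    "term_val TUP (\<lambda>k. cls (F k)) t = cls (term_function F t)" "r \<in> carrier R"
    by auto
  show ?case
    by (simp only: term_val.simps term_function_simps TUP_simps IH torsion_functions_subset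
        UP_smult torsion_fun_smult simp_thms)
qed

end

section \<open>The theorem of Los\<close>

locale equivalent_family = module_family R I U M + principal_domain R
  for R :: "('r, 'x) ring_scheme" (structure)
    and I :: "'i set" and U :: "'i set set" and M :: "'i \<Rightarrow> ('r, 'm) LR_struct" +
  fixes T :: "'r LR_form set"
  assumes torsion: "i \<in> I \<Longrightarrow> torsion_module R (M i)"
    and complete: "complete_theory R T"
    and models: "i \<in> I \<Longrightarrow> is_model R (M i) T"
begin

text \<open>The scalar is found in one factor, where it may depend on everything about that module.
  Once it is fixed, the bound is a sentence, and completeness makes it true in the other
  factors.\<close>

lemma uniform_witness_bound:
  assumes "LR_formula R \<phi>" "s \<in> carrier R - {\<zero>}" "free_vars \<phi> - {k} \<subseteq> {..<n}"
  shows "\<exists>r\<in>carrier R - {\<zero>}. \<forall>i\<in>I. true_in (M i) (witness_bound s r n k \<phi>)"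
proof -
  obtain i0 where i0: "i0 \<in> I"
    using ultra_nonempty[OF ultra_whole] by blast
  interpret M0: torsion_pid_module R "M i0"
  proof (intro torsion_pid_module.intro pid_module.intro torsion_pid_module_axioms.intro)
    show "module R (M i0)"
      by (rule module_in_family[OF i0])
    show "\<exists>r\<in>carrier R - {\<zero>}. r \<odot>\<^bsub>M i0\<^esub> m = \<zero>\<^bsub>M i0\<^esub>" if "m \<in> carrier (M i0)" for m
      using torsion[OF i0] that unfolding torsion_module_def tor_ann_def regular_iff by blast
  qed (rule principal_domain_axioms)
  obtain r where r: "r \<in> carrier R - {\<zero>}" "true_in (M i0) (witness_bound s r n k \<phi>)"
    using M0.witness_bound_exists[OF uneg_in_family[OF i0] assms] by blast
  have "LR_sentence R (witness_bound s r n k \<phi>)"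
    by (rule LR_sentence_witness_bound) (use assms r(1) in auto)
  then have "true_in (M i) (witness_bound s r n k \<phi>)" if "i \<in> I" for i
    using true_in_complete_theory[OF complete models] i0 that r(2) by blast
  then show ?thesis
    using r(1) by blast
qed

text \<open>Every variable is assigned a torsion function, which updating by a torsion function
  preserves. The cases are classical except for passing from witnesses in the factors to one in the
  torsion ultraproduct, where the annihilator must not vary with the index.\<close>

lemma los:
  assumes "LR_formula R \<phi>" "\<forall>k. F k \<in> torsion_functions"
  shows "{i \<in> I. sat (M i) (\<lambda>k. F k i) \<phi>} \<in> U \<longleftrightarrow> sat TUP (\<lambda>k. cls (F k)) \<phi>"
  using assms
proof (induction \<phi> arbitrary: F)
  case (Eq s t)
  let ?f = "term_function F s" and ?g = "term_function F t"
  have st: "set_LR_term s \<subseteq> carrier R" "set_LR_term t \<subseteq> carrier R"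
    using Eq.prems(1) by (auto simp: LR_formula_def)
  note fg = TUP_term_val[OF Eq.prems(2) st(1)] TUP_term_val[OF Eq.prems(2) st(2)]
  have "sat TUP (\<lambda>k. cls (F k)) (Eq s t) \<longleftrightarrow> cls ?f = cls ?g"
    using fg by simp
  also have "\<dots> \<longleftrightarrow> {i \<in> I. ?f i = ?g i} \<in> U"
    using fg torsion_functions_subset by (intro cls_eq_iff) auto
  also have "{i \<in> I. ?f i = ?g i} = {i \<in> I. sat (M i) (\<lambda>k. F k i) (Eq s t)}"
    by (auto simp: term_function_def)
  finally show ?case by simp
next
  case (Neg \<phi>)
  then show ?case
    by (simp add: ultra_Collect_not LR_formula_def)
next
  case (Conj \<phi> \<psi>)
  then show ?case
    by (simp add: ultra_Collect_conj LR_formula_def)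
next
  case (Exi k \<phi>)
  have \<phi>: "LR_formula R \<phi>"
    using Exi.prems(1) by (simp add: LR_formula_def)
  have upd: "(\<lambda>j. (G(k := f)) j i) = (\<lambda>j. G j i)(k := f i)"
    "(\<lambda>j. cls ((G(k := f)) j)) = (\<lambda>j. cls (G j))(k := cls f)" for G :: "nat \<Rightarrow> 'i \<Rightarrow> 'm" and f i
    by (rule ext, simp)+
  show ?case
  proof
    assume "sat TUP (\<lambda>k. cls (F k)) (Exi k \<phi>)"
    then obtain f where f: "f \<in> torsion_functions" "sat TUP ((\<lambda>k. cls (F k))(k := cls f)) \<phi>"
      by (auto simp: carrier_TUP)
    have "\<forall>j. (F(k := f)) j \<in> torsion_functions"
      using f(1) Exi.prems(2) by simp
    then have "{i \<in> I. sat (M i) ((\<lambda>j. F j i)(k := f i)) \<phi>} \<in> U"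
      using Exi.IH[OF \<phi>, of "F(k := f)"] f(2) unfolding upd by blast
    then show "{i \<in> I. sat (M i) (\<lambda>k. F k i) (Exi k \<phi>)} \<in> U"
      by (rule ultra_Collect_mono)
        (use choice_functionsD[OF torsion_functions_subset[OF f(1)]] in auto)
  next
    assume ex: "{i \<in> I. sat (M i) (\<lambda>k. F k i) (Exi k \<phi>)} \<in> U"
    \<comment> \<open>The variables not free in \<phi> are reset to zero, so that a single scalar
      kills every coordinate below \<open>n\<close>, as the witness bound demands.\<close>
    define G where "G j = (if j \<in> free_vars \<phi> then F j else (\<lambda>i\<in>I. \<zero>\<^bsub>M i\<^esub>))" for j
    have G: "\<forall>j. G j \<in> torsion_functions"
      using Exi.prems(2) by (simp add: G_def torsion_fun_zero)
    \<comment> \<open>\<open>k\<close> is included where it is free in \<phi>, since the premise of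
      the bound covers every variable below \<open>n\<close>.\<close>
    have "\<exists>s\<in>carrier R - {\<zero>}. \<forall>j\<in>free_vars \<phi>. {i \<in> I. s \<odot>\<^bsub>M i\<^esub> F j i = \<zero>\<^bsub>M i\<^esub>} \<in> U"
    proof (rule uniform_scalar[OF finite_free_vars])
      show "\<exists>s\<in>carrier R - {\<zero>}. {i \<in> I. s \<odot>\<^bsub>M i\<^esub> F j i = \<zero>\<^bsub>M i\<^esub>} \<in> U" for j
        using Exi.prems(2) by (auto simp: torsion_functions_def)
      fix j q r assume *: "{i \<in> I. r \<odot>\<^bsub>M i\<^esub> F j i = \<zero>\<^bsub>M i\<^esub>} \<in> U" "q \<in> carrier R" "r \<in> carrier R"
      from *(1) show "{i \<in> I. (q \<otimes> r) \<odot>\<^bsub>M i\<^esub> F j i = \<zero>\<^bsub>M i\<^esub>} \<in> U"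
      proof (rule ultra_Collect_mono)
        fix i assume i: "i \<in> I" "r \<odot>\<^bsub>M i\<^esub> F j i = \<zero>\<^bsub>M i\<^esub>"
        have "F j i \<in> carrier (M i)"
          using choice_functionsD[OF torsion_functions_subset i(1)] Exi.prems(2) by blast
        then show "(q \<otimes> r) \<odot>\<^bsub>M i\<^esub> F j i = \<zero>\<^bsub>M i\<^esub>"
          using *(2,3) i module.smult_assoc1[OF module_in_family[OF i(1)]]
            module.smult_r_null[OF module_in_family[OF i(1)]] by simp
      qed
    qed
    then obtain s where s: "s \<in> carrier R - {\<zero>}"
      "\<And>j. j \<in> free_vars \<phi> \<Longrightarrow> {i \<in> I. s \<odot>\<^bsub>M i\<^esub> F j i = \<zero>\<^bsub>M i\<^esub>} \<in> U"
      by blast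
    obtain n where n: "free_vars \<phi> \<subseteq> {..<n}"
      using finite_nat_iff_bounded finite_free_vars by blast
    have "free_vars \<phi> - {k} \<subseteq> {..<n}"
      using n by blast
    from uniform_witness_bound[OF \<phi> s(1) this] obtain r where r: "r \<in> carrier R - {\<zero>}"
      "\<forall>i\<in>I. true_in (M i) (witness_bound s r n k \<phi>)"
      by blast
    \<comment> \<open>Finitely many sets of \<open>U\<close> meet in a set of \<open>U\<close>; on
      this one a witness exists and \<open>s\<close> kills all relevant parameters.\<close>
    define X where "X = {i \<in> I. sat (M i) (\<lambda>k. F k i) (Exi k \<phi>) \<and>
      (\<forall>j\<in>free_vars \<phi>. s \<odot>\<^bsub>M i\<^esub> F j i = \<zero>\<^bsub>M i\<^esub>)}"
    have X: "X \<in> U"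
      unfolding X_def ultra_Collect_conj by (intro conjI ex ultra_Collect_ball finite_free_vars s(2))
    have "\<exists>y\<in>carrier (M i). r \<odot>\<^bsub>M i\<^esub> y = \<zero>\<^bsub>M i\<^esub> \<and> sat (M i) ((\<lambda>j. G j i)(k := y)) \<phi>" if i: "i \<in> X" for i
    proof -
      have iI: "i \<in> I"
        using i by (simp add: X_def)
      define v where "v j = (if j \<in> free_vars \<phi> then F j i else \<zero>\<^bsub>M i\<^esub>)" for j
      have vG: "v = (\<lambda>j. G j i)"
        using iI by (auto simp: v_def G_def)
      have v1: "v \<in> assignments (M i)"
        using choice_functionsD[OF torsion_functions_subset iI] G unfolding vG by blast
      have v2: "\<forall>j<n. s \<odot>\<^bsub>M i\<^esub> v j = \<zero>\<^bsub>M i\<^esub>"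
        using i s(1) module.smult_r_null[OF module_in_family[OF iI]] by (auto simp: v_def X_def)
      have v3: "sat (M i) v (Exi k \<phi>)"
      proof -
        have "sat (M i) v (Exi k \<phi>) \<longleftrightarrow> sat (M i) (\<lambda>j. F j i) (Exi k \<phi>)"
          by (rule sat_cong) (auto simp: v_def)
        then show ?thesis
          using i by (simp add: X_def)
      qed
      show ?thesis
        using mp[OF mp[OF bspec[OF bspec[OF r(2) iI, unfolded true_in_witness_bound] v1] v2] v3]
        unfolding vG .
    qed
    then have "\<forall>i\<in>X. \<exists>y. y \<in> carrier (M i) \<and> r \<odot>\<^bsub>M i\<^esub> y = \<zero>\<^bsub>M i\<^esub> \<and> sat (M i) ((\<lambda>j. G j i)(k := y)) \<phi>"
      by blast
    then obtain y where y: "\<forall>i\<in>X. y i \<in> carrier (M i) \<and> r \<odot>\<^bsub>M i\<^esub> y i = \<zero>\<^bsub>M i\<^esub> \<and>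
        sat (M i) ((\<lambda>j. G j i)(k := y i)) \<phi>"
      by (rule bchoice[THEN exE])
    \<comment> \<open>Outside \<open>X\<close> the value zero only keeps the function in the
      product.\<close>
    define f where "f = (\<lambda>i\<in>I. if i \<in> X then y i else \<zero>\<^bsub>M i\<^esub>)"
    have XI: "X \<subseteq> I"
      by (auto simp: X_def)
    have f: "f \<in> torsion_functions"
    proof -
      have "f i \<in> carrier (M i)" if "i \<in> I" for i
        using that y choice_functionsD[OF fun_zero that] by (auto simp: f_def)
      then have "f \<in> choice_functions"
        unfolding prod_carrier_def by (intro PiE_I) (auto simp: f_def)
      moreover have "{i \<in> I. r \<odot>\<^bsub>M i\<^esub> f i = \<zero>\<^bsub>M i\<^esub>} \<in> U"
        using y XI by (intro ultra_superset[OF X]) (auto simp: f_def)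
      ultimately show ?thesis
        using r(1) by (intro torsion_functionsI)
    qed
    have "{i \<in> I. sat (M i) (\<lambda>j. (G(k := f)) j i) \<phi>} \<in> U"
      unfolding upd using y XI by (intro ultra_superset[OF X]) (auto simp: f_def)
    moreover have "\<forall>j. (G(k := f)) j \<in> torsion_functions"
      using G f by simp
    ultimately have "sat TUP ((\<lambda>j. cls (G j))(k := cls f)) \<phi>"
      using Exi.IH[OF \<phi>, of "G(k := f)"] unfolding upd by blast
    moreover have "sat TUP ((\<lambda>j. cls (G j))(k := cls f)) \<phi> \<longleftrightarrow> sat TUP ((\<lambda>j. cls (F j))(k := cls f)) \<phi>"
      by (rule sat_cong) (auto simp: G_def)
    ultimately show "sat TUP (\<lambda>k. cls (F k)) (Exi k \<phi>)"
      using f by (auto simp: carrier_TUP)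
  qed
qed

end

theorem theorem5p10:
  fixes R :: "('r, 'x) ring_scheme"
    and T :: "'r LR_form set"
    and I :: "'i set"
    and U :: "'i set set"
    and M :: "'i \<Rightarrow> ('r, 'm) LR_struct"
  assumes "principal_domain R"
    and "complete_theory R T"
    and "extends_theory R T (module_theory R)"
    and "\<And>i. i \<in> I \<Longrightarrow> torsion_module R (M i)"
    and "\<And>i. i \<in> I \<Longrightarrow> is_model R (M i) T"
    and "ultrafilter_on I U"
  shows "substructure R (torsion_ultraproduct R I U M) (ultraproduct I U M) \<and>
    torsion_module R (torsion_ultraproduct R I U M) \<and>
    (\<forall>(n::nat) (\<phi>::'r LR_form) (f::nat \<Rightarrow> 'i \<Rightarrow> 'm).
       LR_formula R \<phi> \<longrightarrow> free_vars \<phi> \<subseteq> {..<n} \<longrightarrow>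
       (\<forall>k<n. f k \<in> prod_carrier I M \<and>
              ultra_class I U M (f k) \<in> carrier (torsion_ultraproduct R I U M)) \<longrightarrow>
       ({i\<in>I. sat (M i) (\<lambda>k. f k i) \<phi>} \<in> U \<longleftrightarrow>
        sat (torsion_ultraproduct R I U M) (\<lambda>k. ultra_class I U M (f k)) \<phi>))"
proof -
  interpret R: principal_domain R
    by (rule assms(1))
  interpret equivalent_family R I U M T
    using assms by unfold_locales (auto simp: torsion_module_def)
  have "{i\<in>I. sat (M i) (\<lambda>k. f k i) \<phi>} \<in> U \<longleftrightarrow> sat TUP (\<lambda>k. cls (f k)) \<phi>"
    if \<phi>: "LR_formula R \<phi>" "free_vars \<phi> \<subseteq> {..<n}" and
      f: "\<forall>k<n. f k \<in> choice_functions \<and> cls (f k) \<in> carrier TUP"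
    for n \<phi> and f :: "nat \<Rightarrow> 'i \<Rightarrow> 'm"
  proof -
    \<comment> \<open>Only the first \<open>n\<close> functions are known to be torsion, while
      \<open>los\<close> asks for all; zero fills the rest without affecting \<phi>.\<close>
    define F where "F k = (if k < n then f k else (\<lambda>i\<in>I. \<zero>\<^bsub>M i\<^esub>))" for k
    have F: "\<forall>k. F k \<in> torsion_functions"
      using f torsion_fun_zero by (auto simp: F_def cls_in_TUP)
    have "sat (M i) (\<lambda>k. f k i) \<phi> \<longleftrightarrow> sat (M i) (\<lambda>k. F k i) \<phi>" for i
      using \<phi>(2) by (intro sat_cong) (auto simp: F_def)
    moreover have "sat TUP (\<lambda>k. cls (f k)) \<phi> \<longleftrightarrow> sat TUP (\<lambda>k. cls (F k)) \<phi>"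
      using \<phi>(2) by (intro sat_cong) (auto simp: F_def)
    ultimately show ?thesis
      using los[OF \<phi>(1) F] by simp
  qed
  then show ?thesis
    using TUP_substructure TUP_torsion by blast
qed

end
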